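(* Let $(P,\Lambda,F)$ be a smooth projective plane of dimension $2n$, and let $(\vartheta^\mu,\omega^\mu,\pi^\mu)_{\mu=1,\dots,n}$ be any adapted coframing on an open subset of $F$. Then one can write $d\vartheta^\mu=-\varpi^\mu_\nu\wedge\omega^\nu$ modulo $\vartheta^1,\dots,\vartheta^n$, where the $1$-forms $\varpi^\mu_\nu$ (combinations of the $\pi$ and $\omega$ $1$-forms) have the form $\varpi^\mu_\nu=t^\mu_{\nu\sigma}\pi^\sigma$ for some functions $t^\mu_{\nu\sigma}$. The bilinear map $t:\mathbb{R}^n\otimes\mathbb{R}^n\to\mathbb{R}^n$, $t^\mu(u,v)=t^\mu_{\nu\sigma}u^\nu v^\sigma$ (the tableau of the adapted coframing) is a triality at a point of $F$ in the domain of the coframing if and only if the projective plane is regular at that point.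
   Context: A projective plane is a triple $(P,\Lambda,F)$ of a set $P$ of points, a set $\Lambda$ of lines and $F\subset P\times\Lambda$ ($p$ is on $\lambda$ if $(p,\lambda)\in F$) such that any two distinct points are on a unique line $p_1p_2$, any two distinct lines have a unique common point $\lambda_1\lambda_2$, and there are 4 points with no three on a line. It is smooth if $P,\Lambda$ are compact smooth manifolds, $F\subset P\times\Lambda$ is a smooth embedded submanifold, and the maps $(p_1,p_2)\mapsto p_1p_2$, $(\lambda_1,\lambda_2)\mapsto\lambda_1\lambda_2$ are smooth on pairs of distinct elements. Dimension: $\dim P=\dim\Lambda=2n$, $\dim F=3n$; the projections $\pi_P:F\to P$, $\pi_\Lambda:F\to\Lambda$ are submersions. $\bar\lambda\subset P$ is the $n$-dimensional submanifold of points on $\lambda$, and $\bar p\subset\Lambda$ the $n$-dimensional submanifold of lines through $p$. The polycontact plane field on $F$ is the rank $2n$ bundle $\Theta=\ker\pi_P'\oplus\ker\pi_\Lambda'\subset TF$. An adapted coframing is a choice of $3n$ linearly independent $1$-forms $\vartheta^\mu,\omega^\mu,\pi^\mu$ on an open subset of $F$ such that the $\vartheta^\mu,\omega^\mu$ are semibasic for $F\to P$, the $\vartheta^\mu,\pi^\mu$ are semibasic for $F\to\Lambda$, and $\Theta=\{\vartheta^1=\dots=\vartheta^n=0\}$ (a $1$-form is semibasic for a submersion if it vanishes on the kernel of its differential). Summation convention is used. A bilinear map $t:U\otimes V\to W$ with $\dim U=\dim V=\dim W$ is a triality if $t(u,v)\neq0$ whenever $u\ne0$ and $v\neq 0$.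 Regularity at $(p_0,\lambda_0)\in F$: the map $\bar p_0\to\widetilde{\mathrm{Gr}}(n,T_{p_0}P)$, $\lambda\mapsto T_{p_0}\bar\lambda$, into the Grassmannian of (oriented) $n$-planes is, at $\lambda=\lambda_0$, transverse to $\widetilde{\mathrm{Gr}}_\ell(n,T_{p_0}P)$, the submanifold of $n$-planes containing $\ell$, for every real line $\ell\subset T_{p_0}\bar\lambda_0$. The plane is regular if this holds at every point of $F$. *)

theory Defs
  imports "HOL-Analysis.Analysis"
begin

section \<open>Smooth manifolds\<close>

text \<open>For open \<open>S\<close>: \<open>f\<close> is of class \<open>C\<^sup>k\<close> on \<open>S\<close>.\<close>

primrec Ck_on ::
  "nat \<Rightarrow> 'a::real_normed_vector set \<Rightarrow> ('a \<Rightarrow> 'b::real_normed_vector) \<Rightarrow> bool" where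
  "Ck_on 0 S f \<longleftrightarrow> continuous_on S f"
| "Ck_on (Suc k) S f \<longleftrightarrow> (\<forall>x\<in>S. f differentiable (at x)) \<and>
     (\<forall>v. Ck_on k S (\<lambda>x. frechet_derivative f (at x) v))"

definition smooth_on ::
  "'a::real_normed_vector set \<Rightarrow> ('a \<Rightarrow> 'b::real_normed_vector) \<Rightarrow> bool" where
  "smooth_on S f \<longleftrightarrow> (\<forall>k. Ck_on k S f)"

text \<open>A chart is a pair of its domain and its coordinate map; the map is irrelevant outside the
  domain. The dimension of a manifold is that of its model space \<open>'e\<close>.\<close>

type_synonym ('m, 'e) chart = "'m set \<times> ('m \<Rightarrow> 'e)"

record ('m, 'e) manifold =
  mtop :: "'m topology"
  atlas :: "('m, 'e) chart set"

abbreviation carrier :: "('m, 'e) manifold \<Rightarrow> 'm set" where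
  "carrier M \<equiv> topspace (mtop M)"

definition smooth_manifold :: "('m, 'e::euclidean_space) manifold \<Rightarrow> bool" where
  "smooth_manifold M \<longleftrightarrow>
     Hausdorff_space (mtop M) \<and> second_countable (mtop M) \<and>
     (\<Union>(U, \<phi>)\<in>atlas M. U) = carrier M \<and>
     (\<forall>(U, \<phi>)\<in>atlas M. openin (mtop M) U \<and> open (\<phi> ` U) \<and>
        homeomorphic_map (subtopology (mtop M) U) (top_of_set (\<phi> ` U)) \<phi>) \<and>
     (\<forall>(U, \<phi>)\<in>atlas M. \<forall>(V, \<psi>)\<in>atlas M.
        smooth_on (\<phi> ` (U \<inter> V)) (\<psi> \<circ> inv_into U \<phi>))"

definition euclidean_manifold :: "('e::euclidean_space, 'e) manifold" where
  "euclidean_manifold = \<lparr>mtop = euclidean, atlas = {(UNIV, id)}\<rparr>"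

definition prod_manifold ::
  "('m, 'a) manifold \<Rightarrow> ('n, 'b) manifold \<Rightarrow> ('m \<times> 'n, 'a \<times> 'b) manifold" where
  "prod_manifold M N = \<lparr>mtop = prod_topology (mtop M) (mtop N),
     atlas = {(U \<times> V, map_prod \<phi> \<psi>) | U \<phi> V \<psi>. (U, \<phi>) \<in> atlas M \<and> (V, \<psi>) \<in> atlas N}\<rparr>"

text \<open>\<open>f\<close> is defined and smooth on a neighbourhood, contained in \<open>W\<close>, of each point of \<open>W\<close>;
  in particular \<open>W\<close> is open and \<open>f\<close> is continuous on \<open>W\<close>.\<close>

definition smooth_map_on ::
  "('m, 'a::euclidean_space) manifold \<Rightarrow> ('n, 'b::euclidean_space) manifold \<Rightarrow>
     'm set \<Rightarrow> ('m \<Rightarrow> 'n) \<Rightarrow> bool" where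
  "smooth_map_on M N W f \<longleftrightarrow>
     (\<forall>x\<in>W. \<exists>(U, \<phi>)\<in>atlas M. \<exists>(V, \<psi>)\<in>atlas N. \<exists>D. x \<in> U \<and> open D \<and> \<phi> x \<in> D \<and>
        D \<subseteq> \<phi> ` (U \<inter> W) \<and> (\<forall>y\<in>D. f (inv_into U \<phi> y) \<in> V) \<and>
        smooth_on D (\<psi> \<circ> f \<circ> inv_into U \<phi>))"

text \<open>Once and for all, a chart around each point is selected. The tangent space at \<open>x\<close> of a
  manifold modelled on \<open>'e\<close> is the space \<open>'e\<close>, a tangent vector being represented by its
  coordinates in the selected chart at \<open>x\<close>. Differentials and differential forms are expressed
  in these coordinates, pointwise; since the selected chart need not depend continuously on the
  point, smoothness of forms is tested in a single chart near each point.\<close>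

definition chart_at :: "('m, 'e) manifold \<Rightarrow> 'm \<Rightarrow> ('m, 'e) chart" where
  "chart_at M x = (SOME c. c \<in> atlas M \<and> x \<in> fst c)"

definition mderiv ::
  "('m, 'a::euclidean_space) manifold \<Rightarrow> ('n, 'b::euclidean_space) manifold \<Rightarrow>
     ('m \<Rightarrow> 'n) \<Rightarrow> 'm \<Rightarrow> 'a \<Rightarrow> 'b" where
  "mderiv M N f x = (case chart_at M x of (U, \<phi>) \<Rightarrow> case chart_at N (f x) of (V, \<psi>) \<Rightarrow>
     frechet_derivative (\<psi> \<circ> f \<circ> inv_into U \<phi>) (at (\<phi> x)))"

definition embedded_submanifold ::
  "('m, 'a::euclidean_space) manifold \<Rightarrow> ('m, 'b::euclidean_space) manifold \<Rightarrow> bool" where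
  "embedded_submanifold S M \<longleftrightarrow>
     smooth_manifold S \<and> carrier S \<subseteq> carrier M \<and>
     mtop S = subtopology (mtop M) (carrier S) \<and>
     smooth_map_on S M (carrier S) (\<lambda>x. x) \<and>
     (\<forall>x\<in>carrier S. inj (mderiv S M (\<lambda>x. x) x))"

text \<open>Tangent vectors of a submanifold given as a mere subset \<open>S\<close> of \<open>M\<close> are the velocities of
  curves in \<open>S\<close>, and the differential of a map on \<open>S\<close> sends the velocity of a curve to the
  velocity of its image.\<close>

definition smooth_curve_in ::
  "('m, 'a::euclidean_space) manifold \<Rightarrow> 'm set \<Rightarrow> 'm \<Rightarrow> (real \<Rightarrow> 'm) \<Rightarrow> bool" where
  "smooth_curve_in M S x \<gamma> \<longleftrightarrow> \<gamma> 0 = x \<and>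
     (\<exists>e>0. \<gamma> ` {-e<..<e} \<subseteq> S \<and> smooth_map_on euclidean_manifold M {-e<..<e} \<gamma>)"

definition velocity :: "('m, 'a::euclidean_space) manifold \<Rightarrow> (real \<Rightarrow> 'm) \<Rightarrow> 'a" where
  "velocity M \<gamma> = vector_derivative (snd (chart_at M (\<gamma> 0)) \<circ> \<gamma>) (at 0)"

definition tangent_space ::
  "('m, 'a::euclidean_space) manifold \<Rightarrow> 'm set \<Rightarrow> 'm \<Rightarrow> 'a set" where
  "tangent_space M S x = {velocity M \<gamma> | \<gamma>. smooth_curve_in M S x \<gamma>}"

definition differential_image ::
  "('m, 'a::euclidean_space) manifold \<Rightarrow> 'm set \<Rightarrow> ('n, 'b::euclidean_space) manifold \<Rightarrow>
     ('m \<Rightarrow> 'n) \<Rightarrow> 'm \<Rightarrow> 'b set" where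
  "differential_image M S N f x = {velocity N (f \<circ> \<gamma>) | \<gamma>. smooth_curve_in M S x \<gamma>}"

text \<open>Transversality at \<open>x\<close> of a map \<open>f\<close> from the submanifold \<open>S\<close> of \<open>M\<close> into \<open>N\<close> to the
  submanifold \<open>Z\<close> of \<open>N\<close>; the right-hand side \<open>UNIV\<close> is the tangent space of \<open>N\<close> at \<open>f x\<close>.\<close>

definition transverse_at ::
  "('m, 'a::euclidean_space) manifold \<Rightarrow> 'm set \<Rightarrow> ('n, 'b::euclidean_space) manifold \<Rightarrow>
     ('m \<Rightarrow> 'n) \<Rightarrow> 'n set \<Rightarrow> 'm \<Rightarrow> bool" where
  "transverse_at M S N f Z x \<longleftrightarrow> (f x \<in> Z \<longrightarrow>
     {a + b | a b. a \<in> differential_image M S N f x \<and> b \<in> tangent_space N Z (f x)} = UNIV)"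


section \<open>Differential forms\<close>

text \<open>\<open>form_in_chart M c \<alpha> y\<close> is the coordinate expression, in the chart \<open>c\<close>, of the 1-form \<open>\<alpha>\<close>
  at the point with coordinates \<open>y\<close>.\<close>

type_synonym ('m, 'e) one_form = "'m \<Rightarrow> 'e \<Rightarrow>\<^sub>L real"

definition form_in_chart ::
  "('m, 'e::euclidean_space) manifold \<Rightarrow> ('m, 'e) chart \<Rightarrow> ('m, 'e) one_form \<Rightarrow>
     'e \<Rightarrow> ('e \<Rightarrow>\<^sub>L real)" where
  "form_in_chart M c \<alpha> y = (case c of (U, \<phi>) \<Rightarrow> let z = inv_into U \<phi> y in
     \<alpha> z o\<^sub>L Blinfun (frechet_derivative (snd (chart_at M z) \<circ> inv_into U \<phi>) (at y)))"

definition smooth_form ::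
  "('m, 'e::euclidean_space) manifold \<Rightarrow> 'm set \<Rightarrow> ('m, 'e) one_form \<Rightarrow> bool" where
  "smooth_form M W \<alpha> \<longleftrightarrow>
     (\<forall>(U, \<phi>)\<in>atlas M. smooth_on (\<phi> ` (U \<inter> W)) (form_in_chart M (U, \<phi>) \<alpha>))"

text \<open>Conventions: \<open>(\<alpha> \<and> \<beta>)(u,v) = \<alpha>(u)\<beta>(v) - \<alpha>(v)\<beta>(u)\<close> and
  \<open>d\<alpha> = \<Sum> \<partial>\<^sub>i\<alpha>\<^sub>j dx\<^sup>i \<and> dx\<^sup>j\<close>.\<close>

definition wedge ::
  "('e::euclidean_space \<Rightarrow>\<^sub>L real) \<Rightarrow> ('e \<Rightarrow>\<^sub>L real) \<Rightarrow> 'e \<Rightarrow> 'e \<Rightarrow> real" where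
  "wedge \<alpha> \<beta> u v = blinfun_apply \<alpha> u * blinfun_apply \<beta> v - blinfun_apply \<alpha> v * blinfun_apply \<beta> u"

definition ext_deriv ::
  "('m, 'e::euclidean_space) manifold \<Rightarrow> ('m, 'e) one_form \<Rightarrow> 'm \<Rightarrow> 'e \<Rightarrow> 'e \<Rightarrow> real" where
  "ext_deriv M \<alpha> x u v = (let c = chart_at M x;
       D = frechet_derivative (form_in_chart M c \<alpha>) (at (snd c x))
     in blinfun_apply (D u) v - blinfun_apply (D v) u)"

text \<open>Congruence of 2-forms on \<open>W\<close> modulo the ideal generated by the 1-forms \<open>\<theta> \<nu>\<close>.\<close>

definition congruent_mod ::
  "('m, 'e::euclidean_space) manifold \<Rightarrow> 'm set \<Rightarrow> ('n::finite \<Rightarrow> ('m, 'e) one_form) \<Rightarrow>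
     ('m \<Rightarrow> 'e \<Rightarrow> 'e \<Rightarrow> real) \<Rightarrow> ('m \<Rightarrow> 'e \<Rightarrow> 'e \<Rightarrow> real) \<Rightarrow> bool" where
  "congruent_mod M W \<theta> \<Phi> \<Psi> \<longleftrightarrow>
     (\<exists>\<beta>. (\<forall>\<nu>. smooth_form M W (\<beta> \<nu>)) \<and>
        (\<forall>x\<in>W. \<forall>u v. \<Phi> x u v = \<Psi> x u v + (\<Sum>\<nu>\<in>UNIV. wedge (\<beta> \<nu> x) (\<theta> \<nu> x) u v)))"

definition semibasic ::
  "('m, 'e::euclidean_space) manifold \<Rightarrow> ('k, 'b::euclidean_space) manifold \<Rightarrow> ('m \<Rightarrow> 'k) \<Rightarrow>
     'm set \<Rightarrow> ('m, 'e) one_form \<Rightarrow> bool" where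
  "semibasic M N f W \<alpha> \<longleftrightarrow>
     (\<forall>x\<in>W. \<forall>v. mderiv M N f x v = 0 \<longrightarrow> blinfun_apply (\<alpha> x) v = 0)"


section \<open>Grassmannians of half-dimensional planes\<close>

text \<open>For a linear automorphism \<open>g\<close> of \<open>\<real>\<^sup>n \<times> \<real>\<^sup>n\<close> and an \<open>n \<times> n\<close> matrix \<open>A\<close>, the image under \<open>g\<close>
  of the graph of \<open>A\<close>. For fixed \<open>g\<close> the inverse of this parametrisation is an affine chart
  of the Grassmannian of \<open>n\<close>-planes in \<open>\<real>\<^sup>n \<times> \<real>\<^sup>n\<close>.\<close>

definition graph_plane ::
  "((real^'n) \<times> (real^'n) \<Rightarrow> (real^'n) \<times> (real^'n)) \<Rightarrow> real^'n^'n \<Rightarrow>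
     ((real^'n::finite) \<times> (real^'n)) set" where
  "graph_plane g A = range (\<lambda>u. g (u, A *v u))"

definition grassmann_atlas ::
  "(((real^'n::finite) \<times> (real^'n)) set, real^'n^'n) chart set" where
  "grassmann_atlas =
     {(range (graph_plane g), inv (graph_plane g)) | g. linear g \<and> bij g}"

definition grassmannian ::
  "(((real^'n::finite) \<times> (real^'n)) set, real^'n^'n) manifold" where
  "grassmannian = \<lparr>
     mtop = topology_generated_by
       {{W \<in> U. \<phi> W \<in> D} | U \<phi> D. (U, \<phi>) \<in> grassmann_atlas \<and> open D},
     atlas = grassmann_atlas\<rparr>"

lemma inj_graph_plane:
  assumes "linear g" "bij g"
  shows "inj (graph_plane g)"
proof (rule injI)
  fix A B assume eq: "graph_plane g A = graph_plane g B"
  have "A *v u = B *v u" for u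
  proof -
    have "g (u, A *v u) \<in> graph_plane g B"
      unfolding eq[symmetric] by (simp add: graph_plane_def)
    then obtain u' where "g (u, A *v u) = g (u', B *v u')"
      by (auto simp: graph_plane_def)
    then have "(u, A *v u) = (u', B *v u')"
      by (rule injD[OF bij_is_inj[OF assms(2)]])
    then show ?thesis by auto
  qed
  then show "A = B"
    by (simp add: matrix_eq)
qed

lemma carrier_grassmannian:
  "carrier (grassmannian :: (((real^'n::finite) \<times> (real^'n)) set, real^'n^'n) manifold) =
     {W. subspace W \<and> dim W = CARD('n)}"
proof -
  let ?G = "grassmannian :: (((real^'n) \<times> (real^'n)) set, real^'n^'n) manifold"
  have car: "carrier ?G = (\<Union>g\<in>{g. linear g \<and> bij g}. range (graph_plane g))" (is "_ = ?R")
  proof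
    show "carrier ?G \<subseteq> ?R"
      unfolding grassmannian_def manifold.simps topology_generated_by_topspace grassmann_atlas_def
      by blast
    show "?R \<subseteq> carrier ?G"
    proof
      fix W assume "W \<in> ?R"
      then obtain g :: "(real^'n) \<times> (real^'n) \<Rightarrow> (real^'n) \<times> (real^'n)"
        where g: "linear g" "bij g" and W: "W \<in> range (graph_plane g)"
        by auto
      then have "(range (graph_plane g), inv (graph_plane g)) \<in> grassmann_atlas"
        unfolding grassmann_atlas_def by blast
      then have "{W \<in> range (graph_plane g). inv (graph_plane g) W \<in> UNIV}
          \<in> {{W \<in> U. \<phi> W \<in> D} | U \<phi> D. (U, \<phi>) \<in> grassmann_atlas \<and> open D}"
        using open_UNIV by blast
      then show "W \<in> carrier ?G"
        using W unfolding grassmannian_def manifold.simps topology_generated_by_topspace by blast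
    qed
  qed
  show ?thesis
    unfolding car
  proof (intro equalityI subsetI)
    fix W assume "W \<in> ?R"
    then obtain g :: "(real^'n) \<times> (real^'n) \<Rightarrow> (real^'n) \<times> (real^'n)" and A
      where g: "linear g" "bij g" and W: "W = range (\<lambda>u. g (u, A *v u))"
      unfolding graph_plane_def by blast
    have "linear (\<lambda>u. (u, A *v u))"
      by (rule linearI) (simp_all add: matrix_vector_right_distrib matrix_vector_mult_scaleR)
    then have lin: "linear (\<lambda>u. g (u, A *v u))"
      using linear_compose[OF _ g(1)] by (simp add: o_def)
    have inj: "inj (\<lambda>u. g (u, A *v u))"
      using g(2) by (auto simp: inj_on_def bij_def)
    have "dim W = dim (UNIV :: (real^'n) set)"
      unfolding W by (rule dim_image_eq[OF lin]) (use inj in simp)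
    then show "W \<in> {W. subspace W \<and> dim W = CARD('n)}"
      using linear_subspace_image[OF lin subspace_UNIV] W by simp
  next
    fix W :: "((real^'n) \<times> (real^'n)) set"
    assume "W \<in> {W. subspace W \<and> dim W = CARD('n)}"
    then have W: "subspace W" "dim W = CARD('n)" by auto
    define W' where "W' = {y. \<forall>x\<in>W. orthogonal x y}"
    have W': "subspace W'"
      unfolding W'_def by (simp add: subspace_orthogonal_to_vectors)
    have "dim W' + dim W = dim (UNIV :: ((real^'n) \<times> (real^'n)) set)"
      using dim_subspace_orthogonal_to_vectors[OF W(1) subspace_UNIV] by (simp add: W'_def)
    then have dW': "dim W' = CARD('n)" using W(2) by simp
    obtain h :: "real^'n \<Rightarrow> (real^'n) \<times> (real^'n)"
      where h: "linear h" "range h = W" "inj h"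
      using subspace_isomorphism[OF subspace_UNIV W(1), where 'a="real^'n"] W(2) by auto
    obtain k :: "real^'n \<Rightarrow> (real^'n) \<times> (real^'n)"
      where k: "linear k" "range k = W'" "inj k"
      using subspace_isomorphism[OF subspace_UNIV W', where 'a="real^'n"] dW' by auto
    define g where "g = (\<lambda>z. h (fst z) + k (snd z))"
    have g: "linear g"
      unfolding g_def by (rule linearI)
        (simp_all add: linear_add[OF h(1)] linear_add[OF k(1)] linear_scale[OF h(1)]
          linear_scale[OF k(1)] scaleR_add_right)
    have "z = 0" if "g z = 0" for z
    proof -
      have hk: "h (fst z) \<bullet> k (snd z) = 0"
        using h(2) k(2) unfolding W'_def orthogonal_def by blast
      have "h (fst z) \<bullet> g z = 0"
        using that by simp
      then have "h (fst z) \<bullet> h (fst z) = 0"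
        using hk unfolding g_def by (simp only: inner_add_right add_0_right)
      then have h0: "h (fst z) = 0"
        by (simp only: inner_eq_zero_iff)
      then have "k (snd z) = 0"
        using that unfolding g_def by simp
      then have "fst z = 0" "snd z = 0"
        using h0 h(1,3) k(1,3) by (metis injD linear_0)+
      then show "z = 0"
        by (simp add: prod_eq_iff)
    qed
    then have "inj g"
      using g by (simp add: linear_injective_0)
    then have "bij g"
      using g linear_injective_imp_surjective by (auto simp: bij_def)
    moreover have "W = graph_plane g 0"
      using h(2) linear_0[OF k(1)] by (simp add: graph_plane_def g_def)
    ultimately show "W \<in> ?R"
      using g by blast
  qed
qed

section \<open>Smooth projective planes\<close>

definition projective_plane :: "'p set \<Rightarrow> 'l set \<Rightarrow> ('p \<times> 'l) set \<Rightarrow> bool" where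
  "projective_plane P L F \<longleftrightarrow> F \<subseteq> P \<times> L \<and>
     (\<forall>p\<in>P. \<forall>q\<in>P. p \<noteq> q \<longrightarrow> (\<exists>!l. l \<in> L \<and> (p, l) \<in> F \<and> (q, l) \<in> F)) \<and>
     (\<forall>l\<in>L. \<forall>m\<in>L. l \<noteq> m \<longrightarrow> (\<exists>!p. p \<in> P \<and> (p, l) \<in> F \<and> (p, m) \<in> F)) \<and>
     (\<exists>Q\<subseteq>P. card Q = 4 \<and>
        (\<forall>T\<subseteq>Q. card T = 3 \<longrightarrow> \<not> (\<exists>l\<in>L. \<forall>p\<in>T. (p, l) \<in> F)))"

definition join :: "'l set \<Rightarrow> ('p \<times> 'l) set \<Rightarrow> 'p \<Rightarrow> 'p \<Rightarrow> 'l" where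
  "join L F p q = (THE l. l \<in> L \<and> (p, l) \<in> F \<and> (q, l) \<in> F)"

definition meet :: "'p set \<Rightarrow> ('p \<times> 'l) set \<Rightarrow> 'l \<Rightarrow> 'l \<Rightarrow> 'p" where
  "meet P F l m = (THE p. p \<in> P \<and> (p, l) \<in> F \<and> (p, m) \<in> F)"

definition points_on :: "('p \<times> 'l) set \<Rightarrow> 'l \<Rightarrow> 'p set" where
  "points_on F l = {p. (p, l) \<in> F}"

definition lines_through :: "('p \<times> 'l) set \<Rightarrow> 'p \<Rightarrow> 'l set" where
  "lines_through F p = {l. (p, l) \<in> F}"

text \<open>With \<open>n = CARD('n)\<close>, the model spaces encode \<open>dim P = dim \<Lambda> = 2n\<close> and \<open>dim F = 3n\<close>.\<close>

type_synonym ('m, 'n) manifold_2n = "('m, (real^'n) \<times> (real^'n)) manifold"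
type_synonym ('m, 'n) manifold_3n = "('m, (real^'n) \<times> (real^'n) \<times> (real^'n)) manifold"

definition smooth_projective_plane ::
  "('p, 'n::finite) manifold_2n \<Rightarrow> ('l, 'n) manifold_2n \<Rightarrow> ('p \<times> 'l, 'n) manifold_3n \<Rightarrow> bool" where
  "smooth_projective_plane P L F \<longleftrightarrow>
     projective_plane (carrier P) (carrier L) (carrier F) \<and>
     smooth_manifold P \<and> compact_space (mtop P) \<and>
     smooth_manifold L \<and> compact_space (mtop L) \<and>
     embedded_submanifold F (prod_manifold P L) \<and>
     smooth_map_on (prod_manifold P P) L {(p, q) \<in> carrier P \<times> carrier P. p \<noteq> q}
       (\<lambda>(p, q). join (carrier L) (carrier F) p q) \<and>
     smooth_map_on (prod_manifold L L) P {(l, m) \<in> carrier L \<times> carrier L. l \<noteq> m}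
       (\<lambda>(l, m). meet (carrier P) (carrier F) l m)"

definition polycontact ::
  "('p, 'n::finite) manifold_2n \<Rightarrow> ('l, 'n) manifold_2n \<Rightarrow> ('p \<times> 'l, 'n) manifold_3n \<Rightarrow>
     'p \<times> 'l \<Rightarrow> ((real^'n) \<times> (real^'n) \<times> (real^'n)) set" where
  "polycontact P L F x =
     {u + v | u v. mderiv F P fst x u = 0 \<and> mderiv F L snd x v = 0}"

definition adapted_coframing ::
  "('p, 'n::finite) manifold_2n \<Rightarrow> ('l, 'n) manifold_2n \<Rightarrow> ('p \<times> 'l, 'n) manifold_3n \<Rightarrow>
     ('p \<times> 'l) set \<Rightarrow>
     ('n \<Rightarrow> ('p \<times> 'l, (real^'n) \<times> (real^'n) \<times> (real^'n)) one_form) \<Rightarrow>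
     ('n \<Rightarrow> ('p \<times> 'l, (real^'n) \<times> (real^'n) \<times> (real^'n)) one_form) \<Rightarrow>
     ('n \<Rightarrow> ('p \<times> 'l, (real^'n) \<times> (real^'n) \<times> (real^'n)) one_form) \<Rightarrow> bool" where
  "adapted_coframing P L F W \<theta> \<omega> \<pi> \<longleftrightarrow>
     openin (mtop F) W \<and>
     (\<forall>\<mu>. smooth_form F W (\<theta> \<mu>) \<and> smooth_form F W (\<omega> \<mu>) \<and> smooth_form F W (\<pi> \<mu>)) \<and>
     (\<forall>x\<in>W. \<forall>a b c.
        (\<Sum>\<mu>\<in>UNIV. a \<mu> *\<^sub>R \<theta> \<mu> x + b \<mu> *\<^sub>R \<omega> \<mu> x + c \<mu> *\<^sub>R \<pi> \<mu> x) = 0 \<longrightarrow>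
        (\<forall>\<mu>. a \<mu> = 0 \<and> b \<mu> = 0 \<and> c \<mu> = 0)) \<and>
     (\<forall>\<mu>. semibasic F P fst W (\<theta> \<mu>) \<and> semibasic F P fst W (\<omega> \<mu>)) \<and>
     (\<forall>\<mu>. semibasic F L snd W (\<theta> \<mu>) \<and> semibasic F L snd W (\<pi> \<mu>)) \<and>
     (\<forall>x\<in>W. polycontact P L F x = {v. \<forall>\<mu>. blinfun_apply (\<theta> \<mu> x) v = 0})"

text \<open>\<open>d\<theta>\<^sup>\<mu> = -\<eta>\<^sup>\<mu>\<^sub>\<nu> \<and> \<omega>\<^sup>\<nu>\<close> modulo the \<open>\<theta>\<close>'s, where \<open>\<eta>\<^sup>\<mu>\<^sub>\<nu> = t\<^sup>\<mu>\<^sub>\<nu>\<^sub>\<sigma> \<pi>\<^sup>\<sigma>\<close> with smooth functions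
  \<open>t\<^sup>\<mu>\<^sub>\<nu>\<^sub>\<sigma>\<close>, on \<open>W\<close>.\<close>

definition structure_equations ::
  "('m, 'e::euclidean_space) manifold \<Rightarrow> 'm set \<Rightarrow>
     ('n::finite \<Rightarrow> ('m, 'e) one_form) \<Rightarrow> ('n \<Rightarrow> ('m, 'e) one_form) \<Rightarrow>
     ('n \<Rightarrow> ('m, 'e) one_form) \<Rightarrow>
     ('n \<Rightarrow> 'n \<Rightarrow> ('m, 'e) one_form) \<Rightarrow> ('n \<Rightarrow> 'n \<Rightarrow> 'n \<Rightarrow> 'm \<Rightarrow> real) \<Rightarrow> bool" where
  "structure_equations F W \<theta> \<omega> \<pi> \<eta> t \<longleftrightarrow>
     (\<forall>\<mu>. congruent_mod F W \<theta> (ext_deriv F (\<theta> \<mu>))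
        (\<lambda>x u v. - (\<Sum>\<nu>\<in>UNIV. wedge (\<eta> \<mu> \<nu> x) (\<omega> \<nu> x) u v))) \<and>
     (\<forall>\<mu> \<nu>. \<forall>x\<in>W. \<eta> \<mu> \<nu> x = (\<Sum>\<sigma>\<in>UNIV. t \<mu> \<nu> \<sigma> x *\<^sub>R \<pi> \<sigma> x)) \<and>
     (\<forall>\<mu> \<nu> \<sigma>. smooth_map_on F euclidean_manifold W (t \<mu> \<nu> \<sigma>))"

definition tableau_map ::
  "('n::finite \<Rightarrow> 'n \<Rightarrow> 'n \<Rightarrow> 'm \<Rightarrow> real) \<Rightarrow> 'm \<Rightarrow> real^'n \<Rightarrow> real^'n \<Rightarrow> real^'n" where
  "tableau_map t x u v = (\<chi> \<mu>. \<Sum>\<nu>\<in>UNIV. \<Sum>\<sigma>\<in>UNIV. t \<mu> \<nu> \<sigma> x * u $ \<nu> * v $ \<sigma>)"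

definition triality ::
  "('u::euclidean_space \<Rightarrow> 'v::euclidean_space \<Rightarrow> 'w::euclidean_space) \<Rightarrow> bool" where
  "triality t \<longleftrightarrow> bilinear t \<and> DIM('u) = DIM('v) \<and> DIM('v) = DIM('w) \<and>
     (\<forall>u v. u \<noteq> 0 \<longrightarrow> v \<noteq> 0 \<longrightarrow> t u v \<noteq> 0)"

text \<open>Orientations of the planes are dropped: transversality is a local condition, and forgetting
  orientations is a local diffeomorphism of Grassmannians.\<close>

definition regular_at ::
  "('p, 'n::finite) manifold_2n \<Rightarrow> ('l, 'n) manifold_2n \<Rightarrow> ('p \<times> 'l, 'n) manifold_3n \<Rightarrow>
     'p \<times> 'l \<Rightarrow> bool" where
  "regular_at P L F = (\<lambda>(p0, l0).
     \<forall>K. subspace K \<and> dim K = 1 \<and> K \<subseteq> tangent_space P (points_on (carrier F) l0) p0 \<longrightarrow>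
       transverse_at L (lines_through (carrier F) p0) grassmannian
         (\<lambda>l. tangent_space P (points_on (carrier F) l) p0)
         {W \<in> carrier grassmannian. K \<subseteq> W} l0)"

end

theory Submission
  imports Defs
begin

text \<open>On the domain of an adapted coframing, linear algebra gives \<open>ker \<pi>\<^sub>P' = {\<theta> = \<omega> = 0}\<close> and
  \<open>ker \<pi>\<^sub>\<Lambda>' = {\<theta> = \<pi> = 0}\<close>. For the dual frame \<open>X\<close>, \<open>d\<theta>(X\<^sub>i, X\<^sub>j) = - \<theta>([X\<^sub>i, X\<^sub>j])\<close>, and this vanishes
  when \<open>X\<^sub>i\<close> and \<open>X\<^sub>j\<close> are tangent to the fibres of the same projection; only the terms
  \<open>t\<^sup>\<mu>\<^sub>\<nu>\<^sub>\<sigma> \<pi>\<^sup>\<sigma> \<and> \<omega>\<^sup>\<nu>\<close> remain modulo \<open>\<theta>\<close>.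

  The plane tangent at \<open>p\<close> to the line \<open>l\<close> is spanned by the vectors \<open>\<pi>\<^sub>P' X(0, u, 0)\<close> at \<open>(p, l)\<close>. When
  \<open>l\<close> moves with velocity \<open>X(0, 0, v)\<close> in the pencil of \<open>p\<close>, these vectors change, modulo the plane, by
  \<open>\<pi>\<^sub>P' [X(0, 0, v), X(0, u, 0)]\<close>, which corresponds to \<open>t(u, v)\<close> under \<open>T P / plane \<cong> real^'n\<close>. Planes
  containing the vector given by \<open>u\<close> have the tangent space \<open>{M. M u = 0}\<close>, so transversality
  for this vector says that \<open>t(u, \<cdot>)\<close> is onto, hence injective.\<close>

section \<open>Smooth maps between normed spaces\<close>

text \<open>The coordinates of a tangent vector refer to the chart selected at its point, which may
  jump, so nothing can be differentiated in the form in which it is defined. Forms and frame are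
  therefore carried into one chart \<open>c\<close>: there the coframing is a map from an open set
  to invertible operators, its inverse is the frame, and brackets, \<open>d\<theta>\<close> and
  moving planes are ordinary Frechet derivatives. Lines and pencils are mere sets, whose tangent
  vectors are velocities of curves. Two tools link them to the frame: a vector killed by one
  projection of \<open>F\<close> is the velocity of a curve in its fibre (inverse function theorem),
  and a curve in a line or a pencil lifts to a differentiable curve of flags. The lift is continuous
  because \<open>F\<close> has the subspace topology, and then differentiable because the two
  projections together form an immersion. One identity serves both halves of the theorem: if
  \<open>df(X) = 0\<close> near a point, then \<open>df([X, Y]) = X(df(Y))\<close>. For
  \<open>Y\<close> also killed by \<open>df\<close> it makes components of \<open>d\<theta>\<close>
  vanish; for \<open>Y = X(0, u, 0)\<close> it computes how the tangent planes turn.\<close>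

lemma linear_blinfun_apply: "linear (blinfun_apply f)"
  using blinfun.bounded_linear_right bounded_linear.linear by blast

abbreviation fderiv :: "('a::real_normed_vector \<Rightarrow> 'b::real_normed_vector) \<Rightarrow> 'a \<Rightarrow> 'a \<Rightarrow> 'b" where
  "fderiv f x \<equiv> frechet_derivative f (at x)"

lemma has_derivative_frechet:
  "f differentiable at x \<Longrightarrow> (f has_derivative fderiv f x) (at x)"
  by (simp add: frechet_derivative_works)

lemma frechet_derivative_eq:
  "(f has_derivative f') (at x) \<Longrightarrow> fderiv f x = f'"
  by (metis frechet_derivative_at)

text \<open>No differentiability is required: \<open>frechet_derivative\<close> is a choice from the
  derivatives of a function, and functions equal near \<open>x\<close> have the same ones, possibly
  none.\<close>

lemma frechet_derivative_cong_open:
  assumes "open S" "x \<in> S" "\<And>y. y \<in> S \<Longrightarrow> f y = g y"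
  shows "fderiv f x = fderiv g x"
proof -
  have "(f has_derivative D) (at x) \<longleftrightarrow> (g has_derivative D) (at x)" for D
    using has_derivative_transform_within_open[of f D x UNIV S g]
      has_derivative_transform_within_open[of g D x UNIV S f] assms by auto
  then show ?thesis by (simp add: frechet_derivative_def)
qed

section \<open>Calculus of maps of class \<open>Ck\<close>\<close>

lemma Ck_on_cong:
  assumes "open S" "\<And>x. x \<in> S \<Longrightarrow> f x = g x"
  shows "Ck_on k S f \<longleftrightarrow> Ck_on k S g"
  using assms(2)
proof (induction k arbitrary: f g)
  case 0
  then show ?case by (auto cong: continuous_on_cong)
next
  case (Suc k)
  have "f differentiable at x \<longleftrightarrow> g differentiable at x" if "x \<in> S" for x
    unfolding differentiable_def
    by (metis (mono_tags, lifting) assms(1) that Suc.prems has_derivative_transform_within_open)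
  moreover have "Ck_on k S (\<lambda>x. fderiv f x v) \<longleftrightarrow>
      Ck_on k S (\<lambda>x. fderiv g x v)" for v
    by (rule Suc.IH) (metis frechet_derivative_cong_open assms(1) Suc.prems)
  ultimately show ?case by simp
qed

lemma Ck_on_SucI:
  assumes "open S" "\<And>x. x \<in> S \<Longrightarrow> (f has_derivative f' x) (at x)"
    and "\<And>v. Ck_on k S (\<lambda>x. f' x v)"
  shows "Ck_on (Suc k) S f"
proof -
  have "Ck_on k S (\<lambda>x. fderiv f x v)" for v
    using assms(3)[of v] Ck_on_cong[OF assms(1), of "\<lambda>x. f' x v" "\<lambda>x. fderiv f x v" k]
    by (simp add: frechet_derivative_eq[OF assms(2)])
  then show ?thesis
    using assms(2) by (auto simp: differentiable_def)
qed

lemma Ck_on_Suc_imp: "Ck_on (Suc k) S f \<Longrightarrow> Ck_on k S f"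
proof (induction k arbitrary: f)
  case 0
  then show ?case
    by (auto intro!: continuous_at_imp_continuous_on differentiable_imp_continuous_within)
qed auto

lemma Ck_on_subset: "Ck_on k S f \<Longrightarrow> T \<subseteq> S \<Longrightarrow> Ck_on k T f"
  by (induction k arbitrary: f) (auto intro: continuous_on_subset)

lemma Ck_on_local:
  assumes "\<And>x. x \<in> S \<Longrightarrow> \<exists>T. open T \<and> x \<in> T \<and> Ck_on k T f"
  shows "Ck_on k S f"
  using assms
proof (induction k arbitrary: f)
  case 0
  then show ?case
    by (auto intro!: continuous_at_imp_continuous_on simp: continuous_on_eq_continuous_at)
      (metis continuous_on_eq_continuous_at)
next
  case (Suc k)
  have "Ck_on k S (\<lambda>x. fderiv f x v)" for v
    by (rule Suc.IH) (use Suc.prems in fastforce)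
  then show ?case using Suc.prems by fastforce
qed

lemma Ck_on_const: "Ck_on k S (\<lambda>x. c)"
  by (induction k arbitrary: c) auto

lemma Ck_on_linear:
  assumes "open S" "bounded_linear L" "Ck_on k S f"
  shows "Ck_on k S (\<lambda>x. L (f x))"
  using assms(3)
proof (induction k arbitrary: f)
  case 0
  then show ?case using bounded_linear.continuous_on[OF assms(2)] by simp
next
  case (Suc k)
  show ?case
    by (rule Ck_on_SucI[where f' = "\<lambda>x v. L (fderiv f x v)"])
      (use Suc assms in \<open>auto intro!: bounded_linear.has_derivative[OF assms(2)] has_derivative_frechet\<close>)
qed

lemma Ck_on_bounded_linear:
  assumes "open S" "bounded_linear L"
  shows "Ck_on k S L"
proof (cases k)
  case 0
  then show ?thesis using linear_continuous_on[OF assms(2)] by simp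
next
  case (Suc k)
  show ?thesis unfolding Suc
    by (rule Ck_on_SucI[where f' = "\<lambda>x. L"])
      (auto intro!: bounded_linear_imp_has_derivative assms Ck_on_const)
qed

lemma Ck_on_add:
  assumes "open S" "Ck_on k S f" "Ck_on k S g"
  shows "Ck_on k S (\<lambda>x. f x + g x)"
  using assms(2,3)
proof (induction k arbitrary: f g)
  case 0
  then show ?case by (auto intro: continuous_on_add)
next
  case (Suc k)
  show ?case
    by (rule Ck_on_SucI[where f' = "\<lambda>x v. fderiv f x v + fderiv g x v"])
      (use Suc assms in \<open>auto intro!: has_derivative_add has_derivative_frechet\<close>)
qed

lemma Ck_on_sum:
  assumes "open S" "\<And>i. i \<in> I \<Longrightarrow> Ck_on k S (f i)"
  shows "Ck_on k S (\<lambda>x. \<Sum>i\<in>I. f i x)"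
  using assms(2)
  by (induction I rule: infinite_finite_induct) (auto intro!: Ck_on_const Ck_on_add assms(1))

lemma Ck_on_bilinear:
  assumes "open S" "bounded_bilinear B" "Ck_on k S f" "Ck_on k S g"
  shows "Ck_on k S (\<lambda>x. B (f x) (g x))"
  using assms(3,4)
proof (induction k arbitrary: f g)
  case 0
  then show ?case using bounded_bilinear.continuous_on[OF assms(2)] by simp
next
  case (Suc k)
  show ?case
  proof (rule Ck_on_SucI[OF assms(1), where f' = "\<lambda>x v. B (f x) (fderiv g x v)
      + B (fderiv f x v) (g x)"])
    show "((\<lambda>x. B (f x) (g x)) has_derivative (\<lambda>v. B (f x) (fderiv g x v)
      + B (fderiv f x v) (g x))) (at x)" if "x \<in> S" for x
      by (rule bounded_bilinear.FDERIV[OF assms(2)]) (use Suc.prems that in \<open>auto intro: has_derivative_frechet\<close>)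
    show "Ck_on k S (\<lambda>x. B (f x) (fderiv g x v)
      + B (fderiv f x v) (g x))" for v
      by (intro Ck_on_add assms Suc.IH) (use Suc.prems Ck_on_Suc_imp in auto)
  qed
qed

lemma linear_euclidean_sum:
  fixes D :: "'a::euclidean_space \<Rightarrow> 'b::real_normed_vector"
  assumes "linear D"
  shows "D w = (\<Sum>b\<in>Basis. (w \<bullet> b) *\<^sub>R D b)"
  by (metis (no_types, lifting) assms euclidean_representation linear_scale linear_sum sum.cong)

lemma Ck_on_compose:
  fixes f :: "'a::euclidean_space \<Rightarrow> 'b::real_normed_vector" and g :: "'c::real_normed_vector \<Rightarrow> 'a"
  assumes "open S" "open T" "g ` S \<subseteq> T" "Ck_on k T f" "Ck_on k S g"
  shows "Ck_on k S (\<lambda>x. f (g x))"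
  using assms(4,5)
proof (induction k arbitrary: f)
  case 0
  then show ?case using assms(3) by (auto intro: continuous_on_compose2)
next
  case (Suc k)
  have df: "(f has_derivative fderiv f y) (at y)" if "y \<in> T" for y
    using Suc.prems that by (auto intro: has_derivative_frechet)
  \<comment> \<open>\<open>Ck_on\<close> differentiates in a fixed direction, but the chain rule
    gives the derivative of \<open>f\<close> in a direction that moves with \<open>x\<close>.
    Expanding this direction in \<open>Basis\<close> leaves products of coordinates of the
    derivative of \<open>g\<close> with derivatives of \<open>f\<close> in constant directions, to
    which the induction hypothesis applies.\<close>
  let ?D = "\<lambda>x v. \<Sum>b\<in>Basis. (fderiv g x v \<bullet> b) *\<^sub>R fderiv f (g x) b"
  show ?case
  proof (rule Ck_on_SucI[OF assms(1), where f' = ?D])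
    fix x assume x: "x \<in> S"
    then have gx: "g x \<in> T" using assms by auto
    have "((\<lambda>x. f (g x)) has_derivative (\<lambda>v. fderiv f (g x) (fderiv g x v))) (at x)"
      using has_derivative_compose[of g "fderiv g x" x UNIV f "fderiv f (g x)"]
        df[OF gx] Suc.prems x by (auto intro: has_derivative_frechet)
    moreover have "linear (fderiv f (g x))"
      using df[OF gx] has_derivative_linear by blast
    then have "(\<lambda>v. fderiv f (g x) (fderiv g x v)) = ?D x"
      by (intro ext linear_euclidean_sum)
    ultimately show "((\<lambda>x. f (g x)) has_derivative ?D x) (at x)" by metis
  next
    show "Ck_on k S (\<lambda>x. ?D x v)" for v
      by (intro Ck_on_sum Ck_on_bilinear[OF _ bounded_bilinear_scaleR] assms(1)
          Ck_on_linear[OF _ bounded_linear_inner_left] Suc.IH)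
        (use Suc.prems Ck_on_Suc_imp in auto)
  qed
qed

lemma smooth_on_cong:
  assumes "open S" "\<And>x. x \<in> S \<Longrightarrow> f x = g x"
  shows "smooth_on S f \<longleftrightarrow> smooth_on S g"
  using Ck_on_cong[OF assms] by (simp add: smooth_on_def)

lemma smooth_on_subset: "smooth_on S f \<Longrightarrow> T \<subseteq> S \<Longrightarrow> smooth_on T f"
  unfolding smooth_on_def using Ck_on_subset by blast

lemma smooth_on_local:
  assumes "\<And>x. x \<in> S \<Longrightarrow> \<exists>T. open T \<and> x \<in> T \<and> smooth_on T f"
  shows "smooth_on S f"
  unfolding smooth_on_def using Ck_on_local assms unfolding smooth_on_def by metis

lemma smooth_on_const: "smooth_on S (\<lambda>x. c)"
  by (simp add: smooth_on_def Ck_on_const)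

lemma smooth_on_bounded_linear: "open S \<Longrightarrow> bounded_linear L \<Longrightarrow> smooth_on S L"
  by (simp add: smooth_on_def Ck_on_bounded_linear)

lemma smooth_on_linear:
  "open S \<Longrightarrow> bounded_linear L \<Longrightarrow> smooth_on S f \<Longrightarrow> smooth_on S (\<lambda>x. L (f x))"
  by (simp add: smooth_on_def Ck_on_linear)

lemma smooth_on_add:
  "open S \<Longrightarrow> smooth_on S f \<Longrightarrow> smooth_on S g \<Longrightarrow> smooth_on S (\<lambda>x. f x + g x)"
  by (simp add: smooth_on_def Ck_on_add)

lemma smooth_on_sum:
  "open S \<Longrightarrow> (\<And>i. i \<in> I \<Longrightarrow> smooth_on S (f i)) \<Longrightarrow> smooth_on S (\<lambda>x. \<Sum>i\<in>I. f i x)"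
  by (simp add: smooth_on_def Ck_on_sum)

lemma smooth_on_bilinear:
  "open S \<Longrightarrow> bounded_bilinear B \<Longrightarrow> smooth_on S f \<Longrightarrow> smooth_on S g \<Longrightarrow> smooth_on S (\<lambda>x. B (f x) (g x))"
  by (simp add: smooth_on_def Ck_on_bilinear)

lemma smooth_on_compose:
  fixes f :: "'a::euclidean_space \<Rightarrow> 'b::real_normed_vector" and g :: "'c::real_normed_vector \<Rightarrow> 'a"
  shows "open S \<Longrightarrow> open T \<Longrightarrow> g ` S \<subseteq> T \<Longrightarrow> smooth_on T f \<Longrightarrow> smooth_on S g \<Longrightarrow> smooth_on S (\<lambda>x. f (g x))"
  unfolding smooth_on_def using Ck_on_compose by blast

lemma smooth_on_differentiable: "smooth_on S f \<Longrightarrow> x \<in> S \<Longrightarrow> f differentiable at x"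
  unfolding smooth_on_def by (metis Ck_on.simps(2))

lemma smooth_on_has_derivative:
  "smooth_on S f \<Longrightarrow> x \<in> S \<Longrightarrow> (f has_derivative fderiv f x) (at x)"
  by (intro has_derivative_frechet smooth_on_differentiable)

lemma smooth_on_continuous: "smooth_on S f \<Longrightarrow> continuous_on S f"
  unfolding smooth_on_def by (metis Ck_on.simps(1))

lemma smooth_on_frechet_derivative: "smooth_on S f \<Longrightarrow> smooth_on S (\<lambda>x. fderiv f x v)"
  unfolding smooth_on_def by (metis Ck_on.simps(2))

lemma smooth_on_uminus: "open S \<Longrightarrow> smooth_on S f \<Longrightarrow> smooth_on S (\<lambda>x. - f x)"
  by (rule smooth_on_linear[of _ uminus]) (auto intro: bounded_linear_minus bounded_linear_ident)

lemma smooth_on_diff: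
  "open S \<Longrightarrow> smooth_on S f \<Longrightarrow> smooth_on S g \<Longrightarrow> smooth_on S (\<lambda>x. f x - g x)"
  using smooth_on_add[of S f "\<lambda>x. - g x"] smooth_on_uminus[of S g] by simp

lemma smooth_on_Pair:
  assumes "open S" "smooth_on S f" "smooth_on S g"
  shows "smooth_on S (\<lambda>x. (f x, g x))"
proof -
  have "smooth_on S (\<lambda>x. (f x, 0) + (0, g x))"
    by (intro smooth_on_add assms smooth_on_linear[of _ "\<lambda>a. (a, 0)"] smooth_on_linear[of _ "\<lambda>a. (0, a)"]
        bounded_linear_Pair bounded_linear_ident bounded_linear_zero)
  then show ?thesis by simp
qed

lemma bounded_linear_axis: "bounded_linear (axis i :: 'a::real_normed_vector \<Rightarrow> 'a^'n::finite)"
proof (rule bounded_linear_intro)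
  show "norm (axis i x :: 'a^'n) \<le> norm x * 1" for x :: 'a
    by (simp add: norm_vec_def L2_set_def axis_def if_distrib[of norm] if_distrib[of "\<lambda>x. x\<^sup>2"] cong: if_cong)
qed (auto simp: axis_def vec_eq_iff)

lemma smooth_on_vec_lambda:
  fixes f :: "'n::finite \<Rightarrow> 'a::real_normed_vector \<Rightarrow> 'b::real_normed_vector"
  assumes "open S" "\<And>i. smooth_on S (f i)"
  shows "smooth_on S (\<lambda>x. \<chi> i. f i x)"
proof -
  have "smooth_on S (\<lambda>x. \<Sum>i\<in>UNIV. axis i (f i x))"
    by (intro smooth_on_sum assms smooth_on_linear[OF _ bounded_linear_axis])
  moreover have "(\<Sum>i\<in>UNIV. axis i (f i x)) = (\<chi> i. f i x)" for x
    by (simp add: vec_eq_iff axis_def sum.delta cong: if_cong)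
  ultimately show ?thesis by simp
qed

lemma blinfun_sum_Basis:
  fixes F :: "'a::euclidean_space \<Rightarrow>\<^sub>L 'b::real_normed_vector"
  shows "F = (\<Sum>b\<in>Basis. blinfun_scaleR_left (F b) o\<^sub>L blinfun_inner_left b)"
proof (rule blinfun_eqI)
  fix v
  have "linear (blinfun_apply F)" by (rule linear_blinfun_apply)
  then show "F v = (\<Sum>b\<in>Basis. blinfun_scaleR_left (F b) o\<^sub>L blinfun_inner_left b) v"
    using linear_euclidean_sum[of "blinfun_apply F" v] by (simp add: blinfun.sum_left)
qed

text \<open>The domain of the operators is finite-dimensional, so an operator is a bounded linear
  function of its values on \<open>Basis\<close>.\<close>

lemma Ck_on_blinfunI:
  fixes F :: "'c::real_normed_vector \<Rightarrow> 'a::euclidean_space \<Rightarrow>\<^sub>L 'b::real_normed_vector"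
  assumes "open S" "\<And>b. b \<in> Basis \<Longrightarrow> Ck_on k S (\<lambda>x. F x b)"
  shows "Ck_on k S F"
proof -
  have "Ck_on k S (\<lambda>x. \<Sum>b\<in>Basis. blinfun_scaleR_left (F x b) o\<^sub>L blinfun_inner_left b)"
    by (intro Ck_on_sum assms Ck_on_linear[OF assms(1), of "\<lambda>c. blinfun_scaleR_left c o\<^sub>L _"]
        bounded_linear_compose[OF bounded_bilinear.bounded_linear_left[OF bounded_bilinear_blinfun_compose]
          bounded_linear_blinfun_scaleR_left])
  moreover have "(\<lambda>x. \<Sum>b\<in>Basis. blinfun_scaleR_left (F x b) o\<^sub>L blinfun_inner_left b) = F"
    by (rule ext) (rule blinfun_sum_Basis[symmetric])
  ultimately show ?thesis by simp
qed

lemma smooth_on_blinfunI: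
  fixes F :: "'c::real_normed_vector \<Rightarrow> 'a::euclidean_space \<Rightarrow>\<^sub>L 'b::real_normed_vector"
  shows "open S \<Longrightarrow> (\<And>b. b \<in> Basis \<Longrightarrow> smooth_on S (\<lambda>x. F x b)) \<Longrightarrow> smooth_on S F"
  unfolding smooth_on_def using Ck_on_blinfunI by blast

text \<open>A product rule in which \<open>f\<close> need only be continuous: where \<open>g\<close>
  vanishes, the increment of \<open>f\<close> is multiplied by a quantity of first order and
  contributes nothing. It is made for operator inverses, whose continuity is known before their
  differentiability.\<close>

lemma bounded_bilinear_vanishing_has_derivative:
  assumes "bounded_bilinear B" "isCont f x" "(g has_derivative g') (at x)" "g x = 0"
  shows "((\<lambda>y. B (f y) (g y)) has_derivative (\<lambda>v. B (f x) (g' v))) (at x)"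
proof -
  interpret B: bounded_bilinear B by fact
  obtain K where K: "\<And>a b. norm (B a b) \<le> norm a * norm b * K" "K > 0"
    using B.pos_bounded by blast
  have g': "bounded_linear g'" using assms(3) has_derivative_bounded_linear by blast
  let ?r = "\<lambda>y. norm (g y - g x - g' (y - x)) / norm (y - x)"
  have r: "(?r \<longlongrightarrow> 0) (at x)"
    using assms(3) by (simp add: has_derivative_iff_norm)
  have lim: "((\<lambda>y. norm (f y - f x) * (?r y + onorm g') * K) \<longlongrightarrow> norm (f x - f x) * (0 + onorm g') * K) (at x)"
    by (intro tendsto_intros r assms(2)[unfolded isCont_def])
  have "((\<lambda>y. B (f y - f x) (g y)) has_derivative (\<lambda>v. 0)) (at x)"
  proof (rule has_derivativeI_sandwich[of 1])
    show "((\<lambda>y. norm (f y - f x) * (?r y + onorm g') * K) \<longlongrightarrow> 0) (at x)"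
      using lim by simp
    fix y assume y: "y \<noteq> x"
    have "norm (g y) \<le> norm (g y - g x - g' (y - x)) + norm (g' (y - x))"
      using assms(4) norm_triangle_sub[of "g y" "g' (y - x)"] by simp
    also have "norm (g' (y - x)) \<le> onorm g' * norm (y - x)"
      using onorm[OF g'] .
    finally have "norm (g y) / norm (y - x) \<le> ?r y + onorm g'"
      using y by (simp add: field_simps)
    then have "norm (f y - f x) * (norm (g y) / norm (y - x)) * K \<le> norm (f y - f x) * (?r y + onorm g') * K"
      using K(2) by (intro mult_right_mono mult_left_mono) auto
    moreover have "norm (B (f y - f x) (g y)) / norm (y - x) \<le> norm (f y - f x) * (norm (g y) / norm (y - x)) * K"
      using K(1)[of "f y - f x" "g y"] by (simp add: divide_right_mono field_simps)
    ultimately show "norm (B (f y - f x) (g y) - B (f x - f x) (g x) - 0) / norm (y - x)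
        \<le> norm (f y - f x) * (?r y + onorm g') * K"
      by (simp add: B.zero_left)
  qed (auto)
  moreover have "((\<lambda>y. B (f x) (g y)) has_derivative (\<lambda>v. B (f x) (g' v))) (at x)"
    by (rule bounded_linear.has_derivative[OF B.bounded_linear_right assms(3)])
  ultimately have "((\<lambda>y. B (f y - f x) (g y) + B (f x) (g y)) has_derivative (\<lambda>v. 0 + B (f x) (g' v))) (at x)"
    by (rule has_derivative_add)
  then show ?thesis by (simp add: B.diff_left)
qed

text \<open>Rests on the resolvent identity \<open>J y - J x = J y (A x - A y) J x\<close>. The
  unknown \<open>J y\<close> stands on the right as well, so a bound for \<open>norm (J y)\<close>
  near \<open>x\<close> has to come first.\<close>

lemma blinfun_inverse_isCont:
  fixes A :: "'x::real_normed_vector \<Rightarrow> 'a::real_normed_vector \<Rightarrow>\<^sub>L 'b::real_normed_vector"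
  assumes "open S" "x \<in> S" "isCont A x"
    and JA: "\<And>y. y \<in> S \<Longrightarrow> J y o\<^sub>L A y = id_blinfun" "\<And>y. y \<in> S \<Longrightarrow> A y o\<^sub>L J y = id_blinfun"
  shows "isCont J x"
proof -
  have eq: "J y - J x = J y o\<^sub>L (A x - A y) o\<^sub>L J x" if "y \<in> S" for y
  proof (rule blinfun_eqI)
    fix v
    have "J y (A y (J x v)) = J x v" "A x (J x v) = v"
      using JA[OF that] JA[OF assms(2)] by (metis blinfun_apply_blinfun_compose blinfun_apply_id_blinfun)+
    then show "(J y - J x) v = (J y o\<^sub>L (A x - A y) o\<^sub>L J x) v"
      by (simp add: blinfun.bilinear_simps)
  qed
  have le: "norm (J y - J x) \<le> norm (J y) * norm (A x - A y) * norm (J x)" if "y \<in> S" for y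
    unfolding eq[OF that] using norm_blinfun_compose[of "J y o\<^sub>L (A x - A y)" "J x"] norm_blinfun_compose[of "J y" "A x - A y"]
    by (meson dual_order.trans mult_right_mono norm_ge_zero)
  have lim0: "((\<lambda>y. norm (A x - A y)) \<longlongrightarrow> norm (A x - A x)) (at x)"
    by (intro tendsto_intros assms(3)[unfolded isCont_def])
  then have "((\<lambda>y. norm (A x - A y) * norm (J x)) \<longlongrightarrow> norm (A x - A x) * norm (J x)) (at x)"
    by (rule tendsto_mult[OF _ tendsto_const])
  \<comment> \<open>Below \<open>1/2\<close> the term with \<open>norm (J y)\<close> on the right
    can be absorbed on the left, which gives \<open>norm (J y) \<le> 2 * norm (J x)\<close>.\<close>
  then have "\<forall>\<^sub>F y in at x. norm (A x - A y) * norm (J x) < 1/2"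
    by (rule order_tendstoD(2)) simp
  moreover have "\<forall>\<^sub>F y in at x. y \<in> S"
    using assms(1,2) by (simp add: eventually_at_in_open')
  ultimately have "\<forall>\<^sub>F y in at x. norm (J y - J x) \<le> 2 * norm (J x) * norm (J x) * norm (A x - A y)"
  proof eventually_elim
    case (elim y)
    have "norm (J y) \<le> norm (J x) + norm (J y - J x)"
      by (metis add.commute norm_triangle_sub)
    also have "\<dots> \<le> norm (J x) + norm (J y) * (norm (A x - A y) * norm (J x))"
      using le[OF elim(2)] by (simp add: mult.assoc)
    also have "\<dots> \<le> norm (J x) + norm (J y) * (1/2)"
      using elim(1) by (intro add_left_mono mult_left_mono) auto
    finally have "norm (J y) \<le> 2 * norm (J x)" by simp
    then have "norm (J y) * norm (A x - A y) * norm (J x) \<le> 2 * norm (J x) * norm (A x - A y) * norm (J x)"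
      by (intro mult_right_mono) auto
    then show ?case using le[OF elim(2)] by (simp add: mult_ac)
  qed
  moreover have "((\<lambda>y. 2 * norm (J x) * norm (J x) * norm (A x - A y)) \<longlongrightarrow> 2 * norm (J x) * norm (J x) * norm (A x - A x)) (at x)"
    by (rule tendsto_mult[OF tendsto_const lim0])
  ultimately have "((\<lambda>y. J y - J x) \<longlongrightarrow> 0) (at x)"
    using Lim_null_comparison by fastforce
  then show ?thesis unfolding isCont_def by (simp add: LIM_zero_iff)
qed

text \<open>Writes \<open>J y\<close> as \<open>J x - J y (A y - A x) J x\<close>. The middle factor
  vanishes at \<open>x\<close>, so continuity of \<open>J\<close> suffices to differentiate the
  product.\<close>

lemma blinfun_inverse_has_derivative:
  fixes A :: "'x::real_normed_vector \<Rightarrow> 'a::real_normed_vector \<Rightarrow>\<^sub>L 'b::real_normed_vector"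
  assumes "open S" "x \<in> S" "(A has_derivative A') (at x)"
    and JA: "\<And>y. y \<in> S \<Longrightarrow> J y o\<^sub>L A y = id_blinfun" "\<And>y. y \<in> S \<Longrightarrow> A y o\<^sub>L J y = id_blinfun"
  shows "(J has_derivative (\<lambda>v. - (J x o\<^sub>L (A' v o\<^sub>L J x)))) (at x)"
proof -
  have "isCont A x" using assms(3) has_derivative_continuous by blast
  then have J: "isCont J x" using blinfun_inverse_isCont[OF assms(1,2)] JA by blast
  have "((\<lambda>y. (A y - A x) o\<^sub>L J x) has_derivative (\<lambda>v. (A' v - 0) o\<^sub>L J x)) (at x)"
    by (intro bounded_linear.has_derivative[OF bounded_bilinear.bounded_linear_left[OF bounded_bilinear_blinfun_compose]]
        has_derivative_diff assms(3) has_derivative_const)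
  then have "((\<lambda>y. J y o\<^sub>L ((A y - A x) o\<^sub>L J x)) has_derivative (\<lambda>v. J x o\<^sub>L ((A' v - 0) o\<^sub>L J x))) (at x)"
    by (intro bounded_bilinear_vanishing_has_derivative[OF bounded_bilinear_blinfun_compose J])
      (auto simp: bounded_bilinear.zero_left[OF bounded_bilinear_blinfun_compose])
  then have "((\<lambda>y. J x - (J y o\<^sub>L ((A y - A x) o\<^sub>L J x))) has_derivative (\<lambda>v. 0 - (J x o\<^sub>L ((A' v - 0) o\<^sub>L J x)))) (at x)"
    by (intro has_derivative_diff has_derivative_const)
  then have *: "((\<lambda>y. J x - (J y o\<^sub>L ((A y - A x) o\<^sub>L J x))) has_derivative (\<lambda>v. - (J x o\<^sub>L (A' v o\<^sub>L J x)))) (at x)"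
    by simp
  show ?thesis
  proof (rule has_derivative_transform_within_open[OF * assms(1,2)])
    fix y assume y: "y \<in> S"
    show "J x - (J y o\<^sub>L ((A y - A x) o\<^sub>L J x)) = J y"
    proof (rule blinfun_eqI)
      fix v
      have "J y (A y (J x v)) = J x v" "A x (J x v) = v"
        using JA[OF y] JA[OF assms(2)] by (metis blinfun_apply_blinfun_compose blinfun_apply_id_blinfun)+
      then show "(J x - (J y o\<^sub>L ((A y - A x) o\<^sub>L J x))) v = J y v"
        by (simp add: blinfun.bilinear_simps)
    qed
  qed
qed

text \<open>The derivative \<open>- J A' J\<close> contains \<open>J\<close> undifferentiated, so
  each step of the induction gains one order.\<close>

lemma Ck_on_blinfun_inverse:
  fixes A :: "'x::real_normed_vector \<Rightarrow> 'a::real_normed_vector \<Rightarrow>\<^sub>L 'b::real_normed_vector"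
  assumes "open S"
    and JA: "\<And>y. y \<in> S \<Longrightarrow> J y o\<^sub>L A y = id_blinfun" "\<And>y. y \<in> S \<Longrightarrow> A y o\<^sub>L J y = id_blinfun"
    and "Ck_on k S A"
  shows "Ck_on k S J"
  using assms(4)
proof (induction k)
  case 0
  then show ?case
    using blinfun_inverse_isCont[OF assms(1) _ _ JA] assms(1)
    by (simp add: continuous_on_eq_continuous_at)
next
  case (Suc k)
  note IH = Suc.IH[OF Ck_on_Suc_imp[OF Suc.prems]]
  show ?case
  proof (rule Ck_on_SucI[OF assms(1)])
    show "(J has_derivative (\<lambda>v. - (J x o\<^sub>L (fderiv A x v o\<^sub>L J x)))) (at x)" if "x \<in> S" for x
      by (rule blinfun_inverse_has_derivative[OF assms(1) that _ JA])
        (use Suc.prems that in \<open>auto intro: has_derivative_frechet\<close>)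
    show "Ck_on k S (\<lambda>x. - (J x o\<^sub>L (fderiv A x v o\<^sub>L J x)))" for v
      by (intro Ck_on_linear[OF assms(1), of uminus] Ck_on_bilinear[OF assms(1) bounded_bilinear_blinfun_compose] IH
          bounded_linear_minus bounded_linear_ident)
        (use Suc.prems in auto)
  qed
qed

lemma smooth_on_blinfun_inverse:
  fixes A :: "'x::real_normed_vector \<Rightarrow> 'a::real_normed_vector \<Rightarrow>\<^sub>L 'b::real_normed_vector"
  assumes "open S"
    and "\<And>y. y \<in> S \<Longrightarrow> J y o\<^sub>L A y = id_blinfun" "\<And>y. y \<in> S \<Longrightarrow> A y o\<^sub>L J y = id_blinfun"
    and "smooth_on S A"
  shows "smooth_on S J"
  using Ck_on_blinfun_inverse[OF assms(1-3)] assms(4) by (simp add: smooth_on_def)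

section \<open>The inverse function theorem for smooth maps\<close>

lemma has_derivative_Blinfun_apply:
  "(f has_derivative D) (at x) \<Longrightarrow> blinfun_apply (Blinfun D) = D"
  by (simp add: bounded_linear_Blinfun_apply has_derivative_bounded_linear)

lemma smooth_on_Blinfun_frechet:
  fixes f :: "'a::euclidean_space \<Rightarrow> 'b::real_normed_vector"
  assumes "open S" "smooth_on S f"
  shows "smooth_on S (\<lambda>x. Blinfun (fderiv f x))"
proof (rule smooth_on_blinfunI[OF assms(1)])
  fix b :: 'a
  have "Blinfun (fderiv f x) b = fderiv f x b" if "x \<in> S" for x
    using has_derivative_Blinfun_apply[OF smooth_on_has_derivative[OF assms(2) that]] by simp
  then show "smooth_on S (\<lambda>x. Blinfun (fderiv f x) b)"
    using smooth_on_cong[OF assms(1), of "\<lambda>x. Blinfun (fderiv f x) b" "\<lambda>x. fderiv f x b"]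
      smooth_on_frechet_derivative[OF assms(2)] by simp
qed

text \<open>The derivative of the local inverse \<open>g\<close> at \<open>y\<close> is the inverse
  of the derivative of \<open>f\<close> at \<open>g y\<close>. This formula bootstraps: if
  \<open>g\<close> is of class \<open>Ck\<close>, then so is the derivative of \<open>f\<close>
  along \<open>g\<close>, hence its operator inverse, hence the derivative of
  \<open>g\<close>.\<close>

lemma smooth_inverse_function:
  fixes f :: "'a::euclidean_space \<Rightarrow> 'a"
  assumes "open U" "smooth_on U f" "x0 \<in> U" "inj (fderiv f x0)"
  obtains U' V g where "open U'" "U' \<subseteq> U" "x0 \<in> U'" "open V" "f x0 \<in> V" "homeomorphism U' V f g" "smooth_on V g"
proof -
  let ?D = "\<lambda>x. Blinfun (fderiv f x)"
  have D: "blinfun_apply (?D x) = fderiv f x" if "x \<in> U" for x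
    using has_derivative_Blinfun_apply[OF smooth_on_has_derivative[OF assms(2) that]] .
  have lin: "linear (blinfun_apply (?D x0))" by (rule linear_blinfun_apply)
  have "inj (blinfun_apply (?D x0))" using assms D by simp
  then obtain I where I: "linear I" "I \<circ> blinfun_apply (?D x0) = id"
    using linear_injective_left_inverse[OF lin] by blast
  have invf: "Blinfun I o\<^sub>L ?D x0 = id_blinfun"
    using I by (intro blinfun_eqI) (simp add: bounded_linear_Blinfun_apply linear_conv_bounded_linear pointfree_idE)
  obtain U' V g g' where g: "open U'" "U' \<subseteq> U" "x0 \<in> U'" "open V" "f x0 \<in> V" "homeomorphism U' V f g"
    "\<And>y. y \<in> V \<Longrightarrow> (g has_derivative (g' y)) (at y)"
    "\<And>y. y \<in> V \<Longrightarrow> g' y = inv (blinfun_apply (?D (g y)))"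
    "\<And>y. y \<in> V \<Longrightarrow> bij (blinfun_apply (?D (g y)))"
    by (rule inverse_function_theorem[OF assms(1) _
          smooth_on_continuous[OF smooth_on_Blinfun_frechet[OF assms(1,2)]] assms(3) invf, of f])
      (use smooth_on_has_derivative[OF assms(2)] D in \<open>auto; fail | blast\<close>)+
  have gU: "g ` V \<subseteq> U" using g(2,6) by (auto simp: homeomorphism_def)
  have inv: "Blinfun (g' y) o\<^sub>L ?D (g y) = id_blinfun" "?D (g y) o\<^sub>L Blinfun (g' y) = id_blinfun" if "y \<in> V" for y
  proof -
    have "blinfun_apply (Blinfun (g' y)) = inv (blinfun_apply (?D (g y)))"
      using has_derivative_Blinfun_apply[OF g(7)[OF that]] g(8)[OF that] by simp
    then show "Blinfun (g' y) o\<^sub>L ?D (g y) = id_blinfun" "?D (g y) o\<^sub>L Blinfun (g' y) = id_blinfun"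
      using g(9)[OF that] by (auto intro!: blinfun_eqI simp: bij_is_inj bij_is_surj surj_f_inv_f)
  qed
  have "Ck_on k V g" for k
  proof (induction k)
    case 0
    then show ?case using g(6) by (simp add: homeomorphism_def)
  next
    case (Suc k)
    have "Ck_on k V (\<lambda>y. ?D (g y))"
      by (rule Ck_on_compose[OF g(4) assms(1) gU _ Suc.IH])
        (use smooth_on_Blinfun_frechet[OF assms(1,2)] in \<open>simp add: smooth_on_def\<close>)
    then have "Ck_on k V (\<lambda>y. Blinfun (g' y))"
      using Ck_on_blinfun_inverse[OF g(4), of "\<lambda>y. Blinfun (g' y)" "\<lambda>y. ?D (g y)"] inv by blast
    then have "Ck_on k V (\<lambda>y. Blinfun (g' y) v)" for v
      by (rule Ck_on_linear[OF g(4), rotated]) auto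
    then have "Ck_on k V (\<lambda>y. g' y v)" for v
      using Ck_on_cong[OF g(4), of "\<lambda>y. Blinfun (g' y) v" "\<lambda>y. g' y v" k]
        has_derivative_Blinfun_apply[OF g(7)] by auto
    then show ?case using Ck_on_SucI[OF g(4,7)] by blast
  qed
  then show thesis using that g(1-6) by (simp add: smooth_on_def)
qed

text \<open>The mean value theorem is applied twice to the second difference over a parallelogram,
  first along \<open>u\<close>, then along \<open>v\<close>. The left-hand side is symmetric in
  \<open>u\<close> and \<open>v\<close>, and this is how the order of differentiation will be
  exchanged.\<close>

lemma second_difference_mean_value:
  fixes f :: "'a::real_normed_vector \<Rightarrow> real"
  assumes "Ck_on 2 S f" "h > 0"
    and box: "\<And>a b. a \<in> {0..h} \<Longrightarrow> b \<in> {0..h} \<Longrightarrow> x + a *\<^sub>R u + b *\<^sub>R v \<in> S"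
  shows "\<exists>a b. a \<in> {0..h} \<and> b \<in> {0..h} \<and>
     f (x + h *\<^sub>R u + h *\<^sub>R v) - f (x + h *\<^sub>R u) - f (x + h *\<^sub>R v) + f x
      = h\<^sup>2 * fderiv (\<lambda>y. fderiv f y u) (x + a *\<^sub>R u + b *\<^sub>R v) v"
proof -
  let ?Df = "\<lambda>y. fderiv f y"
  let ?DD = "\<lambda>y. fderiv (\<lambda>y. fderiv f y u) y"
  have df: "(f has_derivative ?Df y) (at y)" if "y \<in> S" for y
    using assms(1) that by (auto intro!: has_derivative_frechet simp: numeral_2_eq_2)
  have ddf: "((\<lambda>y. ?Df y u) has_derivative ?DD y) (at y)" if "y \<in> S" for y
    using assms(1) that by (auto intro!: has_derivative_frechet simp: numeral_2_eq_2)
  \<comment> \<open>The summand \<open>0 *\<^sub>R v\<close> is kept so that both terms are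
    instances of fact \<open>1\<close>.\<close>
  define \<phi> where "\<phi> = (\<lambda>s. f (x + s *\<^sub>R u + h *\<^sub>R v) - f (x + s *\<^sub>R u + 0 *\<^sub>R v))"
  have 1: "((\<lambda>s. f (x + s *\<^sub>R u + t *\<^sub>R v)) has_real_derivative ?Df (x + s *\<^sub>R u + t *\<^sub>R v) u) (at s)"
    if "s \<in> {0..h}" "t \<in> {0..h}" for s t
  proof -
    have "((\<lambda>s. x + s *\<^sub>R u + t *\<^sub>R v) has_derivative (\<lambda>d. d *\<^sub>R u)) (at s)"
      by (auto intro!: derivative_eq_intros)
    from has_derivative_compose[OF this df[OF box[OF that]]]
    have "((\<lambda>s. f (x + s *\<^sub>R u + t *\<^sub>R v)) has_derivative (\<lambda>d. ?Df (x + s *\<^sub>R u + t *\<^sub>R v) (d *\<^sub>R u))) (at s)" .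
    moreover have "linear (?Df (x + s *\<^sub>R u + t *\<^sub>R v))"
      using df[OF box[OF that]] has_derivative_linear by blast
    ultimately show ?thesis
      by (simp add: has_field_derivative_def linear_scale mult_commute_abs)
  qed
  have "\<exists>z>0. z < h \<and> \<phi> h - \<phi> 0 = (h - 0) * (?Df (x + z *\<^sub>R u + h *\<^sub>R v) u - ?Df (x + z *\<^sub>R u + 0 *\<^sub>R v) u)"
    unfolding \<phi>_def using assms(2) by (intro MVT2 DERIV_diff 1) auto
  then obtain a where a: "a > 0" "a < h"
    "\<phi> h - \<phi> 0 = h * (?Df (x + a *\<^sub>R u + h *\<^sub>R v) u - ?Df (x + a *\<^sub>R u + 0 *\<^sub>R v) u)" by auto
  have 2: "((\<lambda>t. ?Df (x + a *\<^sub>R u + t *\<^sub>R v) u) has_real_derivative ?DD (x + a *\<^sub>R u + t *\<^sub>R v) v) (at t)"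
    if "t \<in> {0..h}" for t
  proof -
    have B: "x + a *\<^sub>R u + t *\<^sub>R v \<in> S" using box a that by auto
    have "((\<lambda>t. x + a *\<^sub>R u + t *\<^sub>R v) has_derivative (\<lambda>d. d *\<^sub>R v)) (at t)"
      by (auto intro!: derivative_eq_intros)
    from has_derivative_compose[OF this ddf[OF B]]
    have "((\<lambda>t. ?Df (x + a *\<^sub>R u + t *\<^sub>R v) u) has_derivative (\<lambda>d. ?DD (x + a *\<^sub>R u + t *\<^sub>R v) (d *\<^sub>R v))) (at t)" .
    moreover have "linear (?DD (x + a *\<^sub>R u + t *\<^sub>R v))"
      using ddf[OF B] has_derivative_linear by blast
    ultimately show ?thesis
      by (simp add: has_field_derivative_def linear_scale mult_commute_abs)
  qed
  have "\<exists>z>0. z < h \<and> ?Df (x + a *\<^sub>R u + h *\<^sub>R v) u - ?Df (x + a *\<^sub>R u + 0 *\<^sub>R v) u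
      = (h - 0) * ?DD (x + a *\<^sub>R u + z *\<^sub>R v) v"
    using assms(2) by (intro MVT2) (auto intro!: 2)
  then obtain b where b: "b > 0" "b < h"
    "?Df (x + a *\<^sub>R u + h *\<^sub>R v) u - ?Df (x + a *\<^sub>R u + 0 *\<^sub>R v) u = h * ?DD (x + a *\<^sub>R u + b *\<^sub>R v) v" by auto
  have "\<phi> h - \<phi> 0 = h\<^sup>2 * ?DD (x + a *\<^sub>R u + b *\<^sub>R v) v"
    using a(3) b(3) by (simp add: power2_eq_square)
  then show ?thesis using a b unfolding \<phi>_def
    by (intro exI[of _ a] exI[of _ b]) auto
qed

lemma second_derivative_symmetric_real:
  fixes f :: "'a::real_normed_vector \<Rightarrow> real"
  assumes "open S" "x \<in> S" "Ck_on 2 S f"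
  shows "fderiv (\<lambda>y. fderiv f y u) x v
       = fderiv (\<lambda>y. fderiv f y v) x u"
proof -
  let ?G = "\<lambda>u v y. fderiv (\<lambda>y. fderiv f y u) y v"
  have cont: "isCont (?G u v) x" for u v
    using assms by (simp add: numeral_2_eq_2 continuous_on_eq_continuous_at)
  have "\<bar>?G u v x - ?G v u x\<bar> < e" if e: "e > 0" for e
  proof -
    obtain d where d: "d > 0" "\<And>y. dist y x < d \<Longrightarrow> \<bar>?G u v y - ?G u v x\<bar> < e/2"
      using cont[of u v, unfolded continuous_at_eps_delta, rule_format, of "e/2"] e
      unfolding dist_real_def by auto
    obtain d' where d': "d' > 0" "\<And>y. dist y x < d' \<Longrightarrow> \<bar>?G v u y - ?G v u x\<bar> < e/2"
      using cont[of v u, unfolded continuous_at_eps_delta, rule_format, of "e/2"] e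
      unfolding dist_real_def by auto
    obtain r where r: "r > 0" "ball x r \<subseteq> S"
      using assms(1,2) open_contains_ball by blast
    define m where "m = min r (min d d')"
    \<comment> \<open>Makes \<open>h * (norm u + norm v)\<close> smaller than \<open>m\<close>, so
      that the parallelogram stays where all estimates hold; the summand \<open>1\<close> covers
      \<open>u = v = 0\<close>.\<close>
    define h where "h = m / (2 * (norm u + norm v + 1))"
    have m: "m > 0" using r d d' by (simp add: m_def)
    have h: "h > 0" using m by (auto simp: h_def intro!: divide_pos_pos add_nonneg_pos)
    have hm: "h * (norm u + norm v) < m"
    proof -
      have "h * (norm u + norm v) < h * (2 * (norm u + norm v + 1))"
        using h norm_ge_zero[of u] norm_ge_zero[of v] by (intro mult_strict_left_mono) (auto simp: add_nonneg_pos)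
      also have "\<dots> = m"
        using add_nonneg_pos[of "norm u + norm v" 1] by (simp add: h_def)
      finally show ?thesis .
    qed
    have near: "dist (x + a *\<^sub>R u + b *\<^sub>R v) x < m" if "a \<in> {0..h}" "b \<in> {0..h}" for a b
    proof -
      have "dist (x + a *\<^sub>R u + b *\<^sub>R v) x \<le> a * norm u + b * norm v"
        using norm_triangle_ineq[of "a *\<^sub>R u" "b *\<^sub>R v"] that by (simp add: dist_norm add.assoc)
      also have "\<dots> \<le> h * norm u + h * norm v"
        using that by (intro add_mono mult_right_mono) auto
      finally show ?thesis using hm by (simp add: distrib_left)
    qed
    have box: "x + a *\<^sub>R u + b *\<^sub>R v \<in> S" if "a \<in> {0..h}" "b \<in> {0..h}" for a b
      using near[OF that] r by (auto simp: m_def subset_eq dist_commute)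
    obtain a b where ab: "a \<in> {0..h}" "b \<in> {0..h}"
      "f (x + h *\<^sub>R u + h *\<^sub>R v) - f (x + h *\<^sub>R u) - f (x + h *\<^sub>R v) + f x = h\<^sup>2 * ?G u v (x + a *\<^sub>R u + b *\<^sub>R v)"
      using second_difference_mean_value[OF assms(3) h box] by blast
    have box': "x + a *\<^sub>R v + b *\<^sub>R u \<in> S" if "a \<in> {0..h}" "b \<in> {0..h}" for a b
      using box[OF that(2,1)] by (simp add: add_ac)
    obtain a' b' where ab': "a' \<in> {0..h}" "b' \<in> {0..h}"
      "f (x + h *\<^sub>R v + h *\<^sub>R u) - f (x + h *\<^sub>R v) - f (x + h *\<^sub>R u) + f x = h\<^sup>2 * ?G v u (x + a' *\<^sub>R v + b' *\<^sub>R u)"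
      using second_difference_mean_value[OF assms(3) h box'] by blast
    have "h\<^sup>2 * ?G u v (x + a *\<^sub>R u + b *\<^sub>R v) = h\<^sup>2 * ?G v u (x + a' *\<^sub>R v + b' *\<^sub>R u)"
    proof -
      have e: "x + h *\<^sub>R v + h *\<^sub>R u = x + h *\<^sub>R u + h *\<^sub>R v" by (simp add: add_ac)
      show ?thesis using ab(3) ab'(3) unfolding e by linarith
    qed
    then have "?G u v (x + a *\<^sub>R u + b *\<^sub>R v) = ?G v u (x + a' *\<^sub>R v + b' *\<^sub>R u)"
      using h by simp
    moreover have "\<bar>?G u v (x + a *\<^sub>R u + b *\<^sub>R v) - ?G u v x\<bar> < e/2"
      using d(2) near[OF ab(1,2)] by (simp add: m_def)
    moreover have "\<bar>?G v u (x + a' *\<^sub>R v + b' *\<^sub>R u) - ?G v u x\<bar> < e/2"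
      using d'(2) near[OF ab'(2,1)] by (simp add: m_def add_ac)
    ultimately show ?thesis by linarith
  qed
  \<comment> \<open>A nonzero difference, taken as its own \<open>e\<close>, would be smaller than
    itself.\<close>
  from this[of "\<bar>?G u v x - ?G v u x\<bar>"] show ?thesis by auto
qed

lemma second_derivative_symmetric:
  fixes f :: "'a::real_normed_vector \<Rightarrow> 'b::euclidean_space"
  assumes "open S" "x \<in> S" "smooth_on S f"
  shows "fderiv (\<lambda>y. fderiv f y u) x v
       = fderiv (\<lambda>y. fderiv f y v) x u"
proof (rule euclidean_eqI)
  fix b :: 'b
  let ?f = "\<lambda>y. f y \<bullet> b"
  have D: "fderiv ?f y = (\<lambda>v. fderiv f y v \<bullet> b)" if "y \<in> S" for y
    using smooth_on_has_derivative[OF assms(3) that]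
    by (intro frechet_derivative_eq has_derivative_inner_left)
  have DD: "fderiv (\<lambda>y. fderiv ?f y u) x v
      = fderiv (\<lambda>y. fderiv f y u) x v \<bullet> b" for u v
  proof -
    have "fderiv (\<lambda>y. fderiv ?f y u) x
        = fderiv (\<lambda>y. fderiv f y u \<bullet> b) x"
      by (rule frechet_derivative_cong_open[OF assms(1,2)]) (simp add: D)
    also have "\<dots> = (\<lambda>v. fderiv (\<lambda>y. fderiv f y u) x v \<bullet> b)"
      by (intro frechet_derivative_eq has_derivative_inner_left smooth_on_has_derivative[OF _ assms(2)]
          smooth_on_frechet_derivative assms(3))
    finally show ?thesis by simp
  qed
  have "smooth_on S ?f" by (rule smooth_on_linear[OF assms(1) bounded_linear_inner_left assms(3)])
  then show "fderiv (\<lambda>y. fderiv f y u) x v \<bullet> b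
       = fderiv (\<lambda>y. fderiv f y v) x u \<bullet> b"
    using second_derivative_symmetric_real[OF assms(1,2), of ?f u v] unfolding DD
    by (simp add: smooth_on_def)
qed

section \<open>Charts of manifolds\<close>

abbreviation chart_inv :: "('m, 'e) chart \<Rightarrow> 'e \<Rightarrow> 'm" where
  "chart_inv c \<equiv> inv_into (fst c) (snd c)"

text \<open>Curves are smooth maps out of this manifold; through it the chart lemmas apply to
  them.\<close>

lemma smooth_manifold_euclidean: "smooth_manifold (euclidean_manifold :: ('e::euclidean_space, 'e) manifold)"
proof -
  have "second_countable (euclidean :: 'e topology)"
  proof -
    obtain B :: "'e set set" where "countable B" "topological_basis B"
      using ex_countable_basis by blast
    then show ?thesis
      unfolding second_countable_def open_openin[symmetric]
      by (intro exI[of _ B]) (meson topological_basis_open topological_basisE)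
  qed
  moreover have "smooth_on UNIV (\<lambda>x::'e. x)"
    by (rule smooth_on_bounded_linear) (auto intro: bounded_linear_ident)
  moreover have "inv_into UNIV (id :: 'e \<Rightarrow> 'e) = id" by (simp add: inv_id)
  moreover have "homeomorphic_map euclidean euclidean (id :: 'e \<Rightarrow> 'e)" by simp
  ultimately show ?thesis
    by (simp add: smooth_manifold_def euclidean_manifold_def id_def o_def)
qed

lemma chart_homeomorphic:
  assumes "smooth_manifold M" "(U, \<phi>) \<in> atlas M"
  shows "openin (mtop M) U" "open (\<phi> ` U)"
    and "homeomorphic_map (subtopology (mtop M) U) (top_of_set (\<phi> ` U)) \<phi>"
    and "topspace (subtopology (mtop M) U) = U"
proof -
  show "openin (mtop M) U" "open (\<phi> ` U)" "homeomorphic_map (subtopology (mtop M) U) (top_of_set (\<phi> ` U)) \<phi>"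
    using assms unfolding smooth_manifold_def by blast+
  then show "topspace (subtopology (mtop M) U) = U"
    using openin_subset by (auto simp: topspace_subtopology)
qed

lemma chart_inj:
  assumes "smooth_manifold M" "(U, \<phi>) \<in> atlas M"
  shows "inj_on \<phi> U"
  using homeomorphic_imp_injective_map[OF chart_homeomorphic(3)[OF assms]] chart_homeomorphic(4)[OF assms] by simp

lemma chart_inv_into:
  assumes "smooth_manifold M" "(U, \<phi>) \<in> atlas M" "x \<in> U"
  shows "inv_into U \<phi> (\<phi> x) = x"
  using chart_inj[OF assms(1,2)] assms(3) by simp

lemma chart_open_image:
  assumes "smooth_manifold M" "(U, \<phi>) \<in> atlas M" "openin (mtop M) A"
  shows "open (\<phi> ` (U \<inter> A))"
proof -
  have "openin (subtopology (mtop M) U) (U \<inter> A)"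
    using assms(3) by (auto simp: openin_subtopology)
  then have "openin (top_of_set (\<phi> ` U)) (\<phi> ` (U \<inter> A))"
    using homeomorphic_imp_open_map[OF chart_homeomorphic(3)[OF assms(1,2)]] by (auto simp: open_map_def)
  then show ?thesis using chart_homeomorphic(2)[OF assms(1,2)] openin_open_trans by blast
qed

lemma chart_open_preimage:
  assumes "smooth_manifold M" "(U, \<phi>) \<in> atlas M" "open D"
  shows "openin (mtop M) {x \<in> U. \<phi> x \<in> D}"
proof -
  have "openin (top_of_set (\<phi> ` U)) (\<phi> ` U \<inter> D)"
    using assms(3) by auto
  then have "openin (subtopology (mtop M) U) {x \<in> topspace (subtopology (mtop M) U). \<phi> x \<in> \<phi> ` U \<inter> D}"
    using homeomorphic_imp_continuous_map[OF chart_homeomorphic(3)[OF assms(1,2)]]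
      openin_continuous_map_preimage by blast
  moreover have "{x \<in> topspace (subtopology (mtop M) U). \<phi> x \<in> \<phi> ` U \<inter> D} = {x \<in> U. \<phi> x \<in> D}"
    using chart_homeomorphic(4)[OF assms(1,2)] by auto
  ultimately show ?thesis
    using chart_homeomorphic(1)[OF assms(1,2)] openin_trans_full by metis
qed

lemma chart_transition_smooth:
  assumes "smooth_manifold M" "(U, \<phi>) \<in> atlas M" "(V, \<psi>) \<in> atlas M"
  shows "smooth_on (\<phi> ` (U \<inter> V)) (\<psi> \<circ> inv_into U \<phi>)" "open (\<phi> ` (U \<inter> V))"
proof -
  show "smooth_on (\<phi> ` (U \<inter> V)) (\<psi> \<circ> inv_into U \<phi>)"
    using assms unfolding smooth_manifold_def by blast
  show "open (\<phi> ` (U \<inter> V))"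
    by (rule chart_open_image[OF assms(1,2) chart_homeomorphic(1)[OF assms(1,3)]])
qed

lemma chart_at_in:
  assumes "smooth_manifold M" "x \<in> carrier M"
  shows "chart_at M x \<in> atlas M" "x \<in> fst (chart_at M x)"
proof -
  have "(\<Union>(U, \<phi>)\<in>atlas M. U) = carrier M"
    using assms(1) unfolding smooth_manifold_def by blast
  with assms(2) have "x \<in> (\<Union>(U, \<phi>)\<in>atlas M. U)" by simp
  then obtain c where "c \<in> atlas M \<and> x \<in> fst c" by auto
  then have "chart_at M x \<in> atlas M \<and> x \<in> fst (chart_at M x)"
    unfolding chart_at_def by (rule someI)
  then show "chart_at M x \<in> atlas M" "x \<in> fst (chart_at M x)" by auto
qed

lemma atlas_carrier:
  assumes "smooth_manifold M" "c \<in> atlas M" "x \<in> fst c"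
  shows "x \<in> carrier M"
  using openin_subset[OF chart_homeomorphic(1)[OF assms(1), of "fst c" "snd c"]] assms by auto

text \<open>\<open>smooth_map_on\<close> provides one suitable pair of charts near each point. Any
  other pair differs from it by transition maps on both sides, which are smooth, so the coordinate
  expression is smooth in every pair.\<close>

lemma smooth_map_on_chart:
  assumes M: "smooth_manifold M" and N: "smooth_manifold N" and f: "smooth_map_on M N W f"
    and c: "(U, \<phi>) \<in> atlas M" and d: "(V, \<psi>) \<in> atlas N"
  shows "open (\<phi> ` {x \<in> U \<inter> W. f x \<in> V})" "smooth_on (\<phi> ` {x \<in> U \<inter> W. f x \<in> V}) (\<psi> \<circ> f \<circ> inv_into U \<phi>)"
proof -
  let ?S = "\<phi> ` {x \<in> U \<inter> W. f x \<in> V}"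
  have *: "\<exists>T. open T \<and> y \<in> T \<and> T \<subseteq> ?S \<and> smooth_on T (\<psi> \<circ> f \<circ> inv_into U \<phi>)" if y: "y \<in> ?S" for y
  proof -
    obtain x where x: "x \<in> U" "x \<in> W" "f x \<in> V" "y = \<phi> x" using y by auto
    obtain U' \<phi>' V' \<psi>' D where c': "(U', \<phi>') \<in> atlas M" and d': "(V', \<psi>') \<in> atlas N"
      and D: "x \<in> U'" "open D" "\<phi>' x \<in> D" "D \<subseteq> \<phi>' ` (U' \<inter> W)" "\<And>y. y \<in> D \<Longrightarrow> f (inv_into U' \<phi>' y) \<in> V'"
        "smooth_on D (\<psi>' \<circ> f \<circ> inv_into U' \<phi>')"
      using bspec[OF f[unfolded smooth_map_on_def] x(2)] by (elim bexE exE conjE case_prodE) auto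
    let ?\<tau> = "\<phi>' \<circ> inv_into U \<phi>" and ?F = "\<psi>' \<circ> f \<circ> inv_into U' \<phi>'" and ?\<sigma> = "\<psi> \<circ> inv_into V' \<psi>'"
    note \<tau> = chart_transition_smooth[OF M c c']
    note \<sigma> = chart_transition_smooth[OF N d' d]
    define T1 where "T1 = D \<inter> ?F -` (\<psi>' ` (V' \<inter> V))"
    define T where "T = \<phi> ` (U \<inter> U') \<inter> ?\<tau> -` T1"
    have T1: "open T1"
      unfolding T1_def using continuous_open_preimage[OF smooth_on_continuous[OF D(6)] D(2) \<sigma>(2)] .
    have T: "open T"
      unfolding T_def using continuous_open_preimage[OF smooth_on_continuous[OF \<tau>(1)] \<tau>(2) T1] .
    have ix: "inv_into U' \<phi>' (\<phi>' z) = z" if "z \<in> U'" for z using chart_inv_into[OF M c' that] .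
    have ix0: "inv_into U \<phi> (\<phi> z) = z" if "z \<in> U" for z using chart_inv_into[OF M c that] .
    have iv: "inv_into V' \<psi>' (\<psi>' z) = z" if "z \<in> V'" for z using chart_inv_into[OF N d' that] .
    \<comment> \<open>The definition of \<open>T\<close> speaks of coordinates only; injectivity of
      the charts turns it into statements about one and the same point \<open>z\<close>.\<close>
    have inT: "\<exists>z. y = \<phi> z \<and> z \<in> U \<and> z \<in> U' \<and> z \<in> W \<and> f z \<in> V \<and> f z \<in> V' \<and> \<phi>' z \<in> D" if "y \<in> T" for y
    proof -
      obtain z where z: "y = \<phi> z" "z \<in> U" "z \<in> U'" "\<phi>' z \<in> D" "\<psi>' (f z) \<in> \<psi>' ` (V' \<inter> V)"
        using \<open>y \<in> T\<close> ix ix0 by (auto simp: T_def T1_def)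
      obtain z' where "\<phi>' z = \<phi>' z'" "z' \<in> U'" "z' \<in> W" using D(4) z(4) by auto
      then have "z \<in> W" using ix z(3) by metis
      moreover have "f z \<in> V'" using D(5)[OF z(4)] ix z(3) by simp
      moreover obtain w where "\<psi>' (f z) = \<psi>' w" "w \<in> V'" "w \<in> V" using z(5) by auto
      ultimately show ?thesis using z by (metis iv)
    qed
    have "T \<subseteq> ?S"
    proof
      fix y assume "y \<in> T"
      from inT[OF this] show "y \<in> ?S" by auto
    qed
    moreover have "y \<in> T"
    proof -
      have "f x \<in> V'" using D(5)[OF D(3)] ix[OF D(1)] by simp
      then show ?thesis using x D ix ix0 by (auto simp: T_def T1_def)
    qed
    moreover have "smooth_on T (\<psi> \<circ> f \<circ> inv_into U \<phi>)"
    proof -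
      have s1: "smooth_on T1 (\<lambda>y. ?\<sigma> (?F y))"
        by (rule smooth_on_compose[OF T1 \<sigma>(2) _ \<sigma>(1)])
          (use smooth_on_subset[OF D(6), of T1] in \<open>auto simp: T1_def o_def\<close>)
      have s2: "smooth_on T (\<lambda>y. (\<lambda>y. ?\<sigma> (?F y)) (?\<tau> y))"
        by (rule smooth_on_compose[OF T T1 _ s1])
          (use smooth_on_subset[OF \<tau>(1), of T] in \<open>auto simp: T_def o_def\<close>)
      have eq: "?\<sigma> (?F (?\<tau> y)) = (\<psi> \<circ> f \<circ> inv_into U \<phi>) y" if "y \<in> T" for y
        using inT[OF that] ix ix0 iv by auto
      show ?thesis by (rule iffD1[OF smooth_on_cong[OF T eq] s2])
    qed
    ultimately show ?thesis using T by blast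
  qed
  show "open ?S"
    unfolding open_subopen[of ?S]
  proof
    fix y assume "y \<in> ?S"
    from *[OF this] show "\<exists>T. open T \<and> y \<in> T \<and> T \<subseteq> ?S" by blast
  qed
  show "smooth_on ?S (\<psi> \<circ> f \<circ> inv_into U \<phi>)" 
  proof (rule smooth_on_local)
    fix y assume "y \<in> ?S"
    from *[OF this] show "\<exists>T. open T \<and> y \<in> T \<and> smooth_on T (\<psi> \<circ> f \<circ> inv_into U \<phi>)" by blast
  qed
qed

text \<open>The change of coordinates of tangent vectors at \<open>x\<close> from the chart
  \<open>c\<close> to the chart \<open>d\<close>. With \<open>d = chart_at M x\<close> it turns a
  coordinate vector in \<open>c\<close> into the tangent vector that it stands for.\<close>

definition transition_deriv :: "('m, 'e::euclidean_space) chart \<Rightarrow> ('m, 'e) chart \<Rightarrow> 'm \<Rightarrow> 'e \<Rightarrow> 'e" where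
  "transition_deriv c d x = fderiv (snd d \<circ> chart_inv c) (snd c x)"

lemma transition_deriv_works:
  assumes "smooth_manifold M" "c \<in> atlas M" "d \<in> atlas M" "x \<in> fst c" "x \<in> fst d"
  shows "((snd d \<circ> chart_inv c) has_derivative transition_deriv c d x) (at (snd c x))"
proof -
  obtain U \<phi> V \<psi> where "c = (U, \<phi>)" "d = (V, \<psi>)" by fastforce
  then show ?thesis
    using smooth_on_has_derivative[OF chart_transition_smooth(1)[OF assms(1)], of U \<phi> V \<psi> "\<phi> x"] assms
    by (auto simp: transition_deriv_def)
qed

lemma transition_deriv_linear:
  assumes "smooth_manifold M" "c \<in> atlas M" "d \<in> atlas M" "x \<in> fst c" "x \<in> fst d"
  shows "bounded_linear (transition_deriv c d x)"
  using transition_deriv_works[OF assms] has_derivative_bounded_linear by blast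

lemma transition_deriv_compose:
  assumes M: "smooth_manifold M" and c: "c \<in> atlas M" "d \<in> atlas M" "e \<in> atlas M"
    and x: "x \<in> fst c" "x \<in> fst d" "x \<in> fst e"
  shows "transition_deriv d e x (transition_deriv c d x v) = transition_deriv c e x v"
proof -
  obtain U \<phi> V \<psi> X \<xi> where eq: "c = (U, \<phi>)" "d = (V, \<psi>)" "e = (X, \<xi>)" by (meson surj_pair)
  have ix: "inv_into U \<phi> (\<phi> z) = z" if "z \<in> U" for z using chart_inv_into[OF M c(1)[unfolded eq] that] .
  have iv: "inv_into V \<psi> (\<psi> z) = z" if "z \<in> V" for z using chart_inv_into[OF M c(2)[unfolded eq] that] .
  have "snd d (chart_inv c (snd c x)) = snd d x" using ix x eq by simp
  then have D: "((\<lambda>y. (snd e \<circ> chart_inv d) ((snd d \<circ> chart_inv c) y)) has_derivative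
      (\<lambda>v. transition_deriv d e x (transition_deriv c d x v))) (at (snd c x))"
    using has_derivative_compose[OF transition_deriv_works[OF M c(1,2) x(1,2)], of "snd e \<circ> chart_inv d"
        "transition_deriv d e x"] transition_deriv_works[OF M c(2,3) x(2,3)] by simp
  have op: "open (\<phi> ` (U \<inter> V))"
    using chart_transition_smooth(2)[OF M] c eq by blast
  have "((snd e \<circ> chart_inv c) has_derivative
      (\<lambda>v. transition_deriv d e x (transition_deriv c d x v))) (at (snd c x))"
    by (rule has_derivative_transform_within_open[OF D op]) (use x ix iv eq in auto)
  then show ?thesis
    unfolding transition_deriv_def[of c e] by (simp add: frechet_derivative_eq)
qed

lemma transition_deriv_self:
  assumes M: "smooth_manifold M" and c: "c \<in> atlas M" "x \<in> fst c"
  shows "transition_deriv c c x v = v"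
proof -
  obtain U \<phi> where eq: "c = (U, \<phi>)" by fastforce
  have op: "open (\<phi> ` U)" using chart_homeomorphic(2)[OF M] c eq by blast
  have "((snd c \<circ> chart_inv c) has_derivative (\<lambda>v. v)) (at (snd c x))"
    by (rule has_derivative_transform_within_open[OF has_derivative_ident op])
      (use c chart_inv_into[OF M] eq in auto)
  then show ?thesis unfolding transition_deriv_def by (simp add: frechet_derivative_eq)
qed

text \<open>\<open>mderiv\<close> refers to selected charts that vary with the point; this reads it
  in fixed charts, where it can be differentiated again. Both sides are the derivative of one map
  from the coordinates of \<open>c\<close> to those of the chart selected at \<open>f x\<close>,
  factored through \<open>c0\<close> or through \<open>d\<close>.\<close>

lemma mderiv_chart:
  assumes M: "smooth_manifold M" and N: "smooth_manifold N" and f: "smooth_map_on M N W f"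
    and c: "c \<in> atlas M" "x \<in> fst c" and d: "d \<in> atlas N" "f x \<in> fst d" and x: "x \<in> W" "W \<subseteq> carrier M"
  shows "mderiv M N f x (transition_deriv c (chart_at M x) x v) =
    transition_deriv d (chart_at N (f x)) (f x)
      (fderiv (snd d \<circ> f \<circ> chart_inv c) (snd c x) v)"
proof -
  have xM: "x \<in> carrier M" using x by blast
  have fN: "f x \<in> carrier N"
    using atlas_carrier[OF N d] .
  define c0 d0 where "c0 = chart_at M x" and "d0 = chart_at N (f x)"
  have c0: "c0 \<in> atlas M" "x \<in> fst c0" using chart_at_in[OF M xM] by (auto simp: c0_def)
  have d0: "d0 \<in> atlas N" "f x \<in> fst d0" using chart_at_in[OF N fN] by (auto simp: d0_def)
  let ?i = "chart_inv c" and ?k = "chart_inv c0" and ?j = "chart_inv d"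
  have ix: "?i (snd c z) = z" if "z \<in> fst c" for z
    using chart_inv_into[OF M, of "fst c" "snd c"] c(1) that by simp
  have ix0: "?k (snd c0 z) = z" if "z \<in> fst c0" for z
    using chart_inv_into[OF M, of "fst c0" "snd c0"] c0(1) that by simp
  have iv: "?j (snd d z) = z" if "z \<in> fst d" for z
    using chart_inv_into[OF N, of "fst d" "snd d"] d(1) that by simp
  have sm: "smooth_on (snd c ` {x \<in> fst c \<inter> W. f x \<in> fst d}) (snd d \<circ> f \<circ> chart_inv c)"
    if "c \<in> atlas M" "d \<in> atlas N" for c d
    by (rule smooth_map_on_chart(2)[OF M N f, of "fst c" "snd c" "fst d" "snd d"]) (use that in simp_all)
  have op: "open (snd c ` {x \<in> fst c \<inter> W. f x \<in> fst d})"
    if "c \<in> atlas M" "d \<in> atlas N" for c d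
    by (rule smooth_map_on_chart(1)[OF M N f, of "fst c" "snd c" "fst d" "snd d"]) (use that in simp_all)
  have D: "((snd d \<circ> f \<circ> ?i) has_derivative fderiv (snd d \<circ> f \<circ> ?i) (snd c x)) (at (snd c x))"
    by (rule smooth_on_has_derivative[OF sm[OF c(1) d(1)]]) (use c d x in auto)
  have m: "mderiv M N f x = fderiv (snd d0 \<circ> f \<circ> ?k) (snd c0 x)"
    by (simp add: mderiv_def c0_def d0_def split: prod.split)
  have D0: "((snd d0 \<circ> f \<circ> ?k) has_derivative mderiv M N f x) (at (snd c0 x))"
    unfolding m by (rule smooth_on_has_derivative[OF sm[OF c0(1) d0(1)]]) (use c0 d0 x in auto)
  have 1: "((\<lambda>y. (snd d0 \<circ> f \<circ> ?k) ((snd c0 \<circ> ?i) y)) has_derivative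
      (\<lambda>v. mderiv M N f x (transition_deriv c c0 x v))) (at (snd c x))"
    by (rule has_derivative_compose[OF transition_deriv_works[OF M c(1) c0(1) c(2) c0(2)]])
      (use D0 ix[OF c(2)] in \<open>simp add: o_def\<close>)
  have 2: "((\<lambda>y. (snd d0 \<circ> ?j) ((snd d \<circ> f \<circ> ?i) y)) has_derivative
      (\<lambda>v. transition_deriv d d0 (f x) (fderiv (snd d \<circ> f \<circ> ?i) (snd c x) v))) (at (snd c x))"
    by (rule has_derivative_compose[OF D])
      (use transition_deriv_works[OF N d(1) d0(1) d(2) d0(2)] ix[OF c(2)] in \<open>simp add: o_def\<close>)
  have "open (snd c ` (fst c \<inter> fst c0))"
    by (rule chart_transition_smooth(2)[OF M, of "fst c" "snd c" "fst c0" "snd c0"]) (use c(1) c0(1) in simp_all)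
  then have op': "open (snd c ` {x \<in> fst c \<inter> W. f x \<in> fst d} \<inter> snd c ` (fst c \<inter> fst c0))" (is "open ?O")
    using op[OF c(1) d(1)] by blast
  have "((\<lambda>y. (snd d0 \<circ> f \<circ> ?k) ((snd c0 \<circ> ?i) y)) has_derivative
      (\<lambda>v. transition_deriv d d0 (f x) (fderiv (snd d \<circ> f \<circ> ?i) (snd c x) v))) (at (snd c x))"
  proof (rule has_derivative_transform_within_open[OF 2 op'])
    show "snd c x \<in> ?O" using c c0 x d by blast
    fix y assume y: "y \<in> ?O"
    obtain z where z1: "y = snd c z" "z \<in> fst c" "f z \<in> fst d" using y by blast
    obtain z' where z2: "y = snd c z'" "z' \<in> fst c" "z' \<in> fst c0" using y by blast
    note z = z1 z2
    have "z = z'" using z ix by metis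
    then show "(snd d0 \<circ> ?j) ((snd d \<circ> f \<circ> ?i) y) = (snd d0 \<circ> f \<circ> ?k) ((snd c0 \<circ> ?i) y)"
      using z ix ix0 iv by auto
  qed
  from has_derivative_unique[OF 1 this] show ?thesis
    by (simp add: c0_def d0_def fun_eq_iff)
qed

lemma transition_deriv_zero_iff:
  assumes "smooth_manifold M" "c \<in> atlas M" "d \<in> atlas M" "x \<in> fst c" "x \<in> fst d"
  shows "transition_deriv c d x v = 0 \<longleftrightarrow> v = 0"
proof -
  have "transition_deriv d c x (transition_deriv c d x v) = v"
    using transition_deriv_compose[OF assms(1) assms(2,3,2) assms(4,5,4)] transition_deriv_self[OF assms(1,2,4)] by simp
  moreover have "transition_deriv d c x 0 = 0" "transition_deriv c d x 0 = 0"
    using linear_0[OF bounded_linear.linear[OF transition_deriv_linear[OF assms]]]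
      linear_0[OF bounded_linear.linear[OF transition_deriv_linear[OF assms(1,3,2,5,4)]]] by simp_all
  ultimately show ?thesis by metis
qed

lemma form_in_chart_apply:
  assumes "smooth_manifold M" "c \<in> atlas M" "x \<in> fst c"
  shows "form_in_chart M c \<alpha> (snd c x) v = \<alpha> x (transition_deriv c (chart_at M x) x v)"
proof -
  have x: "x \<in> carrier M"
    using atlas_carrier[OF assms] .
  have i: "chart_inv c (snd c x) = x"
    using chart_inv_into[OF assms(1), of "fst c" "snd c"] assms by simp
  have "blinfun_apply (Blinfun (transition_deriv c (chart_at M x) x)) = transition_deriv c (chart_at M x) x"
    by (rule bounded_linear_Blinfun_apply[OF transition_deriv_linear[OF assms(1,2) _ assms(3)]])
      (use chart_at_in[OF assms(1) x] in auto)
  then show ?thesis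
    by (simp add: form_in_chart_def case_prod_beta Let_def i transition_deriv_def)
qed

section \<open>Curves in fibres and brackets of frames\<close>

text \<open>The map \<open>k\<close> completes \<open>h\<close> to a local diffeomorphism. In the
  coordinates \<open>(h, k)\<close> the fibre of \<open>h\<close> is flat, and the curve is a
  straight line in it, pulled back to \<open>Y\<close>.\<close>

lemma fibre_curve:
  fixes h :: "'a::euclidean_space \<Rightarrow> 'b::euclidean_space" and k :: "'a \<Rightarrow> 'c::euclidean_space"
  assumes "open Y" "smooth_on Y h" "y \<in> Y" "linear k" "DIM('a) = DIM('b) + DIM('c)"
    and inj: "\<And>w. fderiv h y w = 0 \<Longrightarrow> k w = 0 \<Longrightarrow> w = 0"
    and v: "fderiv h y v = 0"
  obtains e c where "e > 0" "c 0 = y" "c ` {-e<..<e} \<subseteq> Y" "smooth_on {-e<..<e::real} c"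
    "(c has_vector_derivative v) (at 0)" "\<And>s. s \<in> {-e<..<e} \<Longrightarrow> h (c s) = h y"
proof -
  \<comment> \<open>The inverse function theorem above is for maps of a space to itself, so
    \<open>'b \<times> 'c\<close> is identified with \<open>'a\<close>.\<close>
  obtain j :: "'b \<times> 'c \<Rightarrow> 'a" where j: "linear j" "inj j"
    using subspace_isomorphism[OF subspace_UNIV subspace_UNIV, where 'a="'b \<times> 'c" and 'b='a] assms(5) by auto
  define G where "G = (\<lambda>z. j (h z, k z))"
  have k: "bounded_linear k" using assms(4) linear_conv_bounded_linear by blast
  have jb: "bounded_linear j" using j linear_conv_bounded_linear by blast
  have G: "smooth_on Y G"
    unfolding G_def by (intro smooth_on_linear[OF assms(1) jb] smooth_on_Pair assms(1,2) smooth_on_bounded_linear k)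
  have dh: "(h has_derivative fderiv h y) (at y)"
    using smooth_on_has_derivative[OF assms(2,3)] .
  have dG: "(G has_derivative (\<lambda>w. j (fderiv h y w, k w))) (at y)"
    unfolding G_def
    by (intro bounded_linear.has_derivative[OF jb] has_derivative_Pair dh bounded_linear_imp_has_derivative k)
  then have DG: "fderiv G y = (\<lambda>w. j (fderiv h y w, k w))"
    by (rule frechet_derivative_eq)
  have linG: "linear (fderiv G y)"
    unfolding DG using dG has_derivative_linear by blast
  have z: "w = 0" if "fderiv G y w = 0" for w
  proof -
    have "j (fderiv h y w, k w) = j 0" using that j linear_0 by (simp add: DG)
    then have "(fderiv h y w, k w) = 0" using j(2) by (simp add: inj_eq)
    then show ?thesis using inj[of w] by (simp add: zero_prod_def)
  qed
  then have "inj (fderiv G y)"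
    using linear_injective_0[OF linG] by blast
  then obtain U' V g where g: "open U'" "U' \<subseteq> Y" "y \<in> U'" "open V" "G y \<in> V" "homeomorphism U' V G g" "smooth_on V g"
    using smooth_inverse_function[OF assms(1) G assms(3)] by metis
  have gV: "g q \<in> U'" "G (g q) = q" if "q \<in> V" for q using g(6) that by (auto simp: homeomorphism_def)
  have gy: "g (G y) = y" using g(3,6) by (auto simp: homeomorphism_def)
  define l where "l = (\<lambda>s::real. G y + s *\<^sub>R j (0, k v))"
  have l: "(l has_vector_derivative j (0, k v)) (at s)" for s
    unfolding l_def by (auto intro!: derivative_eq_intros)
  have "open (l -` V)"
    by (rule continuous_open_vimage[OF g(4)]) (auto simp: l_def intro!: continuous_intros)
  moreover have "0 \<in> l -` V" using g(5) by (simp add: l_def)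
  ultimately obtain e where e: "e > 0" "ball 0 e \<subseteq> l -` V" using open_contains_ball by blast
  have lV: "l s \<in> V" if "s \<in> {-e<..<e}" for s using that e by (auto simp: subset_eq dist_real_def)
  have sl: "smooth_on {-e<..<e} l"
    unfolding l_def by (intro smooth_on_add smooth_on_const smooth_on_bounded_linear bounded_linear_scaleR_left) auto
  define c where "c = (\<lambda>s. g (l s))"
  have c0: "c 0 = y" by (simp add: c_def l_def gy)
  have sc: "smooth_on {-e<..<e} c"
    unfolding c_def by (rule smooth_on_compose[OF _ g(4) _ g(7) sl]) (use lV in auto)
  have cY: "c ` {-e<..<e} \<subseteq> Y" using lV gV g(2) by (auto simp: c_def)
  have Gc: "G (c s) = l s" if "s \<in> {-e<..<e}" for s using lV[OF that] gV by (simp add: c_def)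
  have hc: "h (c s) = h y" if "s \<in> {-e<..<e}" for s
  proof -
    have "j (h (c s), k (c s)) = j (h y, k y + s *\<^sub>R k v)"
      using Gc[OF that] linear_add[OF j(1)] linear_scale[OF j(1)]
      by (simp add: G_def l_def linear_add[OF j(1), symmetric] linear_scale[OF j(1), symmetric])
    then show ?thesis using j(2) by (simp add: inj_eq)
  qed
  have "c differentiable at 0" using smooth_on_differentiable[OF sc] e(1) by simp
  then obtain c' where c': "(c has_vector_derivative c') (at 0)"
    using vector_derivative_works by blast
  have "((\<lambda>s. G (c s)) has_vector_derivative fderiv G y c') (at 0)"
    using has_derivative_compose[OF c'[unfolded has_vector_derivative_def], of G "fderiv G y"]
      smooth_on_has_derivative[OF G assms(3)] linear_scale[OF linG]
    unfolding has_vector_derivative_def c0 by simp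
  moreover have "((\<lambda>s. G (c s)) has_vector_derivative j (0, k v)) (at 0)"
    by (rule has_vector_derivative_transform_within_open[OF l, of "{-e<..<e}"]) (use Gc e in auto)
  \<comment> \<open>Here \<open>fderiv h y v = 0\<close> enters: it makes \<open>j (0, k v)\<close>
    the image of \<open>v\<close> under the derivative of \<open>G\<close>.\<close>
  ultimately have "fderiv G y c' = fderiv G y v"
    using vector_derivative_unique_at by (simp add: DG v) blast
  then have "c' = v" using \<open>inj (fderiv G y)\<close> by (simp add: inj_eq)
  then show thesis using that e(1) c0 cY sc c' hc by blast
qed

text \<open>An immersion has a smooth local left inverse: composed with a linear left inverse
  \<open>E\<close> of its derivative it becomes a local diffeomorphism \<open>G\<close>.
  Differentiability of \<open>h\<close> along \<open>c\<close> then passes to \<open>c\<close>,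
  whose continuity keeps it in the region where \<open>G\<close> is invertible.\<close>

lemma lift_curve_differentiable:
  fixes h :: "'a::euclidean_space \<Rightarrow> 'b::euclidean_space" and c :: "real \<Rightarrow> 'a"
  assumes "open Y" "smooth_on Y h" "c 0 \<in> Y" "inj (fderiv h (c 0))"
    and "isCont c 0" "((\<lambda>s. h (c s)) has_vector_derivative a) (at 0)"
  obtains v where "(c has_vector_derivative v) (at 0)" "fderiv h (c 0) v = a"
proof -
  have dh: "(h has_derivative fderiv h (c 0)) (at (c 0))"
    using smooth_on_has_derivative[OF assms(2,3)] .
  then obtain E where E: "linear E" "E \<circ> fderiv h (c 0) = id"
    using linear_injective_left_inverse[OF has_derivative_linear assms(4)] by blast
  then have Eb: "bounded_linear E" using linear_conv_bounded_linear by blast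
  define G where "G = (\<lambda>z. E (h z))"
  have G: "smooth_on Y G" unfolding G_def by (rule smooth_on_linear[OF assms(1) Eb assms(2)])
  have "fderiv G (c 0) = id"
    using bounded_linear.has_derivative[OF Eb dh] E(2) unfolding G_def
    by (simp add: frechet_derivative_eq o_def)
  then obtain U' V g where g: "open U'" "U' \<subseteq> Y" "c 0 \<in> U'" "open V" "G (c 0) \<in> V" "homeomorphism U' V G g" "smooth_on V g"
    using smooth_inverse_function[OF assms(1) G assms(3)] by (metis inj_on_id)
  have gG: "g (G q) = q" if "q \<in> U'" for q using g(6) that by (auto simp: homeomorphism_def)
  have Gc: "((\<lambda>s. G (c s)) has_vector_derivative E a) (at 0)"
    unfolding G_def by (rule bounded_linear.has_vector_derivative[OF Eb assms(6)])
  have dg: "(g has_derivative fderiv g (G (c 0))) (at (G (c 0)))"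
    using smooth_on_has_derivative[OF g(7,5)] .
  have "((\<lambda>s. g (G (c s))) has_derivative (\<lambda>d. fderiv g (G (c 0)) (d *\<^sub>R E a))) (at 0)"
    by (rule has_derivative_compose[OF Gc[unfolded has_vector_derivative_def] dg])
  moreover have "\<forall>\<^sub>F s in at 0. g (G (c s)) = c s"
    using topological_tendstoD[OF assms(5)[unfolded isCont_def] g(1,3)] by eventually_elim (rule gG)
  ultimately have "(c has_derivative (\<lambda>d. fderiv g (G (c 0)) (d *\<^sub>R E a))) (at 0)"
    by (rule has_derivative_transform_eventually) (use gG g(3) in auto)
  then obtain v where v: "(c has_vector_derivative v) (at 0)"
    by (metis differentiable_def vector_derivative_works)
  have "((\<lambda>s. h (c s)) has_vector_derivative fderiv h (c 0) v) (at 0)"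
    using has_derivative_compose[OF v[unfolded has_vector_derivative_def] dh]
      linear_scale[OF has_derivative_linear[OF dh]]
    unfolding has_vector_derivative_def by simp
  then have "fderiv h (c 0) v = a"
    using vector_derivative_unique_at assms(6) by blast
  then show thesis using that v by blast
qed

section \<open>Derivatives along vector fields and Lie brackets of frames\<close>

lemma frechet_derivative_blinfun_apply:
  assumes "F differentiable at y"
  shows "fderiv (\<lambda>y. blinfun_apply (F y) w) y u = blinfun_apply (fderiv F y u) w"
proof -
  have "((\<lambda>y. blinfun_apply (F y) w) has_derivative (\<lambda>u. blinfun_apply (fderiv F y u) w)) (at y)"
    by (rule bounded_linear.has_derivative[OF blinfun.bounded_linear_left has_derivative_frechet[OF assms]])
  then show ?thesis by (simp add: frechet_derivative_eq)
qed

text \<open>The product rule for evaluating the derivative of \<open>f\<close> on a field: as the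
  direction \<open>\<xi>\<close> moves with the point, a term with \<open>\<xi>'\<close> joins the
  second derivative.\<close>

lemma frechet_derivative_apply_field:
  fixes f :: "'a::euclidean_space \<Rightarrow> 'b::real_normed_vector"
  assumes "open Y" "smooth_on Y f" "y \<in> Y" "(\<xi> has_derivative \<xi>') (at y)"
  shows "((\<lambda>y. fderiv f y (\<xi> y)) has_derivative
      (\<lambda>u. fderiv (\<lambda>y'. fderiv f y' (\<xi> y)) y u
        + fderiv f y (\<xi>' u))) (at y)"
proof -
  let ?F = "\<lambda>x. Blinfun (fderiv f x)"
  have app: "blinfun_apply (?F x) = fderiv f x" if "x \<in> Y" for x
    using has_derivative_Blinfun_apply[OF smooth_on_has_derivative[OF assms(2) that]] .
  have F: "?F differentiable at y"
    using smooth_on_differentiable[OF smooth_on_Blinfun_frechet[OF assms(1,2)] assms(3)] .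
  have "fderiv (\<lambda>y'. fderiv f y' (\<xi> y)) y
      = fderiv (\<lambda>y'. ?F y' (\<xi> y)) y"
    by (rule frechet_derivative_cong_open[OF assms(1,3)]) (simp add: app)
  then have eq: "fderiv (\<lambda>y'. fderiv f y' (\<xi> y)) y u = fderiv ?F y u (\<xi> y)" for u
    using frechet_derivative_blinfun_apply[OF F] by simp
  have "((\<lambda>y. ?F y (\<xi> y)) has_derivative (\<lambda>u. ?F y (\<xi>' u) + fderiv ?F y u (\<xi> y))) (at y)"
    by (rule bounded_bilinear.FDERIV[OF bounded_bilinear_blinfun_apply has_derivative_frechet[OF F] assms(4)])
  then show ?thesis
    unfolding eq app[OF assms(3)] add.commute[of "fderiv f y _"]
    by (rule has_derivative_transform_within_open[OF _ assms(1,3)]) (simp add: app)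
qed

text \<open>The Lie bracket, in coordinates, of the two fields that have the constant coefficients
  \<open>w\<close> and \<open>w'\<close> with respect to the frame \<open>X\<close>.\<close>

definition frame_bracket ::
  "('a::euclidean_space \<Rightarrow> 'a \<Rightarrow>\<^sub>L 'a) \<Rightarrow> 'a \<Rightarrow> 'a \<Rightarrow> 'a \<Rightarrow> 'a" where
  "frame_bracket X w w' y = fderiv (\<lambda>y. X y w') y (X y w) - fderiv (\<lambda>y. X y w) y (X y w')"

text \<open>Cartan's formula \<open>d\<alpha>(X, Y) = X \<alpha>(Y) - Y \<alpha>(X) -
  \<alpha>([X, Y])\<close>, in which the first two terms vanish because the coframe takes constant
  values on the frame fields.\<close>

lemma coframe_derivative_bracket:
  fixes A X :: "'a::euclidean_space \<Rightarrow> 'a \<Rightarrow>\<^sub>L 'a"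
  assumes "open Y" "smooth_on Y A" "smooth_on Y X" "\<And>y. y \<in> Y \<Longrightarrow> A y o\<^sub>L X y = id_blinfun" "y \<in> Y"
  shows "fderiv A y (X y w) (X y w') - fderiv A y (X y w') (X y w)
      = - A y (frame_bracket X w w' y)"
proof -
  have dX: "((\<lambda>y. X y w) has_derivative fderiv (\<lambda>y. X y w) y) (at y)" for w
    by (intro smooth_on_has_derivative[OF _ assms(5)] smooth_on_linear[OF assms(1) blinfun.bounded_linear_left] assms(3))
  have *: "A y (fderiv (\<lambda>y. X y w) y u) + fderiv A y u (X y w) = 0" for w u
  proof -
    have 1: "((\<lambda>y. A y (X y w)) has_derivative (\<lambda>u. A y (fderiv (\<lambda>y. X y w) y u)
        + fderiv A y u (X y w))) (at y)"
      by (rule bounded_bilinear.FDERIV[OF bounded_bilinear_blinfun_apply smooth_on_has_derivative[OF assms(2,5)] dX])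
    have "A y (X y w) = w" if "y \<in> Y" for y
      using assms(4)[OF that] by (metis blinfun_apply_blinfun_compose blinfun_apply_id_blinfun)
    then have 2: "((\<lambda>y. A y (X y w)) has_derivative (\<lambda>u. 0)) (at y)"
      by (intro has_derivative_transform_within_open[OF has_derivative_const assms(1,5)]) auto
    show ?thesis using has_derivative_unique[OF 1 2] by metis
  qed
  from *[where u="X y w" and w=w'] *[where u="X y w'" and w=w] show ?thesis
    unfolding frame_bracket_def blinfun.diff_right by (simp add: add_eq_0_iff)
qed

text \<open>The field of \<open>w\<close> is killed by the derivative of \<open>f\<close> on all of
  \<open>Y\<close>. Differentiating this along the field of \<open>w'\<close> replaces one half of
  the bracket by a second derivative of \<open>f\<close>; by symmetry, the latter is the term that
  completes the other half to a total derivative along the field of \<open>w\<close>.\<close>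

lemma kernel_bracket:
  fixes X :: "'a::euclidean_space \<Rightarrow> 'a \<Rightarrow>\<^sub>L 'a" and f :: "'a \<Rightarrow> 'b::euclidean_space"
  assumes "open Y" "smooth_on Y f" "smooth_on Y X" "\<And>y. y \<in> Y \<Longrightarrow> fderiv f y (X y w) = 0" "y \<in> Y"
  shows "fderiv f y (frame_bracket X w w' y)
    = fderiv (\<lambda>y. fderiv f y (X y w')) y (X y w)"
proof -
  have dX: "((\<lambda>y. X y w) has_derivative fderiv (\<lambda>y. X y w) y) (at y)" for w
    by (intro smooth_on_has_derivative[OF _ assms(5)] smooth_on_linear[OF assms(1) blinfun.bounded_linear_left] assms(3))
  note D = frechet_derivative_apply_field[OF assms(1,2,5) dX]
  have "((\<lambda>y. fderiv f y (X y w)) has_derivative (\<lambda>u. 0)) (at y)"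
    by (rule has_derivative_transform_within_open[OF has_derivative_const assms(1,5)]) (simp add: assms(4))
  from has_derivative_unique[OF D this]
  have 1: "fderiv (\<lambda>y'. fderiv f y' (X y w)) y u
        + fderiv f y (fderiv (\<lambda>y. X y w) y u) = 0" for u
    by metis
  have 2: "fderiv (\<lambda>y. fderiv f y (X y w')) y (X y w) =
      fderiv (\<lambda>y'. fderiv f y' (X y w')) y (X y w)
        + fderiv f y (fderiv (\<lambda>y. X y w') y (X y w))"
    using frechet_derivative_eq[OF D] by metis
  have "linear (fderiv f y)"
    using has_derivative_linear[OF smooth_on_has_derivative[OF assms(2,5)]] .
  then have 3: "fderiv f y (frame_bracket X w w' y) =
      fderiv f y (fderiv (\<lambda>y. X y w') y (X y w))
      - fderiv f y (fderiv (\<lambda>y. X y w) y (X y w'))"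
    unfolding frame_bracket_def by (rule linear_diff)
  show ?thesis
    unfolding 2 3 second_derivative_symmetric[OF assms(1,5,2), of "X y w'" "X y w"]
    using 1[of "X y w'"] by (simp add: eq_neg_iff_add_eq_0 algebra_simps)
qed

section \<open>Curves of planes\<close>

lemma bounded_linear_matrix_of_blinfun:
  "bounded_linear (\<lambda>b :: (real^'n::finite) \<Rightarrow>\<^sub>L (real^'m::finite). matrix (blinfun_apply b))"
proof -
  have "bounded_linear (\<lambda>b :: (real^'n) \<Rightarrow>\<^sub>L (real^'m). \<Sum>i\<in>UNIV. axis i (\<Sum>j\<in>UNIV. axis j (b (axis j 1) $ i)))"
    by (intro bounded_linear_sum bounded_linear_compose[OF bounded_linear_axis]
        bounded_linear_compose[OF bounded_linear_vec_nth] blinfun.bounded_linear_left)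
  moreover have "(\<Sum>i\<in>UNIV. axis i (\<Sum>j\<in>UNIV. axis j (b (axis j 1) $ i))) = matrix (blinfun_apply b)"
    for b :: "(real^'n) \<Rightarrow>\<^sub>L (real^'m)"
    by (simp add: vec_eq_iff matrix_def axis_def sum_component if_distrib[of "\<lambda>v. v $ _"] sum.delta cong: if_cong)
  ultimately show ?thesis by simp
qed

lemma bounded_linear_Blinfun_matrix_vector:
  "bounded_linear (\<lambda>M :: real^'n::finite^'m::finite. Blinfun ((*v) M))"
proof -
  have bl: "bounded_linear ((*v) M)" for M :: "real^'n^'m"
    by (simp add: linear_conv_bounded_linear[symmetric])
  show ?thesis
    unfolding linear_conv_bounded_linear[symmetric]
    by (rule linearI) (auto intro!: blinfun_eqI
        simp: bounded_linear_Blinfun_apply[OF bl] blinfun.bilinear_simps matrix_vector_mult_add_rdistrib scaleR_matrix_vector_assoc)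
qed

text \<open>The lower bound \<open>m * norm u\<close> for \<open>p 0\<close> survives perturbations
  of norm less than \<open>m\<close>.\<close>

lemma eventually_blinfun_invertible:
  fixes p :: "real \<Rightarrow> 'a::euclidean_space \<Rightarrow>\<^sub>L 'a"
  assumes "isCont p 0" "inj (blinfun_apply (p 0))"
  shows "\<forall>\<^sub>F s in nhds 0. bij (blinfun_apply (p s))"
proof -
  have lin: "linear (blinfun_apply q)" for q :: "'a \<Rightarrow>\<^sub>L 'a" by (rule linear_blinfun_apply)
  obtain m where m: "m > 0" "\<And>u. norm (p 0 u) \<ge> m * norm u"
    using linear_inj_bounded_below_pos[OF lin assms(2)] by metis
  have "\<forall>\<^sub>F s in nhds 0. dist (p s) (p 0) < m"
    using assms(1) m(1) tendsto_at_iff_tendsto_nhds[of p 0] tendstoD unfolding isCont_def by blast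
  then show ?thesis
  proof eventually_elim
    case (elim s)
    have "u = 0" if "p s u = 0" for u
    proof (rule ccontr)
      assume u: "u \<noteq> 0"
      have "m * norm u \<le> norm ((p s - p 0) u)"
        using m(2)[of u] that by (simp add: blinfun.diff_left)
      also have "\<dots> \<le> norm (p s - p 0) * norm u" by (rule norm_blinfun)
      also have "\<dots> < m * norm u" using elim u by (simp add: dist_norm)
      finally show False by simp
    qed
    then have "inj (blinfun_apply (p s))" using linear_injective_0[OF lin] by blast
    then show ?case using linear_injective_imp_surjective[OF lin] by (simp add: bij_def)
  qed
qed

text \<open>The derivative at \<open>W\<close> of a curve of planes is a map \<open>W \<Rightarrow> V / W\<close>, computed by
  differentiating a moving frame and projecting; here \<open>V / W\<close> is identified with \<open>real^'n\<close> by
  the map \<open>g (a, b) \<mapsto> b - A0 *v a\<close>.\<close>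

lemma graph_plane_curve:
  fixes B :: "real \<Rightarrow> (real^'n::finite) \<Rightarrow>\<^sub>L ((real^'n) \<times> (real^'n))"
  assumes g: "linear g" "bij g"
    and B: "(B has_vector_derivative B') (at 0)" "range (B 0) = graph_plane g A0"
  obtains A' where "((\<lambda>s. inv (graph_plane g) (range (B s))) has_vector_derivative A') (at 0)"
    "\<And>u. A' *v fst (inv g (B 0 u)) = snd (inv g (B' u)) - A0 *v fst (inv g (B' u))"
    "\<forall>\<^sub>F s in nhds 0. range (B s) \<in> range (graph_plane g)" "bij (\<lambda>u. fst (inv g (B 0 u)))"
proof -
  have lin: "linear (blinfun_apply q)" for q :: "'x::real_normed_vector \<Rightarrow>\<^sub>L 'y::real_normed_vector" by (rule linear_blinfun_apply)
  have "linear (inv g)" using g by (simp add: inj_linear_imp_inv_linear bij_is_inj)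
  then have "bounded_linear (inv g)" using linear_conv_bounded_linear by blast
  then obtain G where G: "blinfun_apply G = inv g" by (metis bounded_linear_Blinfun_apply)
  have gG: "g (inv g z) = z" "inv g (g z) = z" for z
    using g(2) by (simp_all add: bij_is_surj surj_f_inv_f bij_is_inj)
  \<comment> \<open>In the coordinates of \<open>g\<close> the frame has components \<open>p\<close>
    and \<open>r\<close>. As long as \<open>p s\<close> is invertible, the plane is the graph of
    \<open>r s\<close> composed with the inverse \<open>J s\<close> of \<open>p s\<close>.\<close>
  define p where "p = (\<lambda>s. fst_blinfun o\<^sub>L (G o\<^sub>L B s))"
  define r where "r = (\<lambda>s. snd_blinfun o\<^sub>L (G o\<^sub>L B s))"
  define p' where "p' = fst_blinfun o\<^sub>L (G o\<^sub>L B')"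
  define r' where "r' = snd_blinfun o\<^sub>L (G o\<^sub>L B')"
  note comp = bounded_linear.has_vector_derivative[OF bounded_bilinear.bounded_linear_right[OF bounded_bilinear_blinfun_compose]]
  have dp: "(p has_vector_derivative p') (at 0)" unfolding p_def p'_def by (intro comp B)
  have dr: "(r has_vector_derivative r') (at 0)" unfolding r_def r'_def by (intro comp B)
  have pr: "B s u = g (p s u, r s u)" for s u
    by (simp add: p_def r_def G gG)
  have r0: "r 0 u = A0 *v p 0 u" for u
  proof -
    obtain w where "B 0 u = g (w, A0 *v w)" using B(2) unfolding graph_plane_def by blast
    then show ?thesis by (simp add: p_def r_def G gG)
  qed
  have "\<exists>u. p 0 u = w" for w
  proof -
    have "g (w, A0 *v w) \<in> range (B 0)" unfolding B(2) graph_plane_def by blast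
    then obtain u where "B 0 u = g (w, A0 *v w)" by (metis rangeE)
    then show ?thesis by (intro exI[of _ u]) (simp add: p_def G gG)
  qed
  then have "surj (blinfun_apply (p 0))" by (metis surj_def)
  then have inj: "inj (blinfun_apply (p 0))" using linear_surjective_imp_injective[OF lin] by blast
  have "isCont p 0" using dp has_vector_derivative_continuous by blast
  from eventually_blinfun_invertible[OF this inj]
  obtain S where S: "open S" "0 \<in> S" "\<And>s. s \<in> S \<Longrightarrow> bij (blinfun_apply (p s))"
    unfolding eventually_nhds by blast
  define J where "J = (\<lambda>s. Blinfun (inv (blinfun_apply (p s))))"
  have Japp: "blinfun_apply (J s) = inv (blinfun_apply (p s))" if "s \<in> S" for s
  proof -
    have "linear (inv (blinfun_apply (p s)))"
      by (rule inj_linear_imp_inv_linear[OF lin]) (use S(3)[OF that] in \<open>simp add: bij_is_inj\<close>)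
    then show ?thesis unfolding J_def using linear_conv_bounded_linear bounded_linear_Blinfun_apply by blast
  qed
  have JA: "J s o\<^sub>L p s = id_blinfun" "p s o\<^sub>L J s = id_blinfun" if "s \<in> S" for s
    using S(3)[OF that] Japp[OF that] by (auto intro!: blinfun_eqI simp: bij_is_inj bij_is_surj surj_f_inv_f)
  have dJ: "(J has_vector_derivative - (J 0 o\<^sub>L (p' o\<^sub>L J 0))) (at 0)"
    using blinfun_inverse_has_derivative[OF S(1,2) dp[unfolded has_vector_derivative_def] JA]
    unfolding has_vector_derivative_def
    by (simp add: bounded_bilinear.scaleR_left[OF bounded_bilinear_blinfun_compose]
        bounded_bilinear.scaleR_right[OF bounded_bilinear_blinfun_compose])
  define A where "A = (\<lambda>s. matrix (blinfun_apply (r s o\<^sub>L J s)))"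
  \<comment> \<open>The product rule for \<open>r\<close> composed with \<open>J\<close>. As
    \<open>r 0 = A0 p 0\<close>, evaluation at \<open>p 0 u\<close> leaves
    \<open>r' u - A0 p' u\<close>, the derivative of the frame projected along the plane.\<close>
  define A' where "A' = matrix (blinfun_apply ((r 0 o\<^sub>L - (J 0 o\<^sub>L (p' o\<^sub>L J 0))) + (r' o\<^sub>L J 0)))"
  have dA: "(A has_vector_derivative A') (at 0)"
    unfolding A_def A'_def
    by (intro bounded_linear.has_vector_derivative[OF bounded_linear_matrix_of_blinfun]
        bounded_bilinear.has_vector_derivative[OF bounded_bilinear_blinfun_compose] dJ dr)
  have Aapp: "matrix (blinfun_apply q) *v u = q u" for q :: "(real^'n) \<Rightarrow>\<^sub>L (real^'n)" and u
    by (rule fun_cong[OF matrix_vector_mul(2)[OF lin[of q]]])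
  have rng: "range (B s) = graph_plane g (A s)" if "s \<in> S" for s
  proof -
    have "B s u = g (p s u, A s *v p s u)" for u
      unfolding pr A_def Aapp using JA(1)[OF that]
      by (metis blinfun_apply_blinfun_compose blinfun_apply_id_blinfun)
    then show ?thesis
      unfolding graph_plane_def using bij_is_surj[OF S(3)[OF that]] by (metis (no_types, lifting) image_cong image_image)
  qed
  have ev: "\<forall>\<^sub>F s in nhds 0. s \<in> S" using S eventually_nhds_in_open by blast
  show thesis
  proof (rule that)
    show "((\<lambda>s. inv (graph_plane g) (range (B s))) has_vector_derivative A') (at 0)"
    proof (rule has_vector_derivative_transform_within_open[OF dA S(1,2)])
      show "A s = inv (graph_plane g) (range (B s))" if "s \<in> S" for s
        unfolding rng[OF that] by (simp add: inv_f_f[OF inj_graph_plane[OF g]])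
    qed
    show "\<forall>\<^sub>F s in nhds 0. range (B s) \<in> range (graph_plane g)"
      using ev by eventually_elim (use rng in blast)
    have fp: "fst (inv g (B 0 u)) = p 0 u" for u by (simp add: p_def G)
    show "bij (\<lambda>u. fst (inv g (B 0 u)))"
      unfolding fp using S(2,3) by simp
    have J0: "J 0 (p 0 u) = u" for u
      using JA(1)[OF S(2)] by (metis blinfun_apply_blinfun_compose blinfun_apply_id_blinfun)
    have p0: "p 0 (J 0 u) = u" for u
      using JA(2)[OF S(2)] by (metis blinfun_apply_blinfun_compose blinfun_apply_id_blinfun)
    show "A' *v fst (inv g (B 0 u)) = snd (inv g (B' u)) - A0 *v fst (inv g (B' u))" for u
      unfolding fp A'_def Aapp by (simp add: blinfun.bilinear_simps J0 r0 p0 r'_def p'_def G)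
  qed
qed

section \<open>Planes through a fixed line, in a chart of the Grassmannian\<close>

lemma graph_plane_chart_at:
  fixes W0 :: "((real^'n::finite) \<times> (real^'n)) set"
  assumes "W0 \<in> carrier grassmannian"
  obtains g A0 where "linear g" "bij g" "chart_at grassmannian W0 = (range (graph_plane g), inv (graph_plane g))"
    "W0 = graph_plane g A0"
proof -
  let ?G = "grassmannian :: (((real^'n::finite) \<times> (real^'n)) set, real^'n^'n) manifold"
  obtain c where c: "c \<in> atlas ?G" "W0 \<in> fst c"
  proof -
    obtain D :: "((real^'n) \<times> (real^'n)) set set" where "D \<in> {{W \<in> U. \<phi> W \<in> D} | U \<phi> D. (U, \<phi>) \<in> (grassmann_atlas :: (((real^'n) \<times> (real^'n)) set, real^'n^'n) chart set) \<and> open D}" "W0 \<in> D"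
      using assms unfolding grassmannian_def manifold.simps topology_generated_by_topspace by blast
    then show thesis using that by (auto simp: grassmannian_def)
  qed
  then have "chart_at ?G W0 \<in> atlas ?G \<and> W0 \<in> fst (chart_at ?G W0)"
    unfolding chart_at_def by (metis (mono_tags, lifting) someI)
  then show thesis using that by (auto simp: grassmannian_def grassmann_atlas_def)
qed

lemma graph_plane_in_carrier:
  fixes A :: "real^'n::finite^'n"
  assumes "linear g" "bij g"
  shows "graph_plane g A \<in> carrier grassmannian"
proof -
  have "linear (\<lambda>u. (u, A *v u))"
    by (rule linearI) (simp_all add: matrix_vector_right_distrib matrix_vector_mult_scaleR)
  then have lin: "linear (\<lambda>u. g (u, A *v u))"
    using linear_compose[OF _ assms(1)] by (simp add: o_def)
  have inj: "inj (\<lambda>u. g (u, A *v u))"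
    using assms(2) by (auto simp: inj_on_def bij_def)
  have "dim (graph_plane g A) = dim (UNIV :: (real^'n) set)"
    unfolding graph_plane_def by (rule dim_image_eq[OF lin]) (use inj in simp)
  then show ?thesis
    unfolding carrier_grassmannian using linear_subspace_image[OF lin subspace_UNIV] by (simp add: graph_plane_def)
qed

text \<open>In the chart of \<open>g\<close>, containing \<open>k\<close> means
  \<open>A *v u0 = A0 *v u0\<close>. This is an affine subspace of matrices, and its tangent space
  is its space of directions.\<close>

lemma tangent_space_incident_planes:
  fixes W0 :: "((real^'n::finite) \<times> (real^'n)) set"
  assumes g: "linear g" "bij g" "chart_at grassmannian W0 = (range (graph_plane g), inv (graph_plane g))"
    and W0: "W0 = graph_plane g A0" and k: "g (u0, A0 *v u0) = k"
  shows "tangent_space grassmannian {W \<in> carrier grassmannian. span {k} \<subseteq> W} W0 = {M. M *v u0 = 0}"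
proof -
  let ?Z = "{W \<in> carrier grassmannian. span {k} \<subseteq> W}"
  have gG: "inv g (g z) = z" for z using g(2) by (simp add: bij_is_inj)
  have inj: "inj (graph_plane g)" by (rule inj_graph_plane[OF g(1,2)])
  have kin: "k \<in> graph_plane g A \<longleftrightarrow> A *v u0 = A0 *v u0" for A
  proof
    assume "k \<in> graph_plane g A"
    then obtain u where "g (u0, A0 *v u0) = g (u, A *v u)" using k unfolding graph_plane_def by blast
    then have "(u0, A0 *v u0) = (u, A *v u)" using gG by metis
    then have "u = u0" "A *v u = A0 *v u0" by auto
    then show "A *v u0 = A0 *v u0" by simp
  next
    assume "A *v u0 = A0 *v u0"
    then have "k = g (u0, A *v u0)" using k by simp
    then show "k \<in> graph_plane g A" unfolding graph_plane_def by (rule range_eqI)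
  qed
  show ?thesis
  proof (intro equalityI subsetI)
    fix M assume "M \<in> tangent_space grassmannian ?Z W0"
    then obtain \<gamma> where M: "M = velocity grassmannian \<gamma>" and \<gamma>: "smooth_curve_in grassmannian ?Z W0 \<gamma>"
      unfolding tangent_space_def by blast
    obtain e where e: "e > 0" "\<gamma> ` {-e<..<e} \<subseteq> ?Z" "smooth_map_on euclidean_manifold grassmannian {-e<..<e} \<gamma>"
      and \<gamma>0: "\<gamma> 0 = W0" using \<gamma> unfolding smooth_curve_in_def by blast
    have "0 \<in> {-e<..<e}" using e by simp
    from bspec[OF e(3)[unfolded smooth_map_on_def] this]
    have "\<exists>(V, \<psi>)\<in>atlas grassmannian. \<exists>D. open D \<and> 0 \<in> D \<and> D \<subseteq> {-e<..<e} \<and>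
        (\<forall>s\<in>D. \<gamma> s \<in> V) \<and> smooth_on D (\<psi> \<circ> \<gamma>)"
      by (simp add: euclidean_manifold_def inv_id)
    then obtain V \<psi> D where d: "(V, \<psi>) \<in> atlas grassmannian" "open D" "0 \<in> D" "D \<subseteq> {-e<..<e}"
        "\<And>s. s \<in> D \<Longrightarrow> \<gamma> s \<in> V" "smooth_on D (\<psi> \<circ> \<gamma>)"
      by blast
    obtain g' where g': "linear g'" "bij g'" "V = range (graph_plane g')" "\<psi> = inv (graph_plane g')"
      using d(1) by (auto simp: grassmannian_def grassmann_atlas_def)
    define C where "C = \<psi> \<circ> \<gamma>"
    have \<gamma>C: "\<gamma> s = graph_plane g' (C s)" if "s \<in> D" for s
      using d(5)[OF that] g' by (simp add: C_def f_inv_into_f)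
    have "C differentiable at 0" unfolding C_def by (rule smooth_on_differentiable[OF d(6,3)])
    then obtain C' where C': "(C has_vector_derivative C') (at 0)" using vector_derivative_works by blast
    have "bounded_linear g'" using g'(1) linear_conv_bounded_linear by blast
    then obtain G' where G': "blinfun_apply G' = g'" by (metis bounded_linear_Blinfun_apply)
    have "bounded_linear (\<lambda>u::real^'n. (u, 0::real^'n))" "bounded_linear (\<lambda>u::real^'n. (0::real^'n, u))"
      by (intro bounded_linear_Pair bounded_linear_ident bounded_linear_zero)+
    then obtain I1 I2 :: "(real^'n) \<Rightarrow>\<^sub>L ((real^'n) \<times> (real^'n))"
      where I: "blinfun_apply I1 = (\<lambda>u. (u, 0))" "blinfun_apply I2 = (\<lambda>u. (0, u))"
      by (metis bounded_linear_Blinfun_apply)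
    \<comment> \<open>The curve is smooth in some chart \<open>g'\<close>, while its velocity is
      read in the selected chart \<open>g\<close>. In place of a transition map, the planes are
      presented by the moving frame \<open>u \<mapsto> g' (u, C s *v u)\<close>, to which
      \<open>graph_plane_curve\<close> applies in \<open>g\<close>.\<close>
    define B where "B = (\<lambda>s. G' o\<^sub>L (I1 + (I2 o\<^sub>L Blinfun ((*v) (C s)))))"
    have "bounded_linear ((*v) N)" for N :: "real^'n^'n"
      by (simp add: linear_conv_bounded_linear[symmetric])
    then have Bapp: "B s u = g' (u, C s *v u)" for s u
      by (simp add: B_def G' I blinfun.bilinear_simps bounded_linear_Blinfun_apply)
    have "(B has_vector_derivative G' o\<^sub>L (0 + (I2 o\<^sub>L Blinfun ((*v) C')))) (at 0)"
      unfolding B_def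
      by (intro bounded_linear.has_vector_derivative[OF bounded_bilinear.bounded_linear_right[OF bounded_bilinear_blinfun_compose]]
          has_vector_derivative_add has_vector_derivative_const
          bounded_linear.has_vector_derivative[OF bounded_linear_Blinfun_matrix_vector] C')
    then obtain B' where B': "(B has_vector_derivative B') (at 0)" by blast
    have rB: "range (B s) = \<gamma> s" if "s \<in> D" for s
      unfolding \<gamma>C[OF that] graph_plane_def by (auto simp: Bapp)
    have rB0: "range (B 0) = graph_plane g A0" using rB[OF d(3)] \<gamma>0 W0 by simp
    obtain A' where A': "((\<lambda>s. inv (graph_plane g) (range (B s))) has_vector_derivative A') (at 0)"
      "\<forall>\<^sub>F s in nhds 0. range (B s) \<in> range (graph_plane g)"
      using graph_plane_curve[OF g(1,2) B' rB0] by metis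
    have evD: "\<forall>\<^sub>F s in nhds 0. s \<in> D" using d(2,3) eventually_nhds_in_open by blast
    have "((\<lambda>s. inv (graph_plane g) (\<gamma> s)) has_vector_derivative A') (at 0)"
      by (rule has_vector_derivative_transform_within_open[OF A'(1) d(2,3)]) (simp add: rB)
    then have MA: "M = A'"
      unfolding M velocity_def \<gamma>0 g(3) by (simp add: o_def vector_derivative_at)
    have "\<forall>\<^sub>F s in nhds 0. inv (graph_plane g) (range (B s)) *v u0 = A0 *v u0"
      using A'(2) evD
    proof eventually_elim
      case (elim s)
      have "k \<in> range (B s)" using e(2) d(4) elim(2) rB[OF elim(2)] span_base[of k "{k}"] by auto
      moreover obtain A where A: "range (B s) = graph_plane g A" using elim(1) by blast
      ultimately show ?case using kin[of A] unfolding A inv_f_f[OF inj] by simp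
    qed
    then obtain S where S: "open S" "0 \<in> S" "\<And>s. s \<in> S \<Longrightarrow> inv (graph_plane g) (range (B s)) *v u0 = A0 *v u0"
      unfolding eventually_nhds by blast
    have "((\<lambda>s. inv (graph_plane g) (range (B s)) *v u0) has_vector_derivative A' *v u0) (at 0)"
      by (rule bounded_linear.has_vector_derivative[OF _ A'(1)])
        (auto simp: linear_conv_bounded_linear[symmetric] intro!: linearI matrix_vector_mult_add_rdistrib scaleR_matrix_vector_assoc[symmetric])
    moreover have "((\<lambda>s. inv (graph_plane g) (range (B s)) *v u0) has_vector_derivative 0) (at 0)"
      by (rule has_vector_derivative_transform_within_open[OF has_vector_derivative_const S(1,2)]) (simp add: S(3))
    ultimately have "A' *v u0 = 0" using vector_derivative_unique_at by blast
    then show "M \<in> {M. M *v u0 = 0}" by (simp add: MA)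
  next
    fix M assume "M \<in> {M :: real^'n^'n. M *v u0 = 0}"
    then have M: "M *v u0 = 0" by simp
    \<comment> \<open>A straight line in the chart; \<open>M *v u0 = 0\<close> keeps it among the
      planes containing \<open>k\<close>.\<close>
    define \<gamma> where "\<gamma> = (\<lambda>s::real. graph_plane g (A0 + s *\<^sub>R M))"
    have \<gamma>0: "\<gamma> 0 = W0" by (simp add: \<gamma>_def W0)
    have ch: "inv (graph_plane g) \<circ> \<gamma> = (\<lambda>s. A0 + s *\<^sub>R M)"
      by (simp add: fun_eq_iff \<gamma>_def inv_f_f[OF inj])
    have "smooth_curve_in grassmannian ?Z W0 \<gamma>"
      unfolding smooth_curve_in_def
    proof (intro conjI exI)
      show "\<gamma> ` {-1<..<1} \<subseteq> ?Z"
      proof (clarify)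
        fix s :: real
        have "k \<in> \<gamma> s" unfolding \<gamma>_def kin using M by (simp add: matrix_vector_mult_add_rdistrib scaleR_matrix_vector_assoc[symmetric])
        moreover have "\<gamma> s \<in> carrier grassmannian" unfolding \<gamma>_def by (rule graph_plane_in_carrier[OF g(1,2)])
        ultimately show "\<gamma> s \<in> carrier grassmannian \<and> span {k} \<subseteq> \<gamma> s"
          using span_minimal[of "{k}" "\<gamma> s"] by (auto simp: carrier_grassmannian)
      qed
      have sm: "smooth_on {-1<..<1} (\<lambda>s. A0 + s *\<^sub>R M)"
        by (intro smooth_on_add smooth_on_const smooth_on_bounded_linear bounded_linear_scaleR_left) auto
      have "(range (graph_plane g), inv (graph_plane g)) \<in> grassmann_atlas"
        unfolding grassmann_atlas_def using g by blast
      then show "smooth_map_on euclidean_manifold grassmannian {-1<..<1} \<gamma>"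
        unfolding smooth_map_on_def euclidean_manifold_def grassmannian_def
        by (auto simp: inv_id intro!: bexI[of _ "(range (graph_plane g), inv (graph_plane g))"] exI[of _ "{-1<..<1}"] simp: ch sm)
          (auto simp: \<gamma>_def)
    qed (simp_all add: \<gamma>0)
    moreover have "velocity grassmannian \<gamma> = M"
      unfolding velocity_def \<gamma>0 g(3) snd_conv ch
      by (rule vector_derivative_at) (auto intro!: derivative_eq_intros)
    ultimately show "M \<in> tangent_space grassmannian ?Z W0"
      unfolding tangent_space_def by blast
  qed
qed

section \<open>Exterior derivatives and curves in charts\<close>

text \<open>\<open>ext_deriv\<close> is computed in the selected chart, so this is the naturality of
  \<open>d\<close> under a change of charts. Differentiating a pulled back form produces a term with
  the second derivative of the transition map, which is symmetric and drops out of the alternating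
  difference.\<close>

lemma ext_deriv_chart:
  assumes M: "smooth_manifold M" and c: "c \<in> atlas M" "x \<in> fst c"
    and W: "openin (mtop M) W" "x \<in> W" and \<alpha>: "smooth_form M W \<alpha>"
  shows "fderiv (form_in_chart M c \<alpha>) (snd c x) u v
      - fderiv (form_in_chart M c \<alpha>) (snd c x) v u
    = ext_deriv M \<alpha> x (transition_deriv c (chart_at M x) x u) (transition_deriv c (chart_at M x) x v)"
proof -
  define c0 where "c0 = chart_at M x"
  have c0: "c0 \<in> atlas M" "x \<in> fst c0" using chart_at_in[OF M atlas_carrier[OF M c]] by (auto simp: c0_def)
  let ?\<tau> = "snd c0 \<circ> chart_inv c"
  let ?F = "form_in_chart M c \<alpha>" and ?\<beta> = "form_in_chart M c0 \<alpha>"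
  let ?O = "snd c ` (fst c \<inter> (fst c0 \<inter> W))"
  let ?T = "transition_deriv c c0 x"
  have inv: "chart_inv c (snd c z) = z" if "z \<in> fst c" for z
    using chart_inv_into[OF M, of "fst c" "snd c"] c that by simp
  have oU: "openin (mtop M) (fst c0)" using chart_homeomorphic(1)[OF M, of "fst c0" "snd c0"] c0 by simp
  have op: "open ?O"
    by (rule chart_open_image[OF M]) (use c oU W in auto)
  have xO: "snd c x \<in> ?O" using c c0 W by auto
  have \<tau>: "smooth_on ?O ?\<tau>"
    by (rule smooth_on_subset[OF chart_transition_smooth(1)[OF M, of "fst c" "snd c" "fst c0" "snd c0"]])
      (use c c0 in auto)
  have sm: "smooth_on (snd c ` (fst c \<inter> W)) (form_in_chart M c \<alpha>)" if "c \<in> atlas M" for c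
    using bspec[OF \<alpha>[unfolded smooth_form_def] that] by (simp add: case_prod_beta)
  have dF: "?F differentiable at (snd c x)"
    by (rule smooth_on_differentiable[OF sm[OF c(1)]]) (use c W in auto)
  have d\<beta>: "(?\<beta> has_derivative fderiv ?\<beta> (?\<tau> (snd c x))) (at (?\<tau> (snd c x)))"
    by (rule smooth_on_has_derivative[OF sm[OF c0(1)]]) (use c0 W c inv in auto)
  have d\<tau>: "(?\<tau> has_derivative ?T) (at (snd c x))"
    by (rule transition_deriv_works[OF M c(1) c0(1) c(2) c0(2)])
  have pull: "?F y v = ?\<beta> (?\<tau> y) (fderiv ?\<tau> y v)" if yO: "y \<in> ?O" for y v
  proof -
    obtain z where z: "y = snd c z" "z \<in> fst c" "z \<in> fst c0" "z \<in> W" using yO by auto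
    have zc: "chart_at M z \<in> atlas M" "z \<in> fst (chart_at M z)"
      using chart_at_in[OF M atlas_carrier[OF M c(1) z(2)]] by auto
    have "?\<beta> (?\<tau> y) (fderiv ?\<tau> y v)
        = ?\<beta> (snd c0 z) (transition_deriv c c0 z v)"
      by (simp add: z inv transition_deriv_def)
    also have "\<dots> = \<alpha> z (transition_deriv c (chart_at M z) z v)"
      unfolding form_in_chart_apply[OF M c0(1) z(3)]
        transition_deriv_compose[OF M c(1) c0(1) zc(1) z(2,3) zc(2)] ..
    also have "\<dots> = ?F y v" using form_in_chart_apply[OF M c(1) z(2)] z(1) by simp
    finally show ?thesis ..
  qed
  have D: "fderiv ?F (snd c x) u v =
      ?\<beta> (?\<tau> (snd c x)) (fderiv (\<lambda>y. fderiv ?\<tau> y v) (snd c x) u)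
       + fderiv ?\<beta> (?\<tau> (snd c x)) (?T u) (?T v)" for u v
  proof -
    have "((\<lambda>y. fderiv ?\<tau> y v) has_derivative
        fderiv (\<lambda>y. fderiv ?\<tau> y v) (snd c x)) (at (snd c x))"
      by (rule smooth_on_has_derivative[OF smooth_on_frechet_derivative[OF \<tau>] xO])
    from bounded_bilinear.FDERIV[OF bounded_bilinear_blinfun_apply has_derivative_compose[OF d\<tau> d\<beta>] this]
    have "((\<lambda>y. ?F y v) has_derivative (\<lambda>u.
      ?\<beta> (?\<tau> (snd c x)) (fderiv (\<lambda>y. fderiv ?\<tau> y v) (snd c x) u)
       + fderiv ?\<beta> (?\<tau> (snd c x)) (?T u) (fderiv ?\<tau> (snd c x) v))) (at (snd c x))"
      by (rule has_derivative_transform_within_open[OF _ op xO]) (simp add: pull)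
    then show ?thesis
      using frechet_derivative_blinfun_apply[OF dF, of v u]
      by (simp add: frechet_derivative_eq transition_deriv_def)
  qed
  have "?\<tau> (snd c x) = snd c0 x" using inv[OF c(2)] by simp
  then show ?thesis
    unfolding D ext_deriv_def Let_def
    using second_derivative_symmetric[OF op xO \<tau>, of v u] by (simp add: c0_def)
qed

section \<open>Curves in manifolds, read in charts\<close>

lemma smooth_curve_chart:
  assumes M: "smooth_manifold M" and \<gamma>: "smooth_curve_in M S x \<gamma>" and c: "c \<in> atlas M" "x \<in> fst c"
  obtains e where "e > 0" "\<gamma> ` {-e<..<e} \<subseteq> S \<inter> fst c" "smooth_on {-e<..<e} (snd c \<circ> \<gamma>)"
proof -
  obtain e where e: "e > 0" "\<gamma> ` {-e<..<e} \<subseteq> S" "smooth_map_on euclidean_manifold M {-e<..<e} \<gamma>" "\<gamma> 0 = x"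
    using \<gamma> unfolding smooth_curve_in_def by blast
  have at: "(UNIV, id) \<in> atlas (euclidean_manifold :: (real, real) manifold)" by (simp add: euclidean_manifold_def)
  let ?T = "{s \<in> {-e<..<e}. \<gamma> s \<in> fst c}"
  have "open ?T" "smooth_on ?T (snd c \<circ> \<gamma>)"
    using smooth_map_on_chart[OF smooth_manifold_euclidean M e(3) at, of "fst c" "snd c"] c(1)
    by (simp_all add: inv_id)
  moreover have "0 \<in> ?T" using e c by simp
  ultimately obtain r where r: "r > 0" "ball 0 r \<subseteq> ?T" using open_contains_ball by blast
  then have "{-r<..<r} \<subseteq> ?T" by (auto simp: subset_eq dist_real_def)
  then show thesis using that[of r] r(1) e(2) smooth_on_subset[OF \<open>smooth_on ?T (snd c \<circ> \<gamma>)\<close>] by blast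
qed

lemma smooth_curve_inI:
  assumes "c \<in> atlas M" "e > 0" "\<gamma> 0 = x" "\<And>s. s \<in> {-e<..<e} \<Longrightarrow> \<gamma> s \<in> S \<inter> fst c"
    and "smooth_on {-e<..<e} (snd c \<circ> \<gamma>)"
  shows "smooth_curve_in M S x \<gamma>"
  unfolding smooth_curve_in_def smooth_map_on_def
proof (intro conjI exI ballI)
  show "\<gamma> ` {-e<..<e} \<subseteq> S" using assms(4) by blast
  fix s assume s: "s \<in> {-e<..<e}"
  show "\<exists>(U, \<phi>)\<in>atlas euclidean_manifold. \<exists>(V, \<psi>)\<in>atlas M. \<exists>D. s \<in> U \<and> open D \<and> \<phi> s \<in> D \<and>
        D \<subseteq> \<phi> ` (U \<inter> {-e<..<e}) \<and> (\<forall>y\<in>D. \<gamma> (inv_into U \<phi> y) \<in> V) \<and>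
        smooth_on D (\<psi> \<circ> \<gamma> \<circ> inv_into U \<phi>)"
    unfolding euclidean_manifold_def manifold.simps bex_simps case_prod_conv
    using s assms(1,4,5) by (auto intro!: bexI[OF _ assms(1)] exI[of _ "{-e<..<e}"] simp: inv_id case_prod_beta)
qed (use assms in auto)

text \<open>Continuity at \<open>0\<close> in the topology of \<open>M\<close>. It will keep lifted
  curves inside the domain of the coframing and of a chart.\<close>

lemma smooth_curve_eventually:
  assumes M: "smooth_manifold M" and \<gamma>: "smooth_curve_in M S x \<gamma>" and c: "x \<in> carrier M"
    and A: "openin (mtop M) A" "x \<in> A"
  shows "\<forall>\<^sub>F s in nhds 0. \<gamma> s \<in> A \<inter> S"
proof -
  define c where "c = chart_at M x"
  have c: "c \<in> atlas M" "x \<in> fst c" using chart_at_in[OF M c] by (auto simp: c_def)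
  obtain e where e: "e > 0" "\<gamma> ` {-e<..<e} \<subseteq> S \<inter> fst c" "smooth_on {-e<..<e} (snd c \<circ> \<gamma>)"
    using smooth_curve_chart[OF M \<gamma> c] by blast
  have g0: "\<gamma> 0 = x" using \<gamma> by (simp add: smooth_curve_in_def)
  have "open (snd c ` (fst c \<inter> A))"
    by (rule chart_open_image[OF M _ A(1)]) (use c in simp)
  then have op: "open ({-e<..<e} \<inter> (snd c \<circ> \<gamma>) -` (snd c ` (fst c \<inter> A)))"
    by (rule continuous_open_preimage[OF smooth_on_continuous[OF e(3)] open_greaterThanLessThan])
  have "0 \<in> {-e<..<e} \<inter> (snd c \<circ> \<gamma>) -` (snd c ` (fst c \<inter> A))"
    using e(1) g0 c A by auto
  then have "\<forall>\<^sub>F s in nhds 0. s \<in> {-e<..<e} \<inter> (snd c \<circ> \<gamma>) -` (snd c ` (fst c \<inter> A))"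
    using op eventually_nhds_in_open by blast
  then show ?thesis
  proof eventually_elim
    case (elim s)
    then obtain z where z: "snd c (\<gamma> s) = snd c z" "z \<in> fst c" "z \<in> A" by auto
    moreover have "\<gamma> s \<in> fst c" "\<gamma> s \<in> S" using elim e(2) by auto
    moreover have "inj_on (snd c) (fst c)" by (rule chart_inj[OF M]) (use c in simp)
    ultimately show ?case by (metis IntI inj_onD)
  qed
qed

text \<open>In the next two lemmas \<open>a\<close> and \<open>b\<close> are the two projections of the flag manifold, in either order.\<close>

lemma fibre_curve_projects:
  fixes M :: "('m, 'a::euclidean_space) manifold" and N :: "('k, 'b::euclidean_space) manifold"
    and F :: "('f, 'e::euclidean_space) manifold" and k :: "'e \<Rightarrow> 'd::euclidean_space"
  assumes mf: "smooth_manifold F" "smooth_manifold M" "smooth_manifold N"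
    and sm: "smooth_map_on F M (carrier F) a" "smooth_map_on F N (carrier F) b"
    and ch: "c \<in> atlas F" "x \<in> fst c" "d \<in> atlas M" "a x \<in> fst d" "e \<in> atlas N" "b x \<in> fst e"
    and f: "f = snd d \<circ> a \<circ> chart_inv c" and h: "h = snd e \<circ> b \<circ> chart_inv c"
    and k: "linear k" "DIM('e) = DIM('b) + DIM('d)"
      "\<And>w. fderiv h (snd c x) w = 0 \<Longrightarrow> k w = 0 \<Longrightarrow> w = 0"
    and v: "fderiv h (snd c x) v = 0"
  shows "\<exists>C. C 0 = x \<and> (\<forall>\<^sub>F s in nhds 0. C s \<in> fst c \<and> b (C s) = b x) \<and>
    ((snd c \<circ> C) has_vector_derivative v) (at 0) \<and>
    smooth_curve_in M (a ` {z \<in> carrier F. b z = b x}) (a x) (a \<circ> C) \<and>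
    ((snd d \<circ> (a \<circ> C)) has_vector_derivative fderiv f (snd c x) v) (at (0::real))"
proof -
  let ?i = "chart_inv c"
  have inv: "?i (snd c z) = z" if "z \<in> fst c" for z
    using chart_inv_into[OF mf(1), of "fst c" "snd c"] ch(1) that by simp
  have inve: "inj_on (snd e) (fst e)"
    using chart_inj[OF mf(3), of "fst e" "snd e"] ch(5) by simp
  have U: "fst c \<inter> carrier F = fst c" using atlas_carrier[OF mf(1) ch(1)] by auto
  let ?Y1 = "snd c ` {z \<in> fst c \<inter> carrier F. a z \<in> fst d}" and ?Y2 = "snd c ` {z \<in> fst c \<inter> carrier F. b z \<in> fst e}"
  have Y1: "open ?Y1" "smooth_on ?Y1 (snd d \<circ> a \<circ> ?i)"
    using smooth_map_on_chart[OF mf(1,2) sm(1), of "fst c" "snd c" "fst d" "snd d"] ch by simp_all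
  have Y2: "open ?Y2" "smooth_on ?Y2 h"
    using smooth_map_on_chart[OF mf(1,3) sm(2), of "fst c" "snd c" "fst e" "snd e"] ch by (simp_all add: h)
  let ?Y = "?Y1 \<inter> ?Y2"
  have Y: "open ?Y" "smooth_on ?Y h" "snd c x \<in> ?Y"
    using Y1(1) Y2 smooth_on_subset[OF Y2(2)] ch U by auto
  obtain r g where g: "r > 0" "g 0 = snd c x" "g ` {-r<..<r} \<subseteq> ?Y" "smooth_on {-r<..<r::real} g"
    "(g has_vector_derivative v) (at 0)" "\<And>s. s \<in> {-r<..<r} \<Longrightarrow> h (g s) = h (snd c x)"
    using fibre_curve[OF Y k(1,2,3) v] by blast
  define C where "C = ?i \<circ> g"
  have gC: "g s = snd c (C s)" "C s \<in> fst c" "a (C s) \<in> fst d" "b (C s) \<in> fst e" if "s \<in> {-r<..<r}" for s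
  proof -
    have "g s \<in> ?Y" using g(3) that by blast
    then obtain z z' where z: "g s = snd c z" "z \<in> fst c" "a z \<in> fst d" "g s = snd c z'" "z' \<in> fst c" "b z' \<in> fst e"
      by blast
    then have "C s = z" "z = z'" using inv by (metis C_def comp_apply)+
    then show "g s = snd c (C s)" "C s \<in> fst c" "a (C s) \<in> fst d" "b (C s) \<in> fst e" using z by auto
  qed
  \<comment> \<open>So far only the coordinates of \<open>b\<close> are constant along the curve;
    injectivity of the chart \<open>e\<close> makes \<open>b\<close> itself constant.\<close>
  have bC: "b (C s) = b x" if "s \<in> {-r<..<r}" for s
  proof -
    have "snd e (b (C s)) = snd e (b x)"
      using g(6)[OF that] gC[OF that] inv ch(2) by (simp add: h)
    then show ?thesis using inve gC(4)[OF that] ch(6) by (metis inj_onD)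
  qed
  have r: "\<forall>\<^sub>F s in nhds (0::real). s \<in> {-r<..<r}"
    using eventually_nhds_in_open[of "{-r<..<r}" 0] g(1) by auto
  show ?thesis
  proof (intro exI conjI)
    show C0: "C 0 = x" using g(2) inv[OF ch(2)] by (simp add: C_def)
    show "\<forall>\<^sub>F s in nhds 0. C s \<in> fst c \<and> b (C s) = b x"
      using r by eventually_elim (use gC bC in blast)
    show "((snd c \<circ> C) has_vector_derivative v) (at 0)"
      by (rule has_vector_derivative_transform_within_open[OF g(5), of "{-r<..<r}"]) (use g(1) gC(1) in auto)
    have df: "(f has_derivative fderiv f (snd c x)) (at (g 0))"
      unfolding g(2) f by (rule smooth_on_has_derivative[OF Y1(2)]) (use ch U in auto)
    have "((\<lambda>s. f (g s)) has_vector_derivative fderiv f (snd c x) v) (at 0)"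
      using has_derivative_compose[OF g(5)[unfolded has_vector_derivative_def] df]
        linear_scale[OF has_derivative_linear[OF df]]
      unfolding has_vector_derivative_def by simp
    then show "((snd d \<circ> (a \<circ> C)) has_vector_derivative fderiv f (snd c x) v) (at 0)"
      by (simp add: f C_def o_def)
    show "smooth_curve_in M (a ` {z \<in> carrier F. b z = b x}) (a x) (a \<circ> C)"
    proof (rule smooth_curve_inI[OF ch(3) g(1)])
      show "(a \<circ> C) 0 = a x" by (simp add: C0)
      show "(a \<circ> C) s \<in> a ` {z \<in> carrier F. b z = b x} \<inter> fst d" if "s \<in> {-r<..<r}" for s
        using gC[OF that] bC[OF that] U by auto
      have "smooth_on {-r<..<r} (\<lambda>s. (snd d \<circ> a \<circ> ?i) (g s))"
        by (rule smooth_on_compose[OF _ Y1(1) _ Y1(2) g(4)]) (use g(3) in auto)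
      then show "smooth_on {-r<..<r} (snd d \<circ> (a \<circ> C))" by (simp add: C_def o_def)
    qed
  qed
qed

lemma fibre_curve_lifts:
  fixes M :: "('m, 'a::euclidean_space) manifold" and N :: "('k, 'b::euclidean_space) manifold"
    and F :: "('f, 'e::euclidean_space) manifold"
  assumes mf: "smooth_manifold F" "smooth_manifold M" "smooth_manifold N"
    and sm: "smooth_map_on F M (carrier F) a" "smooth_map_on F N (carrier F) b"
    and ch: "c \<in> atlas F" "x \<in> fst c" "d \<in> atlas M" "a x \<in> fst d" "e \<in> atlas N" "b x \<in> fst e"
    and f: "f = snd d \<circ> a \<circ> chart_inv c" and h: "h = snd e \<circ> b \<circ> chart_inv c"
    and inj: "\<And>w. fderiv f (snd c x) w = 0 \<Longrightarrow> fderiv h (snd c x) w = 0 \<Longrightarrow> w = 0"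
    and C: "C 0 = x" "\<And>A. openin (mtop F) A \<Longrightarrow> x \<in> A \<Longrightarrow> \<forall>\<^sub>F s in nhds 0. C s \<in> A"
      "smooth_curve_in M S (a x) (a \<circ> C)" "\<forall>\<^sub>F s in nhds 0. b (C s) = b x"
  shows "\<exists>v. ((snd c \<circ> C) has_vector_derivative v) (at 0) \<and> fderiv h (snd c x) v = 0 \<and>
    ((snd d \<circ> (a \<circ> C)) has_vector_derivative fderiv f (snd c x) v) (at (0::real))"
proof -
  let ?i = "chart_inv c"
  have inv: "?i (snd c z) = z" if "z \<in> fst c" for z
    using chart_inv_into[OF mf(1), of "fst c" "snd c"] ch(1) that by simp
  have U: "fst c \<inter> carrier F = fst c" using atlas_carrier[OF mf(1) ch(1)] by auto
  let ?Y1 = "snd c ` {z \<in> fst c \<inter> carrier F. a z \<in> fst d}" and ?Y2 = "snd c ` {z \<in> fst c \<inter> carrier F. b z \<in> fst e}"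
  have Y1: "open ?Y1" "smooth_on ?Y1 f"
    using smooth_map_on_chart[OF mf(1,2) sm(1), of "fst c" "snd c" "fst d" "snd d"] ch by (simp_all add: f)
  have Y2: "open ?Y2" "smooth_on ?Y2 h"
    using smooth_map_on_chart[OF mf(1,3) sm(2), of "fst c" "snd c" "fst e" "snd e"] ch by (simp_all add: h)
  let ?Y = "?Y1 \<inter> ?Y2"
  have Y: "open ?Y" "smooth_on ?Y f" "smooth_on ?Y h" "snd c x \<in> ?Y"
    using Y1 Y2 smooth_on_subset[OF Y2(2)] smooth_on_subset[OF Y1(2)] ch U by auto
  \<comment> \<open>By \<open>inj\<close> the two projections together form an immersion. Along
    \<open>C\<close> the second is constant and the first is smooth, so
    \<open>lift_curve_differentiable\<close> applies to the pair.\<close>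
  define H where "H = (\<lambda>y. (f y, h y))"
  have H: "smooth_on ?Y H" unfolding H_def by (rule smooth_on_Pair[OF Y(1-3)])
  have "(H has_derivative (\<lambda>w. (fderiv f (snd c x) w, fderiv h (snd c x) w))) (at (snd c x))"
    unfolding H_def by (intro has_derivative_Pair smooth_on_has_derivative[OF _ Y(4)] Y)
  then have DH: "fderiv H (snd c x) = (\<lambda>w. (fderiv f (snd c x) w, fderiv h (snd c x) w))"
    by (rule frechet_derivative_eq)
  have linH: "linear (fderiv H (snd c x))"
    by (rule has_derivative_linear[OF smooth_on_has_derivative[OF H Y(4)]])
  have injH: "inj (fderiv H (snd c x))"
    unfolding linear_injective_0[OF linH] by (auto simp: DH zero_prod_def inj)
  \<comment> \<open>No smoothness of \<open>C\<close> in \<open>F\<close> is assumed, only that it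
    stays in each neighbourhood of \<open>x\<close> for small parameters; this gives continuity of
    its coordinates.\<close>
  have cont: "isCont (snd c \<circ> C) 0"
    unfolding continuous_at_open
  proof (intro allI impI)
    fix D assume D: "open D \<and> (snd c \<circ> C) 0 \<in> D"
    have "\<forall>\<^sub>F s in nhds 0. C s \<in> {z \<in> fst c. snd c z \<in> D}"
      by (rule C(2)[OF chart_open_preimage[OF mf(1), of "fst c" "snd c" D]]) (use D ch(1,2) C(1) in simp_all)
    then show "\<exists>S. open S \<and> 0 \<in> S \<and> (\<forall>x'\<in>S. (snd c \<circ> C) x' \<in> D)"
      unfolding eventually_nhds by auto
  qed
  have evU: "\<forall>\<^sub>F s in nhds 0. C s \<in> fst c"
    by (rule C(2)[OF chart_homeomorphic(1)[OF mf(1), of "fst c" "snd c"] ch(2)]) (simp add: ch(1))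
  obtain r where r: "r > 0" "(a \<circ> C) ` {-r<..<r} \<subseteq> S \<inter> fst d" "smooth_on {-r<..<r} (snd d \<circ> (a \<circ> C))"
    by (rule smooth_curve_chart[OF mf(2) C(3) ch(3,4)])
  have "(snd d \<circ> (a \<circ> C)) differentiable at 0"
    by (rule smooth_on_differentiable[OF r(3)]) (use r(1) in auto)
  then obtain p where p: "((snd d \<circ> (a \<circ> C)) has_vector_derivative p) (at 0)"
    using vector_derivative_works by blast
  obtain S where S: "open S" "0 \<in> S" "\<And>s. s \<in> S \<Longrightarrow> C s \<in> fst c \<and> b (C s) = b x"
    using eventually_conj[OF evU C(4)] unfolding eventually_nhds by blast
  have "((\<lambda>s. ((snd d \<circ> (a \<circ> C)) s, h (snd c x))) has_vector_derivative (p, 0)) (at 0)"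
    by (rule has_vector_derivative_Pair[OF p has_vector_derivative_const])
  then have "((\<lambda>s. H ((snd c \<circ> C) s)) has_vector_derivative (p, 0)) (at 0)"
    by (rule has_vector_derivative_transform_within_open[OF _ S(1,2)])
      (use S(3) inv ch(2) in \<open>auto simp: H_def f h\<close>)
  then obtain v where "((snd c \<circ> C) has_vector_derivative v) (at 0)" "fderiv H (snd c x) v = (p, 0)"
    using lift_curve_differentiable[OF Y(1) H _ _ cont] Y(4) injH C(1) by auto
  then show ?thesis using p by (auto simp: DH)
qed

section \<open>Coframings of the flag manifold\<close>

text \<open>Bundles \<open>3n\<close> scalar forms into one operator, so that passing to the dual
  frame is inversion of operators.\<close>

definition assemble_coframe ::
  "('n::finite \<Rightarrow> 'e::euclidean_space \<Rightarrow>\<^sub>L real) \<Rightarrow> ('n \<Rightarrow> 'e \<Rightarrow>\<^sub>L real) \<Rightarrow> ('n \<Rightarrow> 'e \<Rightarrow>\<^sub>L real) \<Rightarrow>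
     'e \<Rightarrow>\<^sub>L ((real^'n) \<times> (real^'n) \<times> (real^'n))" where
  "assemble_coframe \<alpha> \<beta> \<gamma> = Blinfun (\<lambda>v. (\<chi> \<mu>. \<alpha> \<mu> v, \<chi> \<mu>. \<beta> \<mu> v, \<chi> \<mu>. \<gamma> \<mu> v))"

lemma assemble_coframe_apply:
  "assemble_coframe \<alpha> \<beta> \<gamma> v = (\<chi> \<mu>. \<alpha> \<mu> v, \<chi> \<mu>. \<beta> \<mu> v, \<chi> \<mu>. \<gamma> \<mu> v)"
proof -
  have "linear (\<lambda>v. (\<chi> \<mu>. \<alpha> \<mu> v, \<chi> \<mu>. \<beta> \<mu> v, \<chi> \<mu>. \<gamma> \<mu> v))"
    by (rule linearI) (simp_all add: vec_eq_iff blinfun.bilinear_simps)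
  then have "bounded_linear (\<lambda>v. (\<chi> \<mu>. \<alpha> \<mu> v, \<chi> \<mu>. \<beta> \<mu> v, \<chi> \<mu>. \<gamma> \<mu> v))"
    by (rule linear_conv_bounded_linear[THEN iffD1])
  from fun_cong[OF bounded_linear_Blinfun_apply[OF this]] show ?thesis
    unfolding assemble_coframe_def .
qed

lemma smooth_on_assemble_coframe:
  assumes "open S" "\<And>\<mu>. smooth_on S (\<alpha> \<mu>)" "\<And>\<mu>. smooth_on S (\<beta> \<mu>)" "\<And>\<mu>. smooth_on S (\<gamma> \<mu>)"
  shows "smooth_on S (\<lambda>y. assemble_coframe (\<lambda>\<mu>. \<alpha> \<mu> y) (\<lambda>\<mu>. \<beta> \<mu> y) (\<lambda>\<mu>. \<gamma> \<mu> y))"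
  by (rule smooth_on_blinfunI[OF assms(1)], unfold assemble_coframe_apply)
    (intro smooth_on_Pair smooth_on_vec_lambda smooth_on_linear[OF assms(1) blinfun.bounded_linear_left] assms)

text \<open>The entries of a nonzero vector orthogonal to the range would be the coefficients of a
  linear relation between the forms. So the operator is onto, and then injective because source and
  target have equal dimension.\<close>

lemma inj_assemble_coframe:
  fixes \<alpha> \<beta> \<gamma> :: "'n::finite \<Rightarrow> ((real^'n) \<times> (real^'n) \<times> (real^'n)) \<Rightarrow>\<^sub>L real"
  assumes "\<And>a b c. (\<Sum>\<mu>\<in>UNIV. a \<mu> *\<^sub>R \<alpha> \<mu> + b \<mu> *\<^sub>R \<beta> \<mu> + c \<mu> *\<^sub>R \<gamma> \<mu>) = 0 \<Longrightarrow> \<forall>\<mu>. a \<mu> = 0 \<and> b \<mu> = 0 \<and> c \<mu> = 0"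
  shows "inj (blinfun_apply (assemble_coframe \<alpha> \<beta> \<gamma>))"
proof -
  let ?T = "blinfun_apply (assemble_coframe \<alpha> \<beta> \<gamma>)"
  have lin: "linear ?T" by (rule linear_blinfun_apply)
  have "surj ?T"
  proof (rule ccontr)
    assume ns: "\<not> surj ?T"
    have sub: "subspace (range ?T)" using linear_subspace_image[OF lin subspace_UNIV] .
    have sp: "span (range ?T) = range ?T" using sub by (rule span_eq_iff[THEN iffD2])
    have "span (range ?T) \<noteq> UNIV" unfolding sp by (rule ns)
    then have "dim (range ?T) < DIM((real^'n) \<times> (real^'n) \<times> (real^'n))"
      using dim_eq_full[of "range ?T"] dim_subset_UNIV[of "range ?T"] by linarith
    then obtain w where w: "w \<noteq> 0" "\<And>y. y \<in> span (range ?T) \<Longrightarrow> orthogonal w y"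
      by (rule orthogonal_to_subspace_exists) blast
    obtain a b c where abc: "w = (a, b, c)" by (metis surj_pair)
    have "(\<Sum>\<mu>\<in>UNIV. a $ \<mu> *\<^sub>R \<alpha> \<mu> + b $ \<mu> *\<^sub>R \<beta> \<mu> + c $ \<mu> *\<^sub>R \<gamma> \<mu>) = 0"
    proof (rule blinfun_eqI)
      fix v
      have "orthogonal w (?T v)" by (intro w(2) span_base) simp
      then show "(\<Sum>\<mu>\<in>UNIV. a $ \<mu> *\<^sub>R \<alpha> \<mu> + b $ \<mu> *\<^sub>R \<beta> \<mu> + c $ \<mu> *\<^sub>R \<gamma> \<mu>) v = blinfun_apply 0 v"
        by (simp add: orthogonal_def abc assemble_coframe_apply inner_vec_def blinfun.sum_left
            blinfun.bilinear_simps sum.distrib)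
    qed
    from assms[OF this] have "w = 0" by (simp add: abc vec_eq_iff zero_prod_def)
    then show False using w(1) by simp
  qed
  then show ?thesis by (rule linear_surjective_imp_injective[OF lin]) simp
qed

lemma linear_triple_expand:
  fixes g :: "(real^'n::finite) \<times> (real^'n) \<times> (real^'n) \<Rightarrow> 'b::real_vector"
  assumes "linear g"
  shows "g (a, b, c) = (\<Sum>\<nu>\<in>UNIV. a $ \<nu> *\<^sub>R g (axis \<nu> 1, 0, 0)) + (\<Sum>\<nu>\<in>UNIV. b $ \<nu> *\<^sub>R g (0, axis \<nu> 1, 0))
    + (\<Sum>\<nu>\<in>UNIV. c $ \<nu> *\<^sub>R g (0, 0, axis \<nu> 1))"
proof -
  have e: "(\<Sum>\<nu>\<in>UNIV. a $ \<nu> *\<^sub>R (axis \<nu> 1 :: real^'n)) = a" for a :: "real^'n"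
    using basis_expansion[of a] by (simp add: scalar_mult_eq_scaleR)
  have q: "q a = (\<Sum>\<nu>\<in>UNIV. a $ \<nu> *\<^sub>R q (axis \<nu> 1))" if q: "linear q" for q :: "real^'n \<Rightarrow> 'b" and a
    using arg_cong[OF e[of a], of q] by (simp add: linear_sum[OF q] linear_scale[OF q])
  have "linear (\<lambda>a. g (a, 0, 0))" "linear (\<lambda>b. g (0, b, 0))" "linear (\<lambda>c. g (0, 0, c))"
    by (rule linearI; simp add: linear_add[OF assms, symmetric] linear_scale[OF assms, symmetric])+
  note q[OF this(1), of a] q[OF this(2), of b] q[OF this(3), of c]
  moreover have "g (a, b, c) = g (a, 0, 0) + g (0, b, 0) + g (0, 0, c)"
    by (simp add: linear_add[OF assms, symmetric])
  ultimately show ?thesis by simp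
qed

lemma smooth_on_frechet_apply:
  fixes G :: "'a::euclidean_space \<Rightarrow> 'b::real_normed_vector"
  assumes "open S" "smooth_on S G" "smooth_on S \<xi>"
  shows "smooth_on S (\<lambda>y. fderiv G y (\<xi> y))"
proof -
  have "smooth_on S (\<lambda>y. Blinfun (fderiv G y) (\<xi> y))"
    by (intro smooth_on_bilinear[OF assms(1) bounded_bilinear_blinfun_apply] smooth_on_Blinfun_frechet assms)
  moreover have "Blinfun (fderiv G y) (\<xi> y) = fderiv G y (\<xi> y)" if "y \<in> S" for y
    using has_derivative_Blinfun_apply[OF smooth_on_has_derivative[OF assms(2) that]] by simp
  ultimately show ?thesis
    using smooth_on_cong[OF assms(1), of "\<lambda>y. Blinfun (fderiv G y) (\<xi> y)"
      "\<lambda>y. fderiv G y (\<xi> y)"] by simp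
qed

lemma smooth_form_chart:
  "smooth_form M W \<alpha> \<Longrightarrow> c \<in> atlas M \<Longrightarrow> smooth_on (snd c ` (fst c \<inter> W)) (form_in_chart M c \<alpha>)"
  unfolding smooth_form_def by (simp add: case_prod_beta)

text \<open>The setting of the local argument. Smoothness of the projections will follow from the
  embedding of \<open>F\<close> in the product; \<open>top_F\<close> makes flags with one fixed and
  one moving entry continuous curves in \<open>F\<close>.\<close>

locale incidence_coframing =
  fixes P :: "('p, 'n::finite) manifold_2n" and L :: "('l, 'n) manifold_2n"
    and F :: "('p \<times> 'l, 'n) manifold_3n" and W :: "('p \<times> 'l) set"
    and \<theta> \<omega> \<pi> :: "'n \<Rightarrow> ('p \<times> 'l, (real^'n) \<times> (real^'n) \<times> (real^'n)) one_form"
  assumes P: "smooth_manifold P" and L: "smooth_manifold L" and F: "smooth_manifold F"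
    and fst_smooth: "smooth_map_on F P (carrier F) fst"
    and snd_smooth: "smooth_map_on F L (carrier F) snd"
    and top_F: "mtop F = subtopology (prod_topology (mtop P) (mtop L)) (carrier F)"
    and coframing: "adapted_coframing P L F W \<theta> \<omega> \<pi>"
begin

text \<open>The coframing in a fixed chart, as a function of the coordinates \<open>y\<close>; in
  contrast to \<open>coframe_at\<close> it can be differentiated.\<close>

definition coframe where
  "coframe c y = assemble_coframe (\<lambda>\<mu>. form_in_chart F c (\<theta> \<mu>) y) (\<lambda>\<mu>. form_in_chart F c (\<omega> \<mu>) y)
     (\<lambda>\<mu>. form_in_chart F c (\<pi> \<mu>) y)"

definition frame where
  "frame c y = Blinfun (inv (blinfun_apply (coframe c y)))"

definition coframe_at where
  "coframe_at x = assemble_coframe (\<lambda>\<mu>. \<theta> \<mu> x) (\<lambda>\<mu>. \<omega> \<mu> x) (\<lambda>\<mu>. \<pi> \<mu> x)"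

text \<open>On \<open>W\<close> every chart around \<open>x\<close> gives the same tangent vectors,
  by \<open>frame_at_chart\<close>.\<close>

definition frame_at where
  "frame_at x = frame (chart_at F x) (snd (chart_at F x) x)"

section \<open>Kernels of the two projections in terms of the coframing\<close>

lemma open_W: "openin (mtop F) W"
  and forms_smooth: "smooth_form F W (\<theta> \<mu>)" "smooth_form F W (\<omega> \<mu>)" "smooth_form F W (\<pi> \<mu>)"
  using conjunct1[OF coframing[unfolded adapted_coframing_def]]
    conjunct1[OF conjunct2[OF coframing[unfolded adapted_coframing_def]]] by auto

lemma W_carrier: "x \<in> W \<Longrightarrow> x \<in> carrier F"
  using open_W openin_subset by blast

lemma flag_carrier:
  assumes "x \<in> carrier F"
  shows "fst x \<in> carrier P" "snd x \<in> carrier L"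
proof -
  have "x \<in> topspace (prod_topology (mtop P) (mtop L))"
    using assms topspace_subtopology top_F by (metis IntD1)
  then show "fst x \<in> carrier P" "snd x \<in> carrier L" by auto
qed

lemma inj_coframe_at: "x \<in> W \<Longrightarrow> inj (blinfun_apply (coframe_at x))"
  unfolding coframe_at_def
  by (rule inj_assemble_coframe) (use coframing in \<open>simp add: adapted_coframing_def\<close>)

lemma semibasic_forms:
  assumes "x \<in> W"
  shows "mderiv F P fst x v = 0 \<Longrightarrow> \<theta> \<mu> x v = 0" "mderiv F P fst x v = 0 \<Longrightarrow> \<omega> \<mu> x v = 0"
    "mderiv F L snd x v = 0 \<Longrightarrow> \<theta> \<mu> x v = 0" "mderiv F L snd x v = 0 \<Longrightarrow> \<pi> \<mu> x v = 0"
proof -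
  have 1: "\<forall>\<mu>. semibasic F P fst W (\<theta> \<mu>) \<and> semibasic F P fst W (\<omega> \<mu>)"
    using coframing unfolding adapted_coframing_def by (elim conjE)
  have 2: "\<forall>\<mu>. semibasic F L snd W (\<theta> \<mu>) \<and> semibasic F L snd W (\<pi> \<mu>)"
    using coframing unfolding adapted_coframing_def by (elim conjE)
  from 1 2 show "mderiv F P fst x v = 0 \<Longrightarrow> \<theta> \<mu> x v = 0" "mderiv F P fst x v = 0 \<Longrightarrow> \<omega> \<mu> x v = 0"
    "mderiv F L snd x v = 0 \<Longrightarrow> \<theta> \<mu> x v = 0" "mderiv F L snd x v = 0 \<Longrightarrow> \<pi> \<mu> x v = 0"
    using assms unfolding semibasic_def by blast+
qed

lemma zero_if_coframe_zero:
  assumes "x \<in> W" "\<And>\<mu>. \<theta> \<mu> x v = 0" "\<And>\<mu>. \<omega> \<mu> x v = 0" "\<And>\<mu>. \<pi> \<mu> x v = 0"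
  shows "v = 0"
proof -
  have "coframe_at x v = coframe_at x 0"
    unfolding coframe_at_def assemble_coframe_apply by (simp add: assms blinfun.zero_right)
  then show ?thesis by (rule injD[OF inj_coframe_at[OF assms(1)]])
qed

lemma polycontact_split:
  assumes "x \<in> W" "\<And>\<mu>. \<theta> \<mu> x z = 0"
  obtains u v where "z = u + v" "mderiv F P fst x u = 0" "mderiv F L snd x v = 0"
proof -
  have "polycontact P L F x = {v. \<forall>\<mu>. \<theta> \<mu> x v = 0}"
    using coframing assms(1) unfolding adapted_coframing_def by (elim conjE) simp
  then have "z \<in> polycontact P L F x" using assms(2) by simp
  then show thesis using that unfolding polycontact_def by blast
qed

text \<open>A vector \<open>z\<close> with \<open>\<theta> = \<omega> = 0\<close> lies in the
  polycontact plane, so \<open>z = u + v\<close> with \<open>u\<close> and \<open>v\<close> in the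
  two kernels. As \<open>\<omega>\<close> vanishes on \<open>z\<close> and on \<open>u\<close>, it
  vanishes on \<open>v\<close>, where \<open>\<theta>\<close> and \<open>\<pi>\<close> vanish as
  well. Hence \<open>v = 0\<close> and \<open>z = u\<close>.\<close>

lemma kernel_mderiv_fst:
  assumes "x \<in> W"
  shows "mderiv F P fst x z = 0 \<longleftrightarrow> (\<forall>\<mu>. \<theta> \<mu> x z = 0 \<and> \<omega> \<mu> x z = 0)"
proof
  assume z: "\<forall>\<mu>. \<theta> \<mu> x z = 0 \<and> \<omega> \<mu> x z = 0"
  then obtain u v where uv: "z = u + v" "mderiv F P fst x u = 0" "mderiv F L snd x v = 0"
    using polycontact_split[OF assms, of z] by metis
  have "\<omega> \<mu> x v = 0" for \<mu>
    using z semibasic_forms(2)[OF assms uv(2)] by (simp add: uv(1) blinfun.add_right)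
  then have "v = 0"
    using zero_if_coframe_zero[OF assms] semibasic_forms[OF assms] uv(3) by blast
  then show "mderiv F P fst x z = 0" using uv by simp
qed (use semibasic_forms[OF assms] in blast)

lemma kernel_mderiv_snd:
  assumes "x \<in> W"
  shows "mderiv F L snd x z = 0 \<longleftrightarrow> (\<forall>\<mu>. \<theta> \<mu> x z = 0 \<and> \<pi> \<mu> x z = 0)"
proof
  assume z: "\<forall>\<mu>. \<theta> \<mu> x z = 0 \<and> \<pi> \<mu> x z = 0"
  then obtain u v where uv: "z = u + v" "mderiv F P fst x u = 0" "mderiv F L snd x v = 0"
    using polycontact_split[OF assms, of z] by metis
  have "\<pi> \<mu> x u = 0" for \<mu>
    using z semibasic_forms(4)[OF assms uv(3)] by (simp add: uv(1) blinfun.add_right)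
  then have "u = 0"
    using zero_if_coframe_zero[OF assms] semibasic_forms[OF assms] uv(2) by blast
  then show "mderiv F L snd x z = 0" using uv by simp
qed (use semibasic_forms[OF assms] in blast)

lemma coframe_apply:
  assumes "c \<in> atlas F" "x \<in> fst c"
  shows "coframe c (snd c x) v = coframe_at x (transition_deriv c (chart_at F x) x v)"
  by (simp add: coframe_def coframe_at_def assemble_coframe_apply form_in_chart_apply[OF F assms])

lemma bij_coframe:
  assumes "c \<in> atlas F" "x \<in> fst c" "x \<in> W"
  shows "bij (blinfun_apply (coframe c (snd c x)))"
proof -
  have lin: "linear (blinfun_apply (coframe c (snd c x)))" by (rule linear_blinfun_apply)
  have "v = 0" if "coframe c (snd c x) v = 0" for v
  proof -
    have "coframe_at x (transition_deriv c (chart_at F x) x v) = coframe_at x 0"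
      using that coframe_apply[OF assms(1,2)] by (simp add: blinfun.zero_right)
    then have "transition_deriv c (chart_at F x) x v = 0"
      by (rule injD[OF inj_coframe_at[OF assms(3)]])
    then show ?thesis
      using transition_deriv_zero_iff[OF F assms(1) chart_at_in(1)[OF F W_carrier[OF assms(3)]] assms(2)
          chart_at_in(2)[OF F W_carrier[OF assms(3)]]] by simp
  qed
  then have "inj (blinfun_apply (coframe c (snd c x)))" using linear_injective_0[OF lin] by blast
  then show ?thesis using linear_injective_imp_surjective[OF lin] by (simp add: bij_def)
qed

lemma frame_inverse:
  assumes "c \<in> atlas F" "x \<in> fst c" "x \<in> W"
  shows "frame c (snd c x) o\<^sub>L coframe c (snd c x) = id_blinfun" "coframe c (snd c x) o\<^sub>L frame c (snd c x) = id_blinfun"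
    and "frame c (snd c x) (coframe c (snd c x) v) = v" "coframe c (snd c x) (frame c (snd c x) w) = w"
proof -
  let ?C = "blinfun_apply (coframe c (snd c x))"
  have lin: "linear ?C" by (rule linear_blinfun_apply)
  note bij = bij_coframe[OF assms]
  have "linear (inv ?C)" by (rule inj_linear_imp_inv_linear[OF lin bij_is_inj[OF bij]])
  then have fr: "blinfun_apply (frame c (snd c x)) = inv ?C"
    unfolding frame_def using linear_conv_bounded_linear bounded_linear_Blinfun_apply by blast
  show 1: "frame c (snd c x) (coframe c (snd c x) v) = v" for v
    unfolding fr using bij by (simp add: bij_is_inj)
  show 2: "coframe c (snd c x) (frame c (snd c x) w) = w" for w
    unfolding fr using bij by (simp add: bij_is_surj surj_f_inv_f)
  show "frame c (snd c x) o\<^sub>L coframe c (snd c x) = id_blinfun" "coframe c (snd c x) o\<^sub>L frame c (snd c x) = id_blinfun"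
    by (auto intro!: blinfun_eqI simp: 1 2)
qed

lemma open_chart_W: "c \<in> atlas F \<Longrightarrow> open (snd c ` (fst c \<inter> W))"
  by (rule chart_open_image[OF F _ open_W]) simp

lemma smooth_coframe:
  assumes "c \<in> atlas F"
  shows "smooth_on (snd c ` (fst c \<inter> W)) (coframe c)"
  unfolding coframe_def[abs_def]
  by (intro smooth_on_assemble_coframe open_chart_W smooth_form_chart forms_smooth assms)

lemma smooth_frame:
  assumes "c \<in> atlas F"
  shows "smooth_on (snd c ` (fst c \<inter> W)) (frame c)"
  by (rule smooth_on_blinfun_inverse[OF open_chart_W[OF assms] _ _ smooth_coframe[OF assms]])
    (use frame_inverse[OF assms] in auto)

lemma chart_at_self:
  assumes "x \<in> W"
  shows "chart_at F x \<in> atlas F" "x \<in> fst (chart_at F x)"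
    "coframe (chart_at F x) (snd (chart_at F x) x) v = coframe_at x v"
proof -
  show c: "chart_at F x \<in> atlas F" "x \<in> fst (chart_at F x)"
    using chart_at_in[OF F W_carrier[OF assms]] by auto
  show "coframe (chart_at F x) (snd (chart_at F x) x) v = coframe_at x v"
    by (simp add: coframe_apply[OF c] transition_deriv_self[OF F c])
qed

lemma frame_at_inverse:
  assumes "x \<in> W"
  shows "frame_at x (coframe_at x v) = v" "coframe_at x (frame_at x w) = w"
  using frame_inverse(3,4)[OF chart_at_self(1,2)[OF assms] assms] chart_at_self(3)[OF assms]
  by (simp_all add: frame_at_def)

lemma frame_at_chart:
  assumes "c \<in> atlas F" "x \<in> fst c" "x \<in> W"
  shows "frame_at x w = transition_deriv c (chart_at F x) x (frame c (snd c x) w)"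
  using coframe_apply[OF assms(1,2), of "frame c (snd c x) w"] frame_inverse(4)[OF assms, of w]
    frame_at_inverse[OF assms(3)] by metis

lemma frame_at_forms:
  assumes "x \<in> W"
  shows "\<theta> \<mu> x (frame_at x (a, b, c)) = a $ \<mu>" "\<omega> \<mu> x (frame_at x (a, b, c)) = b $ \<mu>"
    "\<pi> \<mu> x (frame_at x (a, b, c)) = c $ \<mu>"
  using frame_at_inverse(2)[OF assms, of "(a, b, c)"]
  by (auto simp: coframe_at_def assemble_coframe_apply vec_eq_iff)

text \<open>With fixed charts \<open>c\<close> and \<open>d\<close> this description holds at all
  nearby flags at once, so it can be differentiated.\<close>

lemma kernel_fst:
  assumes "c \<in> atlas F" "x \<in> fst c" "x \<in> W" "d \<in> atlas P" "fst x \<in> fst d"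
  shows "fderiv (snd d \<circ> fst \<circ> chart_inv c) (snd c x) v = 0 \<longleftrightarrow>
    fst (coframe c (snd c x) v) = 0 \<and> fst (snd (coframe c (snd c x) v)) = 0"
proof -
  note xF = W_carrier[OF assms(3)]
  have "fderiv (snd d \<circ> fst \<circ> chart_inv c) (snd c x) v = 0 \<longleftrightarrow>
    mderiv F P fst x (transition_deriv c (chart_at F x) x v) = 0"
    unfolding mderiv_chart[OF F P fst_smooth assms(1,2,4,5) xF order_refl]
    using transition_deriv_zero_iff[OF P assms(4) chart_at_in(1)[OF P flag_carrier(1)[OF xF]] assms(5)
        chart_at_in(2)[OF P flag_carrier(1)[OF xF]]] by simp
  then show ?thesis
    unfolding kernel_mderiv_fst[OF assms(3)] coframe_apply[OF assms(1,2)]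
    by (auto simp: coframe_at_def assemble_coframe_apply vec_eq_iff)
qed

lemma kernel_snd:
  assumes "c \<in> atlas F" "x \<in> fst c" "x \<in> W" "d \<in> atlas L" "snd x \<in> fst d"
  shows "fderiv (snd d \<circ> snd \<circ> chart_inv c) (snd c x) v = 0 \<longleftrightarrow>
    fst (coframe c (snd c x) v) = 0 \<and> snd (snd (coframe c (snd c x) v)) = 0"
proof -
  note xF = W_carrier[OF assms(3)]
  have "fderiv (snd d \<circ> snd \<circ> chart_inv c) (snd c x) v = 0 \<longleftrightarrow>
    mderiv F L snd x (transition_deriv c (chart_at F x) x v) = 0"
    unfolding mderiv_chart[OF F L snd_smooth assms(1,2,4,5) xF order_refl]
    using transition_deriv_zero_iff[OF L assms(4) chart_at_in(1)[OF L flag_carrier(2)[OF xF]] assms(5)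
        chart_at_in(2)[OF L flag_carrier(2)[OF xF]]] by simp
  then show ?thesis
    unfolding kernel_mderiv_snd[OF assms(3)] coframe_apply[OF assms(1,2)]
    by (auto simp: coframe_at_def assemble_coframe_apply vec_eq_iff)
qed

lemma smooth_projection_charts:
  assumes "c \<in> atlas F"
  shows "d \<in> atlas P \<Longrightarrow> open (snd c ` {z \<in> fst c \<inter> W. fst z \<in> fst d})"
    "d \<in> atlas P \<Longrightarrow> smooth_on (snd c ` {z \<in> fst c \<inter> W. fst z \<in> fst d}) (snd d \<circ> fst \<circ> chart_inv c)"
    "e \<in> atlas L \<Longrightarrow> open (snd c ` {z \<in> fst c \<inter> W. snd z \<in> fst e})"
    "e \<in> atlas L \<Longrightarrow> smooth_on (snd c ` {z \<in> fst c \<inter> W. snd z \<in> fst e}) (snd e \<circ> snd \<circ> chart_inv c)"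
proof -
  have *: "snd c ` {z \<in> fst c \<inter> W. q z \<in> D} = snd c ` {z \<in> fst c \<inter> carrier F. q z \<in> D} \<inter> snd c ` (fst c \<inter> W)"
    for q :: "'p \<times> 'l \<Rightarrow> 'k" and D
  proof -
    have "inj_on (snd c) (fst c)" by (rule chart_inj[OF F]) (use assms in simp)
    then have "snd c ` (A \<inter> B) = snd c ` A \<inter> snd c ` B" if "A \<subseteq> fst c" "B \<subseteq> fst c" for A B
      using that by (intro inj_on_image_Int)
    from this[of "{z \<in> fst c \<inter> carrier F. q z \<in> D}" "fst c \<inter> W"]
    have "snd c ` ({z \<in> fst c \<inter> carrier F. q z \<in> D} \<inter> (fst c \<inter> W)) = snd c ` {z \<in> fst c \<inter> carrier F. q z \<in> D} \<inter> snd c ` (fst c \<inter> W)"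
      by simp
    moreover have "{z \<in> fst c \<inter> carrier F. q z \<in> D} \<inter> (fst c \<inter> W) = {z \<in> fst c \<inter> W. q z \<in> D}"
      using W_carrier by blast
    ultimately show ?thesis by simp
  qed
  note op = open_chart_W[OF assms]
  show "open (snd c ` {z \<in> fst c \<inter> W. fst z \<in> fst d})"
    and "smooth_on (snd c ` {z \<in> fst c \<inter> W. fst z \<in> fst d}) (snd d \<circ> fst \<circ> chart_inv c)" if "d \<in> atlas P"
  proof -
    have "(fst c, snd c) \<in> atlas F" "(fst d, snd d) \<in> atlas P" using assms that by simp_all
    note ch = smooth_map_on_chart[OF F P fst_smooth this]
    show "open (snd c ` {z \<in> fst c \<inter> W. fst z \<in> fst d})" unfolding * by (rule open_Int[OF ch(1) op])
    show "smooth_on (snd c ` {z \<in> fst c \<inter> W. fst z \<in> fst d}) (snd d \<circ> fst \<circ> chart_inv c)"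
      unfolding * by (rule smooth_on_subset[OF ch(2) Int_lower1])
  qed
  show "open (snd c ` {z \<in> fst c \<inter> W. snd z \<in> fst e})"
    and "smooth_on (snd c ` {z \<in> fst c \<inter> W. snd z \<in> fst e}) (snd e \<circ> snd \<circ> chart_inv c)" if "e \<in> atlas L"
  proof -
    have "(fst c, snd c) \<in> atlas F" "(fst e, snd e) \<in> atlas L" using assms that by simp_all
    note ch = smooth_map_on_chart[OF F L snd_smooth this]
    show "open (snd c ` {z \<in> fst c \<inter> W. snd z \<in> fst e})" unfolding * by (rule open_Int[OF ch(1) op])
    show "smooth_on (snd c ` {z \<in> fst c \<inter> W. snd z \<in> fst e}) (snd e \<circ> snd \<circ> chart_inv c)"
      unfolding * by (rule smooth_on_subset[OF ch(2) Int_lower1])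
  qed
qed

end

section \<open>The structure equations\<close>

lemma smooth_form_scaleR:
  assumes "\<And>c. c \<in> atlas M \<Longrightarrow> open (snd c ` (fst c \<inter> W))" "smooth_form M W \<alpha>"
    and "\<And>c. c \<in> atlas M \<Longrightarrow> smooth_on (snd c ` (fst c \<inter> W)) (f \<circ> chart_inv c)"
  shows "smooth_form M W (\<lambda>x. f x *\<^sub>R \<alpha> x)"
  unfolding smooth_form_def
proof (safe)
  fix U \<phi> assume c: "(U, \<phi>) \<in> atlas M"
  have "form_in_chart M (U, \<phi>) (\<lambda>x. f x *\<^sub>R \<alpha> x) = (\<lambda>y. (f \<circ> inv_into U \<phi>) y *\<^sub>R form_in_chart M (U, \<phi>) \<alpha> y)"
    by (simp add: fun_eq_iff form_in_chart_def Let_def bounded_bilinear.scaleR_left[OF bounded_bilinear_blinfun_compose])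
  then show "smooth_on (\<phi> ` (U \<inter> W)) (form_in_chart M (U, \<phi>) (\<lambda>x. f x *\<^sub>R \<alpha> x))"
    using smooth_on_bilinear[OF assms(1)[OF c] bounded_bilinear_scaleR assms(3)[OF c] smooth_form_chart[OF assms(2) c]]
    by simp
qed

lemma smooth_form_add:
  assumes "\<And>c. c \<in> atlas M \<Longrightarrow> open (snd c ` (fst c \<inter> W))" "smooth_form M W \<alpha>" "smooth_form M W \<beta>"
  shows "smooth_form M W (\<lambda>x. \<alpha> x + \<beta> x)"
  unfolding smooth_form_def
proof (safe)
  fix U \<phi> assume c: "(U, \<phi>) \<in> atlas M"
  have "form_in_chart M (U, \<phi>) (\<lambda>x. \<alpha> x + \<beta> x) = (\<lambda>y. form_in_chart M (U, \<phi>) \<alpha> y + form_in_chart M (U, \<phi>) \<beta> y)"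
    by (simp add: fun_eq_iff form_in_chart_def Let_def bounded_bilinear.add_left[OF bounded_bilinear_blinfun_compose])
  then show "smooth_on (\<phi> ` (U \<inter> W)) (form_in_chart M (U, \<phi>) (\<lambda>x. \<alpha> x + \<beta> x))"
    using smooth_on_add[OF assms(1)[OF c] smooth_form_chart[OF assms(2) c] smooth_form_chart[OF assms(3) c]] by simp
qed

lemma smooth_form_zero: "smooth_form M W (\<lambda>x. 0)"
  unfolding smooth_form_def
proof (safe)
  fix U \<phi> assume "(U, \<phi>) \<in> atlas M"
  have "form_in_chart M (U, \<phi>) (\<lambda>x. 0) = (\<lambda>y. 0)"
    by (simp add: fun_eq_iff form_in_chart_def Let_def bounded_bilinear.zero_left[OF bounded_bilinear_blinfun_compose])
  then show "smooth_on (\<phi> ` (U \<inter> W)) (form_in_chart M (U, \<phi>) (\<lambda>x. 0))"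
    by (simp add: smooth_on_const)
qed

lemma smooth_form_sum:
  assumes "\<And>c. c \<in> atlas M \<Longrightarrow> open (snd c ` (fst c \<inter> W))" "\<And>i. i \<in> I \<Longrightarrow> smooth_form M W (\<alpha> i)"
  shows "smooth_form M W (\<lambda>x. \<Sum>i\<in>I. \<alpha> i x)"
  using assms(2)
  by (induction I rule: infinite_finite_induct) (auto intro: smooth_form_zero smooth_form_add[OF assms(1)])

context incidence_coframing
begin

text \<open>The components of \<open>d\<theta>\<^sup>\<mu>\<close> in the dual frame. With constant
  coefficients \<open>w\<close> and \<open>w'\<close>, the structure equations become identities
  between bilinear functions of these coefficients.\<close>

definition torsion where
  "torsion \<mu> w w' x = ext_deriv F (\<theta> \<mu>) x (frame_at x w) (frame_at x w')"

lemma ext_deriv_bilinear: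
  assumes "x \<in> W"
  shows "linear (\<lambda>u. ext_deriv F (\<theta> \<mu>) x u v)" "linear (\<lambda>v. ext_deriv F (\<theta> \<mu>) x u v)"
    and "ext_deriv F (\<theta> \<mu>) x u v = - ext_deriv F (\<theta> \<mu>) x v u"
proof -
  let ?c = "chart_at F x"
  let ?D = "fderiv (form_in_chart F ?c (\<theta> \<mu>)) (snd ?c x)"
  have lin: "linear ?D"
    by (rule has_derivative_linear[OF smooth_on_has_derivative[OF smooth_form_chart[OF forms_smooth(1)]]])
      (use chart_at_self[OF assms] assms in auto)
  show "linear (\<lambda>u. ext_deriv F (\<theta> \<mu>) x u v)" "linear (\<lambda>v. ext_deriv F (\<theta> \<mu>) x u v)"
    unfolding ext_deriv_def Let_def
    by (rule linearI; simp only: linear_add[OF lin] linear_scale[OF lin] blinfun.bilinear_simps; simp add: algebra_simps)+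
  show "ext_deriv F (\<theta> \<mu>) x u v = - ext_deriv F (\<theta> \<mu>) x v u"
    by (simp add: ext_deriv_def Let_def)
qed

lemma torsion_bilinear:
  assumes "x \<in> W"
  shows "linear (\<lambda>w. torsion \<mu> w w' x)" "linear (\<lambda>w'. torsion \<mu> w w' x)"
    and "torsion \<mu> w w' x = - torsion \<mu> w' w x"
proof -
  have lin: "linear (blinfun_apply (frame_at x))" by (rule linear_blinfun_apply)
  show "linear (\<lambda>w. torsion \<mu> w w' x)" "linear (\<lambda>w'. torsion \<mu> w w' x)"
    unfolding torsion_def
    using linear_compose[OF lin ext_deriv_bilinear(1)[OF assms]] linear_compose[OF lin ext_deriv_bilinear(2)[OF assms]]
    by (simp_all add: o_def)
  show "torsion \<mu> w w' x = - torsion \<mu> w' w x"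
    unfolding torsion_def by (rule ext_deriv_bilinear(3)[OF assms])
qed

lemma torsion_chart:
  assumes "c \<in> atlas F" "x \<in> fst c" "x \<in> W"
  shows "torsion \<mu> w w' x =
      fderiv (form_in_chart F c (\<theta> \<mu>)) (snd c x) (frame c (snd c x) w) (frame c (snd c x) w')
    - fderiv (form_in_chart F c (\<theta> \<mu>)) (snd c x) (frame c (snd c x) w') (frame c (snd c x) w)"
  unfolding torsion_def frame_at_chart[OF assms]
  by (rule ext_deriv_chart[OF F assms(1,2) open_W assms(3) forms_smooth(1), symmetric])

text \<open>Both the functions \<open>t\<close> and the coefficients of the remainder modulo
  \<open>\<theta>\<close> are built from these components, so this yields their smoothness.\<close>

lemma smooth_torsion:
  assumes "c \<in> atlas F"
  shows "smooth_on (snd c ` (fst c \<inter> W)) (torsion \<mu> w w' \<circ> chart_inv c)"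
proof -
  let ?Y = "snd c ` (fst c \<inter> W)" and ?\<alpha> = "form_in_chart F c (\<theta> \<mu>)"
  note op = open_chart_W[OF assms]
  have fr: "smooth_on ?Y (\<lambda>y. frame c y w)" for w
    by (rule smooth_on_linear[OF op blinfun.bounded_linear_left smooth_frame[OF assms]])
  have "smooth_on ?Y (\<lambda>y. fderiv ?\<alpha> y (frame c y w) (frame c y w')
      - fderiv ?\<alpha> y (frame c y w') (frame c y w))"
    by (intro smooth_on_diff[OF op] smooth_on_bilinear[OF op bounded_bilinear_blinfun_apply] fr
        smooth_on_frechet_apply[OF op] smooth_form_chart forms_smooth assms)
  moreover have "fderiv ?\<alpha> y (frame c y w) (frame c y w')
      - fderiv ?\<alpha> y (frame c y w') (frame c y w) = (torsion \<mu> w w' \<circ> chart_inv c) y"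
    if y: "y \<in> ?Y" for y
  proof -
    obtain x where x: "y = snd c x" "x \<in> fst c" "x \<in> W" using y by blast
    then show ?thesis
      using torsion_chart[OF assms x(2,3)] chart_inv_into[OF F, of "fst c" "snd c"] assms by simp
  qed
  ultimately show ?thesis
    using smooth_on_cong[OF op, of "\<lambda>y. fderiv ?\<alpha> y (frame c y w) (frame c y w')
      - fderiv ?\<alpha> y (frame c y w') (frame c y w)"] by blast
qed

text \<open>The \<open>\<theta>\<close> part of \<open>coframe_derivative_bracket\<close>, that is,
  \<open>d\<theta>(X, Y) = - \<theta>([X, Y])\<close> for frame fields.\<close>

lemma torsion_bracket:
  assumes "c \<in> atlas F" "x \<in> fst c" "x \<in> W"
  shows "(\<chi> \<mu>. torsion \<mu> w w' x) = - fst (coframe c (snd c x) (frame_bracket (frame c) w w' (snd c x)))"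
proof -
  let ?Y = "snd c ` (fst c \<inter> W)"
  have xY: "snd c x \<in> ?Y" using assms by blast
  have comp: "fst (fderiv (coframe c) (snd c x) u v) $ \<mu>
      = fderiv (form_in_chart F c (\<theta> \<mu>)) (snd c x) u v" for u v \<mu>
  proof -
    have D: "(coframe c has_derivative fderiv (coframe c) (snd c x)) (at (snd c x))"
      by (rule smooth_on_has_derivative[OF smooth_coframe[OF assms(1)] xY])
    have "bounded_linear (\<lambda>A :: ((real^'n) \<times> (real^'n) \<times> (real^'n)) \<Rightarrow>\<^sub>L ((real^'n) \<times> (real^'n) \<times> (real^'n)). fst (A v) $ \<mu>)"
      by (intro bounded_linear_compose[OF bounded_linear_vec_nth] bounded_linear_compose[OF bounded_linear_fst]
          blinfun.bounded_linear_left)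
    from bounded_linear.has_derivative[OF this D]
    have 1: "((\<lambda>y. form_in_chart F c (\<theta> \<mu>) y v) has_derivative
        (\<lambda>u. fst (fderiv (coframe c) (snd c x) u v) $ \<mu>)) (at (snd c x))"
      by (simp add: coframe_def assemble_coframe_apply)
    have "form_in_chart F c (\<theta> \<mu>) differentiable at (snd c x)"
      by (rule smooth_on_differentiable[OF smooth_form_chart[OF forms_smooth(1) assms(1)] xY])
    from frechet_derivative_blinfun_apply[OF this] show ?thesis
      using frechet_derivative_eq[OF 1] by metis
  qed
  have "torsion \<mu> w w' x = (- fst (coframe c (snd c x) (frame_bracket (frame c) w w' (snd c x)))) $ \<mu>" for \<mu>
  proof -
    have "torsion \<mu> w w' x = fst (fderiv (coframe c) (snd c x) (frame c (snd c x) w) (frame c (snd c x) w')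
      - fderiv (coframe c) (snd c x) (frame c (snd c x) w') (frame c (snd c x) w)) $ \<mu>"
      unfolding torsion_chart[OF assms] by (simp add: comp)
    also have "\<dots> = fst (- coframe c (snd c x) (frame_bracket (frame c) w w' (snd c x))) $ \<mu>"
      by (subst coframe_derivative_bracket[OF open_chart_W[OF assms(1)] smooth_coframe[OF assms(1)] smooth_frame[OF assms(1)] _ xY])
        (use frame_inverse(2)[OF assms(1)] in auto)
    finally show ?thesis by simp
  qed
  then show ?thesis by (simp add: vec_eq_iff)
qed

text \<open>The field of \<open>(0, 0, v)\<close> is vertical for the point projection at every
  nearby flag, so \<open>kernel_bracket\<close> applies. The right-hand side is the rate at which
  projected frame vectors change when the line turns about its point.\<close>

lemma bracket_kernel_fst:
  assumes "c \<in> atlas F" "x \<in> fst c" "x \<in> W" "d \<in> atlas P" "fst x \<in> fst d"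
    and f: "f = snd d \<circ> fst \<circ> chart_inv c"
  shows "fderiv f (snd c x) (frame_bracket (frame c) (0, 0, v) w' (snd c x))
    = fderiv (\<lambda>y. fderiv f y (frame c y w')) (snd c x) (frame c (snd c x) (0, 0, v))"
proof -
  let ?Y = "snd c ` {z \<in> fst c \<inter> W. fst z \<in> fst d}"
  have "fderiv f y (frame c y (0, 0, v)) = 0" if y: "y \<in> ?Y" for y
  proof -
    obtain z where z: "y = snd c z" "z \<in> fst c" "z \<in> W" "fst z \<in> fst d" using y by blast
    then show ?thesis
      unfolding f z(1) kernel_fst[OF assms(1) z(2,3) assms(4) z(4)] frame_inverse(4)[OF assms(1) z(2,3)] by simp
  qed
  moreover have "smooth_on ?Y (frame c)"
    by (rule smooth_on_subset[OF smooth_frame[OF assms(1)]]) auto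
  moreover have "snd c x \<in> ?Y" using assms by auto
  ultimately show ?thesis
    using kernel_bracket[OF smooth_projection_charts(1)[OF assms(1,4)] smooth_projection_charts(2)[OF assms(1,4)], folded f] by blast
qed

text \<open>Involutivity of fibres: if the derivative of \<open>f\<close> kills two fields, it kills
  their bracket, and \<open>\<theta>\<close> vanishes on its kernel. It is used for both
  projections.\<close>

lemma torsion_vanishes:
  fixes f :: "_ \<Rightarrow> 'b::euclidean_space"
  assumes c: "c \<in> atlas F" "x \<in> fst c" "x \<in> W"
    and Y: "open Y" "snd c x \<in> Y" "Y \<subseteq> snd c ` (fst c \<inter> W)" "smooth_on Y f"
    and ker: "\<And>y. y \<in> Y \<Longrightarrow> fderiv f y (frame c y w) = 0" "\<And>y. y \<in> Y \<Longrightarrow> fderiv f y (frame c y w') = 0"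
    and \<theta>: "\<And>v. fderiv f (snd c x) v = 0 \<Longrightarrow> fst (coframe c (snd c x) v) = 0"
  shows "torsion \<mu> w w' x = 0"
proof -
  have "fderiv (\<lambda>y. fderiv f y (frame c y w')) (snd c x) = fderiv (\<lambda>y. 0) (snd c x)"
    by (rule frechet_derivative_cong_open[OF Y(1,2)]) (rule ker(2))
  then have "fderiv f (snd c x) (frame_bracket (frame c) w w' (snd c x)) = 0"
    using kernel_bracket[OF Y(1,4) smooth_on_subset[OF smooth_frame[OF c(1)] Y(3)] ker(1) Y(2), of w'] by simp
  then have "(\<chi> \<mu>. torsion \<mu> w w' x) = 0"
    unfolding torsion_bracket[OF c] by (simp add: \<theta>)
  then show ?thesis by (simp add: vec_eq_iff)
qed

lemma torsion_vanishes_pi: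
  assumes "x \<in> W"
  shows "torsion \<mu> (0, 0, v) (0, 0, v') x = 0"
proof -
  define c where "c = chart_at F x"
  have c: "c \<in> atlas F" "x \<in> fst c" using chart_at_self[OF assms] by (auto simp: c_def)
  obtain d where d: "d \<in> atlas P" "fst x \<in> fst d"
    using chart_at_in[OF P flag_carrier(1)[OF W_carrier[OF assms]]] by blast
  have ker: "fderiv (snd d \<circ> fst \<circ> chart_inv c) y (frame c y (0, 0, v)) = 0"
    if y: "y \<in> snd c ` {z \<in> fst c \<inter> W. fst z \<in> fst d}" for y v
  proof -
    obtain z where z: "y = snd c z" "z \<in> fst c" "z \<in> W" "fst z \<in> fst d" using y by blast
    then show ?thesis
      unfolding z(1) kernel_fst[OF c(1) z(2,3) d(1) z(4)] frame_inverse(4)[OF c(1) z(2,3)] by simp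
  qed
  show ?thesis
    by (rule torsion_vanishes[OF c assms smooth_projection_charts(1)[OF c(1) d(1)] _ _
          smooth_projection_charts(2)[OF c(1) d(1)] ker ker])
      (use c d assms in \<open>blast | simp add: kernel_fst[OF c assms d]\<close>)+
qed

lemma torsion_vanishes_omega:
  assumes "x \<in> W"
  shows "torsion \<mu> (0, u, 0) (0, u', 0) x = 0"
proof -
  define c where "c = chart_at F x"
  have c: "c \<in> atlas F" "x \<in> fst c" using chart_at_self[OF assms] by (auto simp: c_def)
  obtain d where d: "d \<in> atlas L" "snd x \<in> fst d"
    using chart_at_in[OF L flag_carrier(2)[OF W_carrier[OF assms]]] by blast
  have ker: "fderiv (snd d \<circ> snd \<circ> chart_inv c) y (frame c y (0, u, 0)) = 0"
    if y: "y \<in> snd c ` {z \<in> fst c \<inter> W. snd z \<in> fst d}" for y u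
  proof -
    obtain z where z: "y = snd c z" "z \<in> fst c" "z \<in> W" "snd z \<in> fst d" using y by blast
    then show ?thesis
      unfolding z(1) kernel_snd[OF c(1) z(2,3) d(1) z(4)] frame_inverse(4)[OF c(1) z(2,3)] by simp
  qed
  show ?thesis
    by (rule torsion_vanishes[OF c assms smooth_projection_charts(3)[OF c(1) d(1)] _ _
          smooth_projection_charts(4)[OF c(1) d(1)] ker ker])
      (use c d assms in \<open>blast | simp add: kernel_snd[OF c assms d]\<close>)+
qed

text \<open>The tableau without reference to a solution of the structure equations. The sign: on the
  frame vectors of \<open>(0, 0, v)\<close> and \<open>(0, u, 0)\<close>, in this order,
  \<open>- t \<pi> \<and> \<omega>\<close> takes the value \<open>- t(u, v)\<close>.\<close>

definition tableau where
  "tableau x u v = (\<chi> \<mu>. - torsion \<mu> (0, 0, v) (0, u, 0) x)"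

lemma tableau_bilinear:
  assumes "x \<in> W"
  shows "bilinear (tableau x)"
proof -
  have "linear (\<lambda>v::real^'n. (0::real^'n, 0::real^'n, v))" "linear (\<lambda>v::real^'n. (0::real^'n, v, 0::real^'n))"
    by (rule linearI; simp)+
  from linear_compose[OF this(1) torsion_bilinear(1)[OF assms]] linear_compose[OF this(2) torsion_bilinear(2)[OF assms]]
  have l: "linear (\<lambda>v. torsion \<mu> (0, 0, v) w x)" "linear (\<lambda>u. torsion \<mu> w (0, u, 0) x)" for \<mu> w
    by (simp_all add: o_def)
  show ?thesis
    unfolding bilinear_def tableau_def
    by (intro allI conjI; rule linearI;
        simp add: vec_eq_iff linear_add[OF l(1)] linear_scale[OF l(1)] linear_add[OF l(2)] linear_scale[OF l(2)])
qed

text \<open>The forms \<open>\<theta>\<close> vanish on the frame vectors of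
  \<open>(0, 0, v)\<close> and \<open>(0, u, 0)\<close>, and with them the remainder of the
  congruence. So every solution has the same \<open>t\<close> at each point of
  \<open>W\<close>.\<close>

lemma tableau_map_eq:
  assumes s: "structure_equations F W \<theta> \<omega> \<pi> \<eta> t" and x: "x \<in> W"
  shows "tableau_map t x = tableau x"
proof (intro ext)
  fix u v
  have "(\<Sum>\<nu>\<in>UNIV. \<Sum>\<sigma>\<in>UNIV. t \<mu> \<nu> \<sigma> x * u $ \<nu> * v $ \<sigma>) = - torsion \<mu> (0, 0, v) (0, u, 0) x" for \<mu>
  proof -
    have "congruent_mod F W \<theta> (ext_deriv F (\<theta> \<mu>)) (\<lambda>x u v. - (\<Sum>\<nu>\<in>UNIV. wedge (\<eta> \<mu> \<nu> x) (\<omega> \<nu> x) u v))"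
      using s unfolding structure_equations_def by blast
    then obtain \<beta> where b: "\<And>u v. ext_deriv F (\<theta> \<mu>) x u v = - (\<Sum>\<nu>\<in>UNIV. wedge (\<eta> \<mu> \<nu> x) (\<omega> \<nu> x) u v)
        + (\<Sum>\<nu>\<in>UNIV. wedge (\<beta> \<nu> x) (\<theta> \<nu> x) u v)"
      using x unfolding congruent_mod_def by blast
    have e: "\<eta> \<mu> \<nu> x = (\<Sum>\<sigma>\<in>UNIV. t \<mu> \<nu> \<sigma> x *\<^sub>R \<pi> \<sigma> x)" for \<nu>
      using s x unfolding structure_equations_def by blast
    have "torsion \<mu> (0, 0, v) (0, u, 0) x = - (\<Sum>\<nu>\<in>UNIV. (\<Sum>\<sigma>\<in>UNIV. t \<mu> \<nu> \<sigma> x * v $ \<sigma>) * u $ \<nu>)"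
      unfolding torsion_def b wedge_def e
      by (simp add: frame_at_forms[OF x] blinfun.sum_left blinfun.scaleR_left)
    then show ?thesis by (simp add: sum_distrib_left sum_distrib_right mult_ac)
  qed
  then show "tableau_map t x u v = tableau x u v"
    by (simp add: tableau_map_def tableau_def)
qed

text \<open>The bilinear form \<open>torsion\<close> is split into blocks according to
  \<open>\<theta>\<close>, \<open>\<omega>\<close> and \<open>\<pi>\<close>. Blocks involving
  \<open>\<theta>\<close> are absorbed by \<open>\<beta>\<close>, the pure \<open>\<omega>\<close>
  and pure \<open>\<pi>\<close> blocks vanish, and the mixed block defines \<open>t\<close>.\<close>

lemma structure_equations_exist: "\<exists>\<eta> t. structure_equations F W \<theta> \<omega> \<pi> \<eta> t"
proof -
  define t where "t = (\<lambda>\<mu> \<nu> \<sigma> x. - torsion \<mu> (0, 0, axis \<sigma> 1) (0, axis \<nu> 1, 0) x)"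
  define \<eta> where "\<eta> = (\<lambda>\<mu> \<nu> x. \<Sum>\<sigma>\<in>UNIV. t \<mu> \<nu> \<sigma> x *\<^sub>R \<pi> \<sigma> x)"
  \<comment> \<open>The factor \<open>1/2\<close>: each \<open>\<theta>\<^sup>\<rho> \<and> \<theta>\<^sup>\<nu>\<close> occurs twice in \<open>\<Sum>\<^sub>\<nu> \<beta>\<^sub>\<nu> \<and> \<theta>\<^sup>\<nu>\<close>.\<close>
  define \<beta> where "\<beta> = (\<lambda>\<mu> \<nu> x. (\<Sum>\<rho>\<in>UNIV. torsion \<mu> ((1/2) *\<^sub>R axis \<rho> 1, 0, 0) (axis \<nu> 1, 0, 0) x *\<^sub>R \<theta> \<rho> x)
    + (\<Sum>\<rho>\<in>UNIV. torsion \<mu> (0, axis \<rho> 1, 0) (axis \<nu> 1, 0, 0) x *\<^sub>R \<omega> \<rho> x)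
    + (\<Sum>\<rho>\<in>UNIV. torsion \<mu> (0, 0, axis \<rho> 1) (axis \<nu> 1, 0, 0) x *\<^sub>R \<pi> \<rho> x))"
  have \<beta>_smooth: "smooth_form F W (\<beta> \<mu> \<nu>)" for \<mu> \<nu>
    unfolding \<beta>_def
    by (intro smooth_form_add smooth_form_sum smooth_form_scaleR open_chart_W forms_smooth smooth_torsion)
  have eq: "ext_deriv F (\<theta> \<mu>) x u v = - (\<Sum>\<nu>\<in>UNIV. wedge (\<eta> \<mu> \<nu> x) (\<omega> \<nu> x) u v) + (\<Sum>\<nu>\<in>UNIV. wedge (\<beta> \<mu> \<nu> x) (\<theta> \<nu> x) u v)"
    if x: "x \<in> W" for x \<mu> u v
  proof -
    let ?B = "\<lambda>w w'. torsion \<mu> w w' x"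
    obtain a b c where u: "coframe_at x u = (a, b, c)" by (metis surj_pair)
    obtain a' b' c' where v: "coframe_at x v = (a', b', c')" by (metis surj_pair)
    note T1 = torsion_bilinear(1)[OF x] and T2 = torsion_bilinear(2)[OF x] and T3 = torsion_bilinear(3)[OF x]
    have uf: "u = frame_at x (a, b, c)" "v = frame_at x (a', b', c')"
      using frame_at_inverse(1)[OF x] u v by metis+
    \<comment> \<open>Only the \<open>\<theta>\<close> slot is halved, since the blocks pairing
      \<open>\<theta>\<close> with \<open>\<omega>\<close> or \<open>\<pi>\<close> are collected
      once.\<close>
    have \<beta>: "\<beta> \<mu> \<nu> x (frame_at x (a, b, c)) = ?B ((1/2) *\<^sub>R a, b, c) (axis \<nu> 1, 0, 0)" for a b c \<nu>
    proof -
      have "linear (\<lambda>z::(real^'n) \<times> (real^'n) \<times> (real^'n). ((1/2) *\<^sub>R fst z, snd z))"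
        by (rule linearI) (auto simp: scaleR_add_right)
      from linear_triple_expand[OF linear_compose[OF this T1[where \<mu>=\<mu> and w'="(axis \<nu> 1, 0, 0)"]], where a=a and b=b and c=c] show ?thesis
        by (simp add: \<beta>_def blinfun.bilinear_simps blinfun.sum_left frame_at_forms[OF x] mult.commute)
    qed
    have sumB: "(\<Sum>\<nu>\<in>UNIV. ?B w (axis \<nu> 1, 0, 0) * a $ \<nu>) = ?B w (a, 0, 0)" for w a
      using linear_triple_expand[OF T2[where w=w and \<mu>=\<mu>], where a=a and b=0 and c=0] by (simp add: mult.commute)
    have "(\<Sum>\<nu>\<in>UNIV. wedge (\<beta> \<mu> \<nu> x) (\<theta> \<nu> x) u v)
        = ?B ((1/2) *\<^sub>R a, b, c) (a', 0, 0) - ?B ((1/2) *\<^sub>R a', b', c') (a, 0, 0)"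
      unfolding wedge_def uf \<beta> frame_at_forms[OF x] sum_subtractf sumB ..
    moreover
    have \<eta>: "\<eta> \<mu> \<nu> x (frame_at x (a, b, c)) = - ?B (0, 0, c) (0, axis \<nu> 1, 0)" for a b c \<nu>
      using linear_triple_expand[OF T1[where \<mu>=\<mu> and w'="(0, axis \<nu> 1, 0)"], where a=0 and b=0 and c=c]
      by (simp add: \<eta>_def t_def blinfun.bilinear_simps blinfun.sum_left frame_at_forms[OF x] mult.commute sum_negf)
    have sumB': "(\<Sum>\<nu>\<in>UNIV. ?B w (0, axis \<nu> 1, 0) * b $ \<nu>) = ?B w (0, b, 0)" for w b
      using linear_triple_expand[OF T2[where w=w and \<mu>=\<mu>], where a=0 and b=b and c=0] by (simp add: mult.commute)
    have "(\<Sum>\<nu>\<in>UNIV. wedge (\<eta> \<mu> \<nu> x) (\<omega> \<nu> x) u v) = - ?B (0, 0, c) (0, b', 0) + ?B (0, 0, c') (0, b, 0)"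
      unfolding wedge_def uf \<eta> frame_at_forms[OF x] sum_subtractf mult_minus_left sum_negf sumB' by simp
    moreover have "ext_deriv F (\<theta> \<mu>) x u v = ?B (a, b, c) (a', b', c')"
      by (simp add: torsion_def uf)
    moreover have "?B (a, b, c) (a', b', c') = ?B (a, b, c) (a', 0, 0) + ?B (a, 0, 0) (0, b', c')
        + ?B (0, b, 0) (0, b', 0) + ?B (0, b, 0) (0, 0, c') + ?B (0, 0, c) (0, b', 0) + ?B (0, 0, c) (0, 0, c')"
    proof -
      have "(a', b', c') = (a', 0, 0) + (0, b', c')" "(0::real^'n, b', c') = (0, b', 0) + (0, 0, c')"
        "(a, b, c) = (a, 0, 0) + (0, b, 0) + (0, 0, c)" by simp_all
      then show ?thesis by (smt (verit) linear_add[OF T1] linear_add[OF T2])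
    qed
    moreover have "?B (a, b, c) (a', 0, 0) = ?B (a, 0, 0) (a', 0, 0) + ?B (0, b, c) (a', 0, 0)"
      using linear_add[OF T1[where \<mu>=\<mu> and w'="(a', 0, 0)"], of "(a, 0, 0)" "(0, b, c)"] by simp
    moreover have "?B ((1/2) *\<^sub>R a, b, c) (a', 0, 0) = (1/2) * ?B (a, 0, 0) (a', 0, 0) + ?B (0, b, c) (a', 0, 0)" for a b c a'
      using linear_add[OF T1[where \<mu>=\<mu> and w'="(a', 0, 0)"], of "(1/2) *\<^sub>R (a, 0, 0)" "(0, b, c)"]
        linear_scale[OF T1[where \<mu>=\<mu> and w'="(a', 0, 0)"], of "1/2" "(a, 0, 0)"] by simp
    moreover have "?B (a', 0, 0) (a, 0, 0) = - ?B (a, 0, 0) (a', 0, 0)" by (rule T3)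
    moreover have "?B (0, b', c') (a, 0, 0) = - ?B (a, 0, 0) (0, b', c')" by (rule T3)
    moreover have "?B (0, b, 0) (0, 0, c') = - ?B (0, 0, c') (0, b, 0)" by (rule T3)
    ultimately show ?thesis
      by (simp add: torsion_vanishes_pi[OF x] torsion_vanishes_omega[OF x])
  qed
  have "smooth_map_on F euclidean_manifold W (t \<mu> \<nu> \<sigma>)" for \<mu> \<nu> \<sigma>
    unfolding smooth_map_on_def
  proof
    fix x assume x: "x \<in> W"
    define c where "c = chart_at F x"
    have c: "c \<in> atlas F" "x \<in> fst c" using chart_at_self[OF x] by (auto simp: c_def)
    let ?D = "snd c ` (fst c \<inter> W)"
    have "smooth_on ?D (\<lambda>y. - (torsion \<mu> (0, 0, axis \<sigma> 1) (0, axis \<nu> 1, 0) \<circ> chart_inv c) y)"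
      by (intro smooth_on_uminus open_chart_W smooth_torsion c)
    then have "smooth_on ?D (id \<circ> t \<mu> \<nu> \<sigma> \<circ> chart_inv c)"
      by (simp add: t_def o_def)
    then have "x \<in> fst c \<and> open ?D \<and> snd c x \<in> ?D \<and> ?D \<subseteq> snd c ` (fst c \<inter> W) \<and>
      (\<forall>y\<in>?D. t \<mu> \<nu> \<sigma> (chart_inv c y) \<in> UNIV) \<and> smooth_on ?D (id \<circ> t \<mu> \<nu> \<sigma> \<circ> chart_inv c)"
      using open_chart_W[OF c(1)] c x by blast
    moreover have "(UNIV, id) \<in> atlas (euclidean_manifold :: (real, real) manifold)" by (simp add: euclidean_manifold_def)
    ultimately show "\<exists>(U, \<phi>)\<in>atlas F. \<exists>(V, \<psi>)\<in>atlas euclidean_manifold. \<exists>D. x \<in> U \<and> open D \<and> \<phi> x \<in> D \<and>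
        D \<subseteq> \<phi> ` (U \<inter> W) \<and> (\<forall>y\<in>D. t \<mu> \<nu> \<sigma> (inv_into U \<phi> y) \<in> V) \<and> smooth_on D (\<psi> \<circ> t \<mu> \<nu> \<sigma> \<circ> inv_into U \<phi>)"
      unfolding case_prod_beta using c(1) by (metis (no_types, lifting) fst_conv snd_conv)
  qed
  then have "structure_equations F W \<theta> \<omega> \<pi> \<eta> t"
    unfolding structure_equations_def congruent_mod_def using eq \<beta>_smooth \<eta>_def by blast
  then show ?thesis by blast
qed

end

section \<open>Regularity\<close>

lemma smooth_map_on_prod:
  assumes "smooth_map_on F (prod_manifold P L) W (\<lambda>x. x)"
  shows "smooth_map_on F P W fst" "smooth_map_on F L W snd"
proof -
  have ex: "\<exists>c\<in>atlas F. \<exists>d\<in>atlas P. \<exists>e\<in>atlas L. \<exists>D. x \<in> fst c \<and> open D \<and> snd c x \<in> D \<and> D \<subseteq> snd c ` (fst c \<inter> W) \<and>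
      (\<forall>y\<in>D. chart_inv c y \<in> fst d \<times> fst e) \<and>
      smooth_on D (map_prod (snd d) (snd e) \<circ> chart_inv c)" if x: "x \<in> W" for x
  proof -
    have "\<exists>c\<in>atlas F. \<exists>b\<in>atlas (prod_manifold P L). \<exists>D. x \<in> fst c \<and> open D \<and> snd c x \<in> D \<and> D \<subseteq> snd c ` (fst c \<inter> W) \<and>
      (\<forall>y\<in>D. chart_inv c y \<in> fst b) \<and> smooth_on D (snd b \<circ> (\<lambda>x. x) \<circ> chart_inv c)"
      using bspec[OF assms[unfolded smooth_map_on_def] x] unfolding case_prod_beta .
    then obtain c b D where c: "c \<in> atlas F" and b: "b \<in> atlas (prod_manifold P L)" and
      D: "x \<in> fst c" "open D" "snd c x \<in> D" "D \<subseteq> snd c ` (fst c \<inter> W)"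
        "\<forall>y\<in>D. chart_inv c y \<in> fst b" "smooth_on D (snd b \<circ> (\<lambda>x. x) \<circ> chart_inv c)"
      by (elim bexE exE conjE) (rule that)
    obtain d e where de: "d \<in> atlas P" "e \<in> atlas L" "b = (fst d \<times> fst e, map_prod (snd d) (snd e))"
      using b unfolding prod_manifold_def by auto
    have "smooth_on D (map_prod (snd d) (snd e) \<circ> chart_inv c)"
      using D(6) de(3) by (simp add: o_def)
    moreover have "\<forall>y\<in>D. chart_inv c y \<in> fst d \<times> fst e" using D(5) de(3) by simp
    ultimately show ?thesis
      by (intro bexI[OF _ c] bexI[OF _ de(1)] bexI[OF _ de(2)] exI[of _ D] conjI D(1-4))
  qed
  show "smooth_map_on F P W fst"
    unfolding smooth_map_on_def case_prod_beta
  proof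
    fix x assume "x \<in> W"
    from ex[OF this] obtain c d e D where c: "c \<in> atlas F" "d \<in> atlas P" "e \<in> atlas L" "x \<in> fst c" "open D" "snd c x \<in> D"
      "D \<subseteq> snd c ` (fst c \<inter> W)" and D: "\<forall>y\<in>D. chart_inv c y \<in> fst d \<times> fst e"
      and s: "smooth_on D (map_prod (snd d) (snd e) \<circ> chart_inv c)"
      by (elim bexE exE conjE) (rule that)
    have "smooth_on D (snd d \<circ> fst \<circ> chart_inv c)"
      using smooth_on_linear[OF c(5) bounded_linear_fst s] by (simp add: o_def)
    moreover have "\<forall>y\<in>D. fst (chart_inv c y) \<in> fst d" using D by (auto simp: mem_Times_iff)
    ultimately show "\<exists>c\<in>atlas F. \<exists>d\<in>atlas P. \<exists>D. x \<in> fst c \<and> open D \<and> snd c x \<in> D \<and> D \<subseteq> snd c ` (fst c \<inter> W) \<and>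
      (\<forall>y\<in>D. fst (chart_inv c y) \<in> fst d) \<and> smooth_on D (snd d \<circ> fst \<circ> chart_inv c)"
      by (intro bexI[OF _ c(1)] bexI[OF _ c(2)] exI[of _ D] conjI c(4-7))
  qed
  show "smooth_map_on F L W snd"
    unfolding smooth_map_on_def case_prod_beta
  proof
    fix x assume "x \<in> W"
    from ex[OF this] obtain c d e D where c: "c \<in> atlas F" "d \<in> atlas P" "e \<in> atlas L" "x \<in> fst c" "open D" "snd c x \<in> D"
      "D \<subseteq> snd c ` (fst c \<inter> W)" and D: "\<forall>y\<in>D. chart_inv c y \<in> fst d \<times> fst e"
      and s: "smooth_on D (map_prod (snd d) (snd e) \<circ> chart_inv c)"
      by (elim bexE exE conjE) (rule that)
    have "smooth_on D (snd e \<circ> snd \<circ> chart_inv c)"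
      using smooth_on_linear[OF c(5) bounded_linear_snd s] by (simp add: o_def)
    moreover have "\<forall>y\<in>D. snd (chart_inv c y) \<in> fst e" using D by (auto simp: mem_Times_iff)
    ultimately show "\<exists>c\<in>atlas F. \<exists>d\<in>atlas L. \<exists>D. x \<in> fst c \<and> open D \<and> snd c x \<in> D \<and> D \<subseteq> snd c ` (fst c \<inter> W) \<and>
      (\<forall>y\<in>D. snd (chart_inv c y) \<in> fst d) \<and> smooth_on D (snd d \<circ> snd \<circ> chart_inv c)"
      by (intro bexI[OF _ c(1)] bexI[OF _ c(3)] exI[of _ D] conjI c(4-7))
  qed
qed

context incidence_coframing
begin

text \<open>As the topology of \<open>F\<close> is induced from the product, a neighbourhood of
  \<open>(p, l)\<close> contains all flags in some product of neighbourhoods of \<open>p\<close> and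
  \<open>l\<close>. This continuity is where the differentiability of lifted curves starts.\<close>

lemma flag_curve_continuous:
  assumes "(p, l) \<in> carrier F" "openin (mtop F) A" "(p, l) \<in> A"
  shows "smooth_curve_in P (points_on (carrier F) l) p \<gamma> \<Longrightarrow> \<forall>\<^sub>F s in nhds 0. (\<gamma> s, l) \<in> A"
    and "smooth_curve_in L (lines_through (carrier F) p) l \<gamma>' \<Longrightarrow> \<forall>\<^sub>F s in nhds 0. (p, \<gamma>' s) \<in> A"
proof -
  obtain A' where A': "openin (prod_topology (mtop P) (mtop L)) A'" "A = A' \<inter> carrier F"
    using assms(2) by (subst (asm) top_F) (auto simp: openin_subtopology)
  have "(p, l) \<in> A'" using assms(3) A'(2) by simp
  with A'(1) have "\<exists>V1 V2. openin (mtop P) V1 \<and> openin (mtop L) V2 \<and> p \<in> V1 \<and> l \<in> V2 \<and> V1 \<times> V2 \<subseteq> A'"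
    by (simp add: openin_prod_topology_alt)
  then obtain V1 V2 where V: "openin (mtop P) V1" "openin (mtop L) V2" "p \<in> V1" "l \<in> V2" "V1 \<times> V2 \<subseteq> A'"
    by blast
  have pl: "p \<in> carrier P" "l \<in> carrier L" using flag_carrier[OF assms(1)] by simp_all
  have inA: "(p', l') \<in> A" if "p' \<in> V1" "l' \<in> V2" "(p', l') \<in> carrier F" for p' l'
    unfolding A'(2) using V(5) that by blast
  show "\<forall>\<^sub>F s in nhds 0. (\<gamma> s, l) \<in> A" if \<gamma>: "smooth_curve_in P (points_on (carrier F) l) p \<gamma>"
    by (rule eventually_mono[OF smooth_curve_eventually[OF P \<gamma> pl(1) V(1,3)]])
      (use inA V(4) in \<open>simp add: points_on_def\<close>)
  show "\<forall>\<^sub>F s in nhds 0. (p, \<gamma>' s) \<in> A" if \<gamma>: "smooth_curve_in L (lines_through (carrier F) p) l \<gamma>'"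
    by (rule eventually_mono[OF smooth_curve_eventually[OF L \<gamma> pl(2) V(2,4)]])
      (use inA V(3) in \<open>simp add: lines_through_def\<close>)
qed

section \<open>Tangent planes and pencils in terms of the frame\<close>

lemma frame_coordinates:
  assumes "c \<in> atlas F" "x \<in> fst c" "x \<in> W"
  obtains a b e where "v = frame c (snd c x) (a, b, e)" "coframe c (snd c x) v = (a, b, e)"
  using frame_inverse(3)[OF assms, of v] by (metis surj_pair)

lemma coframe_zero:
  assumes "c \<in> atlas F" "x \<in> fst c" "x \<in> W"
    and "fst (coframe c (snd c x) v) = 0" "fst (snd (coframe c (snd c x) v)) = 0" "snd (snd (coframe c (snd c x) v)) = 0"
  shows "v = 0"
proof -
  have "coframe c (snd c x) v = 0" using assms(4-6) by (simp add: prod_eq_iff)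
  then show ?thesis using frame_inverse(3)[OF assms(1-3), of v] by (simp add: blinfun.zero_right)
qed

text \<open>A curve of points on \<open>l\<close> lifts to flags \<open>(\<gamma> s, l)\<close>,
  whose velocity is killed by the line projection and so has only an \<open>\<omega>\<close> part.
  Conversely, each such frame vector is the velocity of a curve in the fibre over \<open>l\<close>,
  which projects to points on \<open>l\<close>.\<close>

lemma tangent_space_points_on:
  assumes c: "c \<in> atlas F" "(p, l) \<in> fst c" and W: "(p, l) \<in> W"
    and f: "f = snd (chart_at P p) \<circ> fst \<circ> chart_inv c"
  shows "tangent_space P (points_on (carrier F) l) p
    = range (\<lambda>u. fderiv f (snd c (p, l)) (frame c (snd c (p, l)) (0, u, 0)))"
proof -
  let ?y = "snd c (p, l)"
  note plF = W_carrier[OF W]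
  define d where "d = chart_at P p"
  have d: "d \<in> atlas P" "fst (p, l) \<in> fst d"
    using chart_at_in[OF P flag_carrier(1)[OF plF]] by (auto simp: d_def)
  obtain e where e: "e \<in> atlas L" "snd (p, l) \<in> fst e"
    using chart_at_in[OF L flag_carrier(2)[OF plF]] by blast
  define h where "h = snd e \<circ> snd \<circ> chart_inv c"
  have f': "f = snd d \<circ> fst \<circ> chart_inv c" by (simp add: f d_def)
  note kf = kernel_fst[OF c W d, folded f'] and kh = kernel_snd[OF c W e, folded h_def]
  note fi = frame_inverse[OF c W]
  show ?thesis
  proof (intro equalityI subsetI)
    fix v assume "v \<in> tangent_space P (points_on (carrier F) l) p"
    then obtain \<gamma> where v: "v = velocity P \<gamma>" and \<gamma>: "smooth_curve_in P (points_on (carrier F) l) p \<gamma>"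
      unfolding tangent_space_def by blast
    have g0: "\<gamma> 0 = p" using \<gamma> by (simp add: smooth_curve_in_def)
    have "\<exists>w. ((snd c \<circ> (\<lambda>s. (\<gamma> s, l))) has_vector_derivative w) (at 0) \<and> fderiv h ?y w = 0 \<and>
      ((snd d \<circ> (fst \<circ> (\<lambda>s. (\<gamma> s, l)))) has_vector_derivative fderiv f ?y w) (at 0)"
    proof (rule fibre_curve_lifts[OF F P L fst_smooth snd_smooth c d e f' h_def])
      show "w = 0" if "fderiv f ?y w = 0" "fderiv h ?y w = 0" for w
        by (rule coframe_zero[OF c W]) (use that in \<open>simp_all add: kf kh\<close>)
      show "(\<lambda>s. (\<gamma> s, l)) 0 = (p, l)" by (simp add: g0)
      show "smooth_curve_in P (points_on (carrier F) l) (fst (p, l)) (fst \<circ> (\<lambda>s. (\<gamma> s, l)))"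
        using \<gamma> by (simp add: o_def)
      show "\<forall>\<^sub>F s in nhds 0. (\<gamma> s, l) \<in> A" if "openin (mtop F) A" "(p, l) \<in> A" for A
        by (rule flag_curve_continuous(1)[OF plF that \<gamma>])
    qed simp
    then obtain w where w: "fderiv h ?y w = 0"
      "((snd d \<circ> (fst \<circ> (\<lambda>s. (\<gamma> s, l)))) has_vector_derivative fderiv f ?y w) (at 0)"
      by blast
    have vw: "v = fderiv f ?y w"
      unfolding v velocity_def g0 d_def[symmetric] using w(2) by (simp add: o_def vector_derivative_at)
    obtain a b e where "w = frame c ?y (a, b, e)" "coframe c ?y w = (a, b, e)"
      by (rule frame_coordinates[OF c W])
    then have "w = frame c ?y (0, b, 0)" using w(1) unfolding kh by simp
    then show "v \<in> range (\<lambda>u. fderiv f ?y (frame c ?y (0, u, 0)))"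
      unfolding vw by blast
  next
    fix v assume "v \<in> range (\<lambda>u. fderiv f ?y (frame c ?y (0, u, 0)))"
    then obtain u where v: "v = fderiv f ?y (frame c ?y (0, u, 0))" by blast
    \<comment> \<open>The line projection has the kernel \<open>\<theta> = \<pi> = 0\<close>, on
      which the \<open>\<omega>\<close> components are coordinates; so they are the complement that
      \<open>fibre_curve_projects\<close> asks for.\<close>
    let ?k = "\<lambda>w. fst (snd (coframe c ?y w))"
    let ?w = "frame c ?y (0, u, 0)"
    have "\<exists>C. C 0 = (p, l) \<and> (\<forall>\<^sub>F s in nhds 0. C s \<in> fst c \<and> snd (C s) = snd (p, l)) \<and>
      ((snd c \<circ> C) has_vector_derivative ?w) (at 0) \<and>
      smooth_curve_in P (fst ` {z \<in> carrier F. snd z = snd (p, l)}) (fst (p, l)) (fst \<circ> C) \<and>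
      ((snd d \<circ> (fst \<circ> C)) has_vector_derivative fderiv f ?y ?w) (at (0::real))"
    proof (rule fibre_curve_projects[OF F P L fst_smooth snd_smooth c d e f' h_def])
      show "linear ?k" by (rule linearI) (simp_all add: blinfun.bilinear_simps)
      show "DIM((real^'n) \<times> (real^'n) \<times> (real^'n)) = DIM((real^'n) \<times> (real^'n)) + DIM(real^'n)" by simp
      show "w = 0" if "fderiv h ?y w = 0" "?k w = 0" for w
        by (rule coframe_zero[OF c W]) (use that in \<open>simp_all add: kh\<close>)
      show "fderiv h ?y (frame c ?y (0, u, 0)) = 0"
        unfolding kh fi(4) by simp
    qed
    then obtain C where C: "C 0 = (p, l)" "smooth_curve_in P (fst ` {z \<in> carrier F. snd z = snd (p, l)}) (fst (p, l)) (fst \<circ> C)"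
      "((snd d \<circ> (fst \<circ> C)) has_vector_derivative v) (at (0::real))"
      unfolding v by blast
    have "fst ` {z \<in> carrier F. snd z = snd (p, l)} = points_on (carrier F) l"
      by (force simp: points_on_def)
    then have "smooth_curve_in P (points_on (carrier F) l) p (fst \<circ> C)" using C(2) by simp
    moreover have "velocity P (fst \<circ> C) = v"
      unfolding velocity_def using C(1,3) by (simp add: d_def vector_derivative_at)
    ultimately show "v \<in> tangent_space P (points_on (carrier F) l) p" unfolding tangent_space_def by blast
  qed
qed

text \<open>The counterpart of \<open>tangent_space_points_on\<close> for the pencil of
  \<open>p\<close>, with the projections exchanged. Velocities are recorded in \<open>F\<close> and
  not in \<open>L\<close>, because the tangent planes are described by a frame on
  \<open>F\<close>.\<close>

lemma curve_of_lines:
  assumes c: "c \<in> atlas F" "(p, l) \<in> fst c" and W: "(p, l) \<in> W"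
  shows "smooth_curve_in L (lines_through (carrier F) p) l \<gamma> \<Longrightarrow>
      \<exists>v. ((\<lambda>s. snd c (p, \<gamma> s)) has_vector_derivative frame c (snd c (p, l)) (0, 0, v)) (at 0)"
    and "\<exists>\<gamma>. smooth_curve_in L (lines_through (carrier F) p) l \<gamma> \<and>
      ((\<lambda>s. snd c (p, \<gamma> s)) has_vector_derivative frame c (snd c (p, l)) (0, 0, v)) (at 0)"
proof -
  let ?y = "snd c (p, l)"
  note plF = W_carrier[OF W]
  obtain d where d: "d \<in> atlas P" "fst (p, l) \<in> fst d"
    using chart_at_in[OF P flag_carrier(1)[OF plF]] by blast
  obtain e where e: "e \<in> atlas L" "snd (p, l) \<in> fst e"
    using chart_at_in[OF L flag_carrier(2)[OF plF]] by blast
  define f where "f = snd d \<circ> fst \<circ> chart_inv c"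
  define h where "h = snd e \<circ> snd \<circ> chart_inv c"
  note kf = kernel_fst[OF c W d, folded f_def] and kh = kernel_snd[OF c W e, folded h_def]
  note fi = frame_inverse[OF c W]
  show "\<exists>v. ((\<lambda>s. snd c (p, \<gamma> s)) has_vector_derivative frame c ?y (0, 0, v)) (at 0)"
    if \<gamma>: "smooth_curve_in L (lines_through (carrier F) p) l \<gamma>"
  proof -
    have g0: "\<gamma> 0 = l" using \<gamma> by (simp add: smooth_curve_in_def)
    have "\<exists>w. ((snd c \<circ> (\<lambda>s. (p, \<gamma> s))) has_vector_derivative w) (at 0) \<and> fderiv f ?y w = 0 \<and>
      ((snd e \<circ> (snd \<circ> (\<lambda>s. (p, \<gamma> s)))) has_vector_derivative fderiv h ?y w) (at 0)"
    proof (rule fibre_curve_lifts[OF F L P snd_smooth fst_smooth c e d h_def f_def])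
      show "w = 0" if "fderiv h ?y w = 0" "fderiv f ?y w = 0" for w
        by (rule coframe_zero[OF c W]) (use that in \<open>simp_all add: kf kh\<close>)
      show "(\<lambda>s. (p, \<gamma> s)) 0 = (p, l)" by (simp add: g0)
      show "smooth_curve_in L (lines_through (carrier F) p) (snd (p, l)) (snd \<circ> (\<lambda>s. (p, \<gamma> s)))"
        using \<gamma> by (simp add: o_def)
      show "\<forall>\<^sub>F s in nhds 0. (p, \<gamma> s) \<in> A" if "openin (mtop F) A" "(p, l) \<in> A" for A
        by (rule flag_curve_continuous(2)[OF plF that \<gamma>])
    qed simp
    then obtain w where w: "fderiv f ?y w = 0"
      "((snd c \<circ> (\<lambda>s. (p, \<gamma> s))) has_vector_derivative w) (at 0)"
      by blast
    obtain a b e where "w = frame c ?y (a, b, e)" "coframe c ?y w = (a, b, e)"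
      by (rule frame_coordinates[OF c W])
    then have "w = frame c ?y (0, 0, e)" using w(1) unfolding kf by simp
    then show ?thesis using w(2) by (auto simp: o_def)
  qed
  let ?k = "\<lambda>w. snd (snd (coframe c ?y w))"
  let ?w = "frame c ?y (0, 0, v)"
  have "\<exists>C. C 0 = (p, l) \<and> (\<forall>\<^sub>F s in nhds 0. C s \<in> fst c \<and> fst (C s) = fst (p, l)) \<and>
      ((snd c \<circ> C) has_vector_derivative ?w) (at 0) \<and>
      smooth_curve_in L (snd ` {z \<in> carrier F. fst z = fst (p, l)}) (snd (p, l)) (snd \<circ> C) \<and>
      ((snd e \<circ> (snd \<circ> C)) has_vector_derivative fderiv h ?y ?w) (at (0::real))"
  proof (rule fibre_curve_projects[OF F L P snd_smooth fst_smooth c e d h_def f_def])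
    show "linear ?k" by (rule linearI) (simp_all add: blinfun.bilinear_simps)
    show "DIM((real^'n) \<times> (real^'n) \<times> (real^'n)) = DIM((real^'n) \<times> (real^'n)) + DIM(real^'n)" by simp
    show "w = 0" if "fderiv f ?y w = 0" "?k w = 0" for w
      by (rule coframe_zero[OF c W]) (use that in \<open>simp_all add: kf\<close>)
    show "fderiv f ?y (frame c ?y (0, 0, v)) = 0"
      unfolding kf fi(4) by simp
  qed
  then obtain C where C: "C 0 = (p, l)" "\<forall>\<^sub>F s in nhds 0. C s \<in> fst c \<and> fst (C s) = fst (p, l)"
    "((snd c \<circ> C) has_vector_derivative ?w) (at (0::real))"
    "smooth_curve_in L (snd ` {z \<in> carrier F. fst z = fst (p, l)}) (snd (p, l)) (snd \<circ> C)"
    by blast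
  have "snd ` {z \<in> carrier F. fst z = fst (p, l)} = lines_through (carrier F) p"
    by (force simp: lines_through_def)
  then have "smooth_curve_in L (lines_through (carrier F) p) l (snd \<circ> C)" using C(4) by simp
  moreover obtain S where S: "open S" "0 \<in> S" "\<And>s. s \<in> S \<Longrightarrow> fst (C s) = p"
    using C(2) unfolding eventually_nhds by auto
  have "((\<lambda>s. snd c (p, (snd \<circ> C) s)) has_vector_derivative frame c ?y (0, 0, v)) (at 0)"
  proof (rule has_vector_derivative_transform_within_open[OF C(3) S(1,2)])
    show "(snd c \<circ> C) s = snd c (p, (snd \<circ> C) s)" if "s \<in> S" for s
      using S(3)[OF that] by (metis comp_apply prod.collapse)
  qed
  ultimately show "\<exists>\<gamma>. smooth_curve_in L (lines_through (carrier F) p) l \<gamma> \<and>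
      ((\<lambda>s. snd c (p, \<gamma> s)) has_vector_derivative frame c ?y (0, 0, v)) (at 0)" by blast
qed

text \<open>The kernel of the point projection is \<open>\<theta> = \<omega> = 0\<close>, so the
  projection is injective on the frame vectors of \<open>(0, u, 0)\<close>.\<close>

lemma tangent_space_in_grassmannian:
  assumes W: "(p, l) \<in> W"
  shows "tangent_space P (points_on (carrier F) l) p \<in> carrier grassmannian"
proof -
  note plF = W_carrier[OF W]
  define c where "c = chart_at F (p, l)"
  have c: "c \<in> atlas F" "(p, l) \<in> fst c" using chart_at_self[OF W] by (auto simp: c_def)
  let ?y = "snd c (p, l)"
  have d: "chart_at P p \<in> atlas P" "fst (p, l) \<in> fst (chart_at P p)"
    using chart_at_in[OF P flag_carrier(1)[OF plF]] by auto
  define f where "f = snd (chart_at P p) \<circ> fst \<circ> chart_inv c"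
  let ?b = "\<lambda>u. fderiv f ?y (frame c ?y (0, u, 0))"
  have d': "p \<in> fst (chart_at P p)" using d by simp
  have "linear (fderiv f ?y)"
    by (rule has_derivative_linear[OF smooth_on_has_derivative[OF smooth_projection_charts(2)[OF c(1) d(1), folded f_def]]])
      (use c W d' in auto)
  moreover have "linear (\<lambda>u. frame c ?y (0, u, 0))"
    by (rule linearI) (simp_all add: blinfun.add_right[symmetric] blinfun.scaleR_right[symmetric])
  ultimately have lin: "linear ?b"
    using linear_compose[of "\<lambda>u. frame c ?y (0, u, 0)" "fderiv f ?y"]
    by (simp add: o_def)
  have "u = 0" if "?b u = 0" for u
    using that unfolding kernel_fst[OF c W d, folded f_def] frame_inverse(4)[OF c W] by simp
  then have inj: "inj ?b" using linear_injective_0[OF lin] by blast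
  have "dim (range ?b) = dim (UNIV :: (real^'n) set)"
    by (rule dim_image_eq[OF lin]) (use inj in simp)
  then show ?thesis
    unfolding tangent_space_points_on[OF c W f_def] carrier_grassmannian
    using linear_subspace_image[OF lin subspace_UNIV] by simp
qed

text \<open>The moving frame \<open>u \<mapsto> (\<pi>\<^sub>P)' X(0, u, 0)\<close> of the tangent planes of the lines through \<open>p\<close>; its
  derivative along \<open>X(0, 0, v)\<close> is, modulo the plane, the image of a Lie bracket, and hence of the torsion.\<close>

lemma tangent_plane_derivative:
  assumes W: "(p, l) \<in> W"
    and T: "T = tangent_space P (points_on (carrier F) l) p"
    and g: "linear g" "bij g" "chart_at grassmannian T = (range (graph_plane g), inv (graph_plane g))" "T = graph_plane g A0"
  obtains b1 N :: "real^'n \<Rightarrow> real^'n" where "linear b1" "bij b1" "linear N" "inj N"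
    "\<And>D. D \<in> differential_image L (lines_through (carrier F) p) grassmannian
       (\<lambda>l. tangent_space P (points_on (carrier F) l) p) l \<longleftrightarrow> (\<exists>v. \<forall>u. D *v b1 u = N (tableau (p, l) u v))"
proof -
  note plF = W_carrier[OF W]
  define c where "c = chart_at F (p, l)"
  have c: "c \<in> atlas F" "(p, l) \<in> fst c" using chart_at_self[OF W] by (auto simp: c_def)
  define d where "d = chart_at P p"
  have d: "d \<in> atlas P" "fst (p, l) \<in> fst d"
    using chart_at_in[OF P flag_carrier(1)[OF plF]] by (auto simp: d_def)
  have d': "p \<in> fst d" using d by simp
  define f where "f = snd d \<circ> fst \<circ> chart_inv c"
  have f': "f = snd (chart_at P p) \<circ> fst \<circ> chart_inv c" by (simp add: f_def d_def)
  let ?y = "snd c (p, l)" and ?Y = "snd c ` {z \<in> fst c \<inter> W. fst z \<in> fst d}"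
  note Y = smooth_projection_charts(1,2)[OF c(1) d(1), folded f_def]
  have yY: "?y \<in> ?Y" using c W d' by auto
  note fi = frame_inverse[OF c W]
  note kf = kernel_fst[OF c W d, folded f_def]
  let ?Df = "fderiv f ?y"
  have linDf: "linear ?Df" by (rule has_derivative_linear[OF smooth_on_has_derivative[OF Y(2) yY]])
  have bli: "bounded_linear (\<lambda>u::real^'n. (0::real^'n, u, 0::real^'n))"
    by (intro bounded_linear_Pair bounded_linear_zero bounded_linear_ident)
  define B where "B = (\<lambda>y. Blinfun (fderiv f y) o\<^sub>L (frame c y o\<^sub>L Blinfun (\<lambda>u::real^'n. (0::real^'n, u, 0::real^'n))))"
  have Bapp: "B y u = fderiv f y (frame c y (0, u, 0))" if "y \<in> ?Y" for y u
    using has_derivative_Blinfun_apply[OF smooth_on_has_derivative[OF Y(2) that]]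
    by (simp add: B_def bounded_linear_Blinfun_apply[OF bli])
  have sfr: "smooth_on ?Y (frame c)" by (rule smooth_on_subset[OF smooth_frame[OF c(1)]]) auto
  have sB: "smooth_on ?Y B"
    unfolding B_def
    by (intro smooth_on_bilinear[OF Y(1) bounded_bilinear_blinfun_compose] smooth_on_Blinfun_frechet Y sfr smooth_on_const)
  have plane: "tangent_space P (points_on (carrier F) l') p = range (B (snd c (p, l')))"
    if "(p, l') \<in> fst c" "(p, l') \<in> W" for l'
  proof -
    have "snd c (p, l') \<in> ?Y" using that d' by auto
    from Bapp[OF this] show ?thesis
      unfolding tangent_space_points_on[OF c(1) that f'] by auto
  qed
  have TB: "T = range (B ?y)" unfolding T by (rule plane[OF c(2) W])
  have rB: "range (B ?y) = graph_plane g A0" using TB g(4) by simp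
  \<comment> \<open>The parameter at which the graph of \<open>A0\<close>, placed by
    \<open>g\<close>, passes through the frame vector of \<open>u\<close>.\<close>
  define b1 where "b1 = (\<lambda>u. fst (inv g (B ?y u)))"
  have "linear (inv g)" using g(1,2) by (simp add: inj_linear_imp_inv_linear bij_is_inj)
  note linv = linear_add[OF this] linear_scale[OF this]
  \<comment> \<open>A linear map with kernel \<open>T\<close>; it models the quotient by
    \<open>T\<close> in the chart of \<open>g\<close>.\<close>
  define q where "q = (\<lambda>z. snd (inv g z) - A0 *v fst (inv g z))"
  have linq: "linear q"
    unfolding q_def by (rule linearI)
      (simp_all add: linv matrix_vector_right_distrib matrix_vector_mult_scaleR scaleR_diff_right)
  have q0: "q z = 0 \<longleftrightarrow> z \<in> T" for z
  proof
    assume "q z = 0"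
    then have "inv g z = (fst (inv g z), A0 *v fst (inv g z))" by (simp add: q_def prod_eq_iff)
    then have "z = g (fst (inv g z), A0 *v fst (inv g z))" using g(2) by (metis bij_inv_eq_iff)
    then show "z \<in> T" unfolding g(4) graph_plane_def by blast
  next
    assume "z \<in> T"
    then obtain u where "z = g (u, A0 *v u)" unfolding g(4) graph_plane_def by blast
    then show "q z = 0" using g(2) by (simp add: q_def bij_is_inj)
  qed
  \<comment> \<open>Identifies the values of \<open>\<theta>\<close> with tangent vectors of
    \<open>P\<close> modulo \<open>T\<close>. It is injective: if frame vectors of
    \<open>(w, 0, 0)\<close> and \<open>(0, u, 0)\<close> have the same projection, their difference
    lies in the kernel \<open>\<theta> = \<omega> = 0\<close>, so \<open>w = 0\<close>.\<close>
  define N where "N = (\<lambda>w. q (?Df (frame c ?y (w, 0, 0))))"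
  have linN: "linear N"
  proof -
    have lw: "linear (\<lambda>w::real^'n. (w, 0::real^'n, 0::real^'n))" by (rule linearI) simp_all
    have "linear (blinfun_apply (frame c ?y))" by (rule linear_blinfun_apply)
    from linear_compose[OF linear_compose[OF linear_compose[OF lw this] linDf] linq]
    show ?thesis unfolding N_def by (simp add: o_def)
  qed
  have "w = 0" if "N w = 0" for w
  proof -
    have "?Df (frame c ?y (w, 0, 0)) \<in> range (B ?y)" using that unfolding N_def q0 TB .
    then obtain u where "?Df (frame c ?y (w, 0, 0)) = ?Df (frame c ?y (0, u, 0))"
      using Bapp[OF yY] by auto
    then have "?Df (frame c ?y (w, 0, 0) - frame c ?y (0, u, 0)) = 0"
      using linear_diff[OF linDf] by simp
    then have "?Df (frame c ?y (w, - u, 0)) = 0"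
      by (simp add: blinfun.diff_right[symmetric])
    then show ?thesis unfolding kf fi(4) by simp
  qed
  then have injN: "inj N" using linear_injective_0[OF linN] by blast
  \<comment> \<open>Only the \<open>\<theta>\<close> part of \<open>z\<close> survives: the
    \<open>\<omega>\<close> part is projected into \<open>T\<close>, the \<open>\<pi>\<close> part
    to \<open>0\<close>.\<close>
  have qDf: "q (?Df z) = N (fst (coframe c ?y z))" for z
  proof -
    obtain a b e where z: "z = frame c ?y (a, b, e)" "coframe c ?y z = (a, b, e)"
      using frame_coordinates[OF c W] by blast
    have "z = frame c ?y (a, 0, 0) + frame c ?y (0, b, 0) + frame c ?y (0, 0, e)"
      by (simp add: z(1) blinfun.add_right[symmetric])
    then have "q (?Df z) = N a + q (?Df (frame c ?y (0, b, 0))) + q (?Df (frame c ?y (0, 0, e)))"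
      by (simp add: linear_add[OF linDf] linear_add[OF linq] N_def)
    moreover have "q (?Df (frame c ?y (0, b, 0))) = 0"
      unfolding q0 TB using Bapp[OF yY] by (metis rangeI)
    moreover have "?Df (frame c ?y (0, 0, e)) = 0" unfolding kf fi(4) by simp
    ultimately show ?thesis using linear_0[OF linq] by (simp add: z(2))
  qed
  let ?\<tau> = "\<lambda>l. tangent_space P (points_on (carrier F) l) p"
  have curve: "\<forall>u. velocity grassmannian (?\<tau> \<circ> \<gamma>) *v b1 u = N (tableau (p, l) u v)" and bijb1: "bij b1"
    if \<gamma>: "smooth_curve_in L (lines_through (carrier F) p) l \<gamma>"
      and v: "((\<lambda>s. snd c (p, \<gamma> s)) has_vector_derivative frame c ?y (0, 0, v)) (at 0)" for \<gamma> v
  proof -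
    have g0: "\<gamma> 0 = l" using \<gamma> by (simp add: smooth_curve_in_def)
    have dB: "(B has_derivative fderiv B ?y) (at (snd c (p, \<gamma> 0)))"
      unfolding g0 by (rule smooth_on_has_derivative[OF sB yY])
    define B' where "B' = fderiv B ?y (frame c ?y (0, 0, v))"
    have B': "((\<lambda>s. B (snd c (p, \<gamma> s))) has_vector_derivative B') (at 0)"
      using has_derivative_compose[OF v[unfolded has_vector_derivative_def] dB]
        linear_scale[OF has_derivative_linear[OF dB]]
      unfolding has_vector_derivative_def B'_def by simp
    have "openin (mtop F) (fst c \<inter> W)"
      using open_W chart_homeomorphic(1)[OF F, of "fst c" "snd c"] c(1) by auto
    then have "\<forall>\<^sub>F s in nhds 0. (p, \<gamma> s) \<in> fst c \<inter> W"
      by (rule flag_curve_continuous(2)[OF plF _ _ \<gamma>]) (use c W in auto)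
    then obtain S where S: "open S" "0 \<in> S" "\<And>s. s \<in> S \<Longrightarrow> (p, \<gamma> s) \<in> fst c \<inter> W"
      unfolding eventually_nhds by blast
    have rB0: "range (B (snd c (p, \<gamma> 0))) = graph_plane g A0" unfolding g0 by (rule rB)
    obtain A' where A': "((\<lambda>s. inv (graph_plane g) (range (B (snd c (p, \<gamma> s))))) has_vector_derivative A') (at 0)"
      "\<And>u. A' *v fst (inv g (B (snd c (p, \<gamma> 0)) u)) = snd (inv g (B' u)) - A0 *v fst (inv g (B' u))"
      "bij (\<lambda>u. fst (inv g (B (snd c (p, \<gamma> 0)) u)))"
      by (rule graph_plane_curve[OF g(1,2) B' rB0]) blast
    show "bij b1" using A'(3) by (simp add: b1_def g0)
    have "((\<lambda>s. inv (graph_plane g) (?\<tau> (\<gamma> s))) has_vector_derivative A') (at 0)"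
      by (rule has_vector_derivative_transform_within_open[OF A'(1) S(1,2)]) (use S(3) plane in auto)
    then have vel: "velocity grassmannian (?\<tau> \<circ> \<gamma>) = A'"
      unfolding velocity_def by (simp add: g0 T[symmetric] g(3) o_def vector_derivative_at)
    have "B' u = ?Df (frame_bracket (frame c) (0, 0, v) (0, u, 0) ?y)" for u
    proof -
      have "B' u = fderiv (\<lambda>y. B y u) ?y (frame c ?y (0, 0, v))"
        unfolding B'_def using frechet_derivative_blinfun_apply[OF smooth_on_differentiable[OF sB yY]] by metis
      also have "\<dots> = fderiv (\<lambda>y. fderiv f y (frame c y (0, u, 0))) ?y (frame c ?y (0, 0, v))"
        by (rule fun_cong[OF frechet_derivative_cong_open[OF Y(1) yY]]) (simp add: Bapp)
      finally show ?thesis unfolding bracket_kernel_fst[OF c W d f_def] .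
    qed
    then have "q (B' u) = N (fst (coframe c ?y (frame_bracket (frame c) (0, 0, v) (0, u, 0) ?y)))" for u
      by (simp add: qDf)
    \<comment> \<open>Two signs cancel: \<open>torsion\<close> is minus \<open>\<theta>\<close> of
      the bracket, and \<open>tableau\<close> is minus \<open>torsion\<close>.\<close>
    moreover have "fst (coframe c ?y (frame_bracket (frame c) (0, 0, v) (0, u, 0) ?y)) = tableau (p, l) u v" for u
      using torsion_bracket[OF c W, of "(0, 0, v)" "(0, u, 0)"] unfolding tableau_def
      by (simp add: vec_eq_iff)
    ultimately show "\<forall>u. velocity grassmannian (?\<tau> \<circ> \<gamma>) *v b1 u = N (tableau (p, l) u v)"
      using A'(2) unfolding vel by (simp add: b1_def g0 q_def)
  qed
  show thesis
  proof (rule that[OF _ _ linN injN])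
    have "linear (blinfun_apply (B ?y))" by (rule linear_blinfun_apply)
    then show "linear b1" unfolding b1_def by (intro linearI) (simp_all add: linear_add linear_scale linv)
    \<comment> \<open>\<open>graph_plane_curve\<close> yields this along any curve of lines; one of
      velocity \<open>0\<close> will do.\<close>
    show bij: "bij b1" using bijb1 curve_of_lines(2)[OF c W, of 0] by blast
    fix D
    show "D \<in> differential_image L (lines_through (carrier F) p) grassmannian ?\<tau> l
       \<longleftrightarrow> (\<exists>v. \<forall>u. D *v b1 u = N (tableau (p, l) u v))"
    proof
      assume "D \<in> differential_image L (lines_through (carrier F) p) grassmannian ?\<tau> l"
      then obtain \<gamma> where \<gamma>: "D = velocity grassmannian (?\<tau> \<circ> \<gamma>)" "smooth_curve_in L (lines_through (carrier F) p) l \<gamma>"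
        unfolding differential_image_def by blast
      obtain v where "((\<lambda>s. snd c (p, \<gamma> s)) has_vector_derivative frame c ?y (0, 0, v)) (at 0)"
        using curve_of_lines(1)[OF c W \<gamma>(2)] by blast
      from curve[OF \<gamma>(2) this] show "\<exists>v. \<forall>u. D *v b1 u = N (tableau (p, l) u v)" unfolding \<gamma>(1) by blast
    next
      assume "\<exists>v. \<forall>u. D *v b1 u = N (tableau (p, l) u v)"
      then obtain v where v: "\<And>u. D *v b1 u = N (tableau (p, l) u v)" by blast
      obtain \<gamma> where \<gamma>: "smooth_curve_in L (lines_through (carrier F) p) l \<gamma>"
        "((\<lambda>s. snd c (p, \<gamma> s)) has_vector_derivative frame c ?y (0, 0, v)) (at 0)"
        using curve_of_lines(2)[OF c W] by blast
      \<comment> \<open>As \<open>b1\<close> is onto, the values at all \<open>b1 u\<close>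
        determine the matrix.\<close>
      have "D *v z = velocity grassmannian (?\<tau> \<circ> \<gamma>) *v z" for z
      proof -
        obtain u where "z = b1 u" using bij by (metis bij_is_surj surjD)
        then show ?thesis using v curve[OF \<gamma>] by simp
      qed
      then have "D = velocity grassmannian (?\<tau> \<circ> \<gamma>)" by (simp add: matrix_eq)
      then show "D \<in> differential_image L (lines_through (carrier F) p) grassmannian ?\<tau> l"
        unfolding differential_image_def using \<gamma>(1) by blast
    qed
  qed
qed

text \<open>The planes containing a given line of \<open>T\<close> have as tangent space the kernel
  of evaluation at \<open>b1 u\<close>. Adding a subspace to this kernel gives all matrices exactly
  if evaluation at \<open>b1 u\<close> maps the subspace onto \<open>\<real>^n\<close>. The maps
  \<open>b1\<close> and \<open>N\<close> change coordinates only and do not affect the condition on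
  the tableau.\<close>

lemma regular_at_iff:
  assumes W: "(p, l) \<in> W"
  shows "regular_at P L F (p, l) \<longleftrightarrow> (\<forall>u v. u \<noteq> 0 \<longrightarrow> v \<noteq> 0 \<longrightarrow> tableau (p, l) u v \<noteq> 0)"
proof -
  let ?\<tau> = "\<lambda>l. tangent_space P (points_on (carrier F) l) p"
  define T where "T = ?\<tau> l"
  define DI where "DI = differential_image L (lines_through (carrier F) p) grassmannian ?\<tau> l"
  have "T \<in> carrier grassmannian"
    unfolding T_def by (rule tangent_space_in_grassmannian[OF W])
  then obtain g A0 where g: "linear g" "bij g" "chart_at grassmannian T = (range (graph_plane g), inv (graph_plane g))"
    "T = graph_plane g A0"
    by (rule graph_plane_chart_at)
  obtain b1 N :: "real^'n \<Rightarrow> real^'n" where b1: "linear b1" "bij b1" and N: "linear N" "inj N"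
    and DI: "\<And>D. D \<in> DI \<longleftrightarrow> (\<exists>v. \<forall>u. D *v b1 u = N (tableau (p, l) u v))"
    unfolding DI_def by (rule tangent_plane_derivative[OF W T_def g]) blast
  note bil = tableau_bilinear[OF W]
  have linr: "linear (tableau (p, l) u)" and linl: "linear (\<lambda>u. tableau (p, l) u v)" for u v
    using bil unfolding bilinear_def by auto
  \<comment> \<open>Onto and injective agree in equal dimensions, and the injective \<open>N\<close>
    drops out of the condition.\<close>
  have surj_iff: "surj (\<lambda>v. N (tableau (p, l) u v)) \<longleftrightarrow> (\<forall>v. v \<noteq> 0 \<longrightarrow> tableau (p, l) u v \<noteq> 0)" for u
  proof -
    have lin: "linear (\<lambda>v. N (tableau (p, l) u v))"
      using linear_compose[OF linr N(1)] by (simp add: o_def)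
    have "surj (\<lambda>v. N (tableau (p, l) u v)) \<longleftrightarrow> inj (\<lambda>v. N (tableau (p, l) u v))"
      using linear_surjective_imp_injective[OF lin] linear_injective_imp_surjective[OF lin] by auto
    also have "\<dots> \<longleftrightarrow> (\<forall>v. N (tableau (p, l) u v) = 0 \<longrightarrow> v = 0)"
      by (rule linear_injective_0[OF lin])
    also have "\<dots> \<longleftrightarrow> (\<forall>v. v \<noteq> 0 \<longrightarrow> tableau (p, l) u v \<noteq> 0)"
      using N linear_injective_0[OF N(1)] linear_0[OF N(1)] by metis
    finally show ?thesis .
  qed
  have transverse: "transverse_at L (lines_through (carrier F) p) grassmannian ?\<tau>
      {W \<in> carrier grassmannian. span {g (b1 u, A0 *v b1 u)} \<subseteq> W} l \<longleftrightarrow> surj (\<lambda>v. N (tableau (p, l) u v))"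
    if u: "u \<noteq> 0" for u
  proof -
    let ?k = "g (b1 u, A0 *v b1 u)" and ?Z = "{W \<in> carrier grassmannian. span {g (b1 u, A0 *v b1 u)} \<subseteq> W}"
    have b1u: "b1 u \<noteq> 0"
      using u b1 linear_injective_0[OF b1(1)] by (auto simp: bij_def)
    have "?k \<in> T" unfolding g(4) graph_plane_def by blast
    moreover have "subspace T" using \<open>T \<in> carrier grassmannian\<close> by (simp add: carrier_grassmannian)
    ultimately have "T \<in> ?Z"
      using \<open>T \<in> carrier grassmannian\<close> span_minimal[of "{?k}" T] by simp
    moreover have "tangent_space grassmannian ?Z T = {M. M *v b1 u = 0}"
      by (rule tangent_space_incident_planes[OF g(1,2,3,4) refl])
    ultimately have "transverse_at L (lines_through (carrier F) p) grassmannian ?\<tau> ?Z l \<longleftrightarrow>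
        {a + b | a b. a \<in> DI \<and> b \<in> {M. M *v b1 u = 0}} = UNIV"
      by (simp add: transverse_at_def T_def[symmetric] DI_def)
    also have "\<dots> \<longleftrightarrow> surj (\<lambda>v. N (tableau (p, l) u v))"
    proof
      assume tr: "{a + b | a b. a \<in> DI \<and> b \<in> {M. M *v b1 u = 0}} = UNIV"
      show "surj (\<lambda>v. N (tableau (p, l) u v))"
        unfolding surj_def
      proof
        fix r
        \<comment> \<open>The rank one matrix that sends \<open>b1 u\<close> to \<open>r\<close> and
          vanishes on its orthogonal complement.\<close>
        define M :: "real^'n^'n" where "M = (\<chi> i j. r $ i * b1 u $ j / (b1 u \<bullet> b1 u))"
        have M: "M *v b1 u = r"
        proof -
          have "(M *v b1 u) $ i = r $ i * ((\<Sum>j\<in>UNIV. b1 u $ j * b1 u $ j) / (b1 u \<bullet> b1 u))" for i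
            by (simp add: M_def matrix_vector_mult_def sum_divide_distrib sum_distrib_left mult.assoc)
          moreover have "(\<Sum>j\<in>UNIV. b1 u $ j * b1 u $ j) = b1 u \<bullet> b1 u" by (simp add: inner_vec_def)
          moreover have "b1 u \<bullet> b1 u / (b1 u \<bullet> b1 u) = 1" using b1u by simp
          ultimately have "(M *v b1 u) $ i = r $ i" for i by (simp only: mult_1_right)
          then show ?thesis by (simp add: vec_eq_iff)
        qed
        have "M \<in> {a + b | a b. a \<in> DI \<and> b \<in> {M. M *v b1 u = 0}}" unfolding tr by simp
        then obtain a b where ab: "M = a + b" "a \<in> DI" "b *v b1 u = 0" by blast
        then have "a *v b1 u = r" using M by (simp add: matrix_vector_mult_add_rdistrib)
        then show "\<exists>v. r = N (tableau (p, l) u v)" using ab(2) unfolding DI by metis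
      qed
    next
      assume sj: "surj (\<lambda>v. N (tableau (p, l) u v))"
      have "M \<in> {a + b | a b. a \<in> DI \<and> b \<in> {M. M *v b1 u = 0}}" for M
      proof -
        obtain v where v: "M *v b1 u = N (tableau (p, l) u v)" using sj by (metis surjD)
        have "linear (inv b1)" using b1 by (simp add: inj_linear_imp_inv_linear bij_is_inj)
        from linear_compose[OF linear_compose[OF this linl[of v]] N(1)]
        have lin: "linear (\<lambda>z. N (tableau (p, l) (inv b1 z) v))" by (simp add: o_def)
        \<comment> \<open>The element of \<open>DI\<close> that belongs to \<open>v\<close>,
          obtained by undoing \<open>b1\<close>. By the choice of \<open>v\<close> it agrees with
          \<open>M\<close> at \<open>b1 u\<close>, so \<open>M - a\<close> is tangent to the
          incident planes.\<close>
        define a where "a = matrix (\<lambda>z. N (tableau (p, l) (inv b1 z) v))"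
        have a: "a *v z = N (tableau (p, l) (inv b1 z) v)" for z
          unfolding a_def by (rule fun_cong[OF matrix_vector_mul(2)[OF lin]])
        have "a *v b1 u' = N (tableau (p, l) u' v)" for u'
          using a b1(2) by (simp add: bij_is_inj)
        then have "a \<in> DI" "(M - a) *v b1 u = 0"
          using v unfolding DI by (auto simp: matrix_vector_mult_diff_rdistrib)
        then show ?thesis by (intro CollectI exI[of _ a] exI[of _ "M - a"]) simp
      qed
      then show "{a + b | a b. a \<in> DI \<and> b \<in> {M. M *v b1 u = 0}} = UNIV" by blast
    qed
    finally show ?thesis .
  qed
  \<comment> \<open>As \<open>b1\<close> is onto, every vector of \<open>T\<close> is some
    \<open>g (b1 u, A0 *v b1 u)\<close>, so quantifying over lines in \<open>T\<close> amounts to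
    quantifying over nonzero \<open>u\<close>.\<close>
  have lines: "(subspace K \<and> dim K = 1 \<and> K \<subseteq> T) \<longleftrightarrow> (\<exists>u. u \<noteq> 0 \<and> K = span {g (b1 u, A0 *v b1 u)})" for K
  proof
    assume K: "subspace K \<and> dim K = 1 \<and> K \<subseteq> T"
    obtain B where B: "B \<subseteq> K" "independent B" "K \<subseteq> span B" "card B = dim K"
      using basis_exists[of K] by blast
    then obtain k where k: "B = {k}" using K by (metis card_1_singletonE)
    then have "K = span {k}" using B K span_minimal[of B K] by blast
    moreover have "k \<in> T" "k \<noteq> 0" using B K k by (auto simp: dependent_single)
    moreover obtain z where z: "k = g (z, A0 *v z)"
      using \<open>k \<in> T\<close> unfolding g(4) graph_plane_def by blast
    moreover obtain u where "z = b1 u" using b1(2) by (metis bij_is_surj surjD)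
    moreover have "u \<noteq> 0"
      using \<open>k \<noteq> 0\<close> z \<open>z = b1 u\<close> linear_0[OF b1(1)] linear_0[OF g(1)] by (auto simp: zero_prod_def)
    ultimately show "\<exists>u. u \<noteq> 0 \<and> K = span {g (b1 u, A0 *v b1 u)}" by blast
  next
    assume "\<exists>u. u \<noteq> 0 \<and> K = span {g (b1 u, A0 *v b1 u)}"
    then obtain u where u: "u \<noteq> 0" "K = span {g (b1 u, A0 *v b1 u)}" by blast
    have "b1 u \<noteq> 0"
      using u b1 linear_injective_0[OF b1(1)] by (auto simp: bij_def)
    then have "(b1 u, A0 *v b1 u) \<noteq> 0" by (simp add: zero_prod_def)
    then have "g (b1 u, A0 *v b1 u) \<noteq> 0"
      using g(2) linear_injective_0[OF g(1)] by (auto simp: bij_def)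
    then have "independent {g (b1 u, A0 *v b1 u)}" by (simp add: dependent_single)
    then have "dim K = 1" unfolding u(2) using dim_span_eq_card_independent by fastforce
    moreover have "g (b1 u, A0 *v b1 u) \<in> T" unfolding g(4) graph_plane_def by blast
    moreover have "subspace T" using \<open>T \<in> carrier grassmannian\<close> by (simp add: carrier_grassmannian)
    ultimately show "subspace K \<and> dim K = 1 \<and> K \<subseteq> T"
      unfolding u(2) by (simp add: span_minimal)
  qed
  have "regular_at P L F (p, l) \<longleftrightarrow> (\<forall>K. (\<exists>u. u \<noteq> 0 \<and> K = span {g (b1 u, A0 *v b1 u)}) \<longrightarrow>
      transverse_at L (lines_through (carrier F) p) grassmannian ?\<tau> {W \<in> carrier grassmannian. K \<subseteq> W} l)"
    unfolding regular_at_def case_prod_conv T_def[symmetric] lines ..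
  also have "\<dots> \<longleftrightarrow> (\<forall>u. u \<noteq> 0 \<longrightarrow> surj (\<lambda>v. N (tableau (p, l) u v)))"
    using transverse by blast
  finally show ?thesis unfolding surj_iff by blast
qed

end

theorem proposition1:
  fixes P :: "('p, 'n::finite) manifold_2n"
    and L :: "('l, 'n) manifold_2n"
    and F :: "('p \<times> 'l, 'n) manifold_3n"
    and W :: "('p \<times> 'l) set"
    and \<theta> \<omega> \<pi> :: "'n \<Rightarrow> ('p \<times> 'l, (real^'n) \<times> (real^'n) \<times> (real^'n)) one_form"
  assumes "smooth_projective_plane P L F"
    and "adapted_coframing P L F W \<theta> \<omega> \<pi>"
  shows "(\<exists>\<eta> t. structure_equations F W \<theta> \<omega> \<pi> \<eta> t) \<and>
    (\<forall>\<eta> t. structure_equations F W \<theta> \<omega> \<pi> \<eta> t \<longrightarrow>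
      (\<forall>x\<in>W. triality (tableau_map t x) \<longleftrightarrow> regular_at P L F x))"
proof -
  have PLF: "smooth_manifold P" "smooth_manifold L" and emb: "embedded_submanifold F (prod_manifold P L)"
    using assms(1) unfolding smooth_projective_plane_def by simp_all
  interpret incidence_coframing P L F W \<theta> \<omega> \<pi>
  proof
    have F: "smooth_manifold F"
      using emb unfolding embedded_submanifold_def by (elim conjE)
    have top: "mtop F = subtopology (mtop (prod_manifold P L)) (carrier F)"
      using emb unfolding embedded_submanifold_def by (elim conjE)
    have sm: "smooth_map_on F (prod_manifold P L) (carrier F) (\<lambda>x. x)"
      using emb unfolding embedded_submanifold_def by (elim conjE)
    show "smooth_manifold F" by (rule F)
    show "mtop F = subtopology (prod_topology (mtop P) (mtop L)) (carrier F)"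
      using top unfolding prod_manifold_def manifold.simps .
    show "smooth_map_on F P (carrier F) fst" "smooth_map_on F L (carrier F) snd"
      using smooth_map_on_prod[OF sm] by simp_all
  qed (use assms PLF in auto)
  have "triality (tableau_map t x) \<longleftrightarrow> regular_at P L F x"
    if "structure_equations F W \<theta> \<omega> \<pi> \<eta> t" "x \<in> W" for \<eta> t x
  proof -
    obtain p l where x: "x = (p, l)" by fastforce
    \<comment> \<open>All three spaces are \<open>real^'n\<close> and the tableau is bilinear, so of
      \<open>triality\<close> only the nonvanishing remains.\<close>
    show ?thesis
      unfolding tableau_map_eq[OF that] triality_def
      using regular_at_iff[of p l] tableau_bilinear[OF that(2)] that(2) by (simp add: x)
  qed
  then show ?thesis using structure_equations_exist by blast
qed

end
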